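(* Let $p,q\ge 2$ be integers with $p\ne q$, let $n,m\ge 1$ with $m_1\ge 1$ and $n_1\ge 1$, and let $\mathcal F=\{f_i\}_{i\ge0}$ be a family as in the context. Assume: (a) $f_1$ is an odd function, $f_1\ge 0$ on $[0,T]$ and $f_1\not\equiv 0$ on $[0,T]$; (b) for every integer $r\ge 1$, the set $\{f_i^e\}_{i\in\mathcal N_r^{\text{non-odd}}}$, ordered by increasing index, is a CT-system on $(0,T)$; (c) for all integers $k,l\ge 1$, $\tilde F_l^e\tilde f_k^o\in\mathcal B_{k+l-1}\setminus\mathcal B_{k+l-2}$, and moreover $m_1\ge\min\{m-m_1-1,\;n_1-1\}$. Let $M_1(\cdot\,;\mu)$ and $M_2(\cdot\,;\mu)$ be the first- and second-order Melnikov functions of the perturbed equation $$\frac{dx}{dt}=\big(f_1(t)+\varepsilon P_1(t)+\varepsilon^2P_2(t)\big)x^p+\big(\varepsilon Q_1(t)+\varepsilon^2Q_2(t)\big)x^q ,$$ with parameter vector $\mu\in\mathbb R^{2(n+m+2)}$ as in the context. Suppose $M_1(\cdot\,;\mu)\equiv0$ and $M_2(\cdot\,;\mu)\not\equiv 0$. Let $K=\max\{m-m_1+n_1,\;m_1+1\}$, and let $Z(M_2)^+$ (resp. $Z(M_2)^-$) be the number of zeros of $M_2(\cdot\,;\mu)$ on $J\cap(0,+\infty)$ (resp. $J\cap(-\infty,0)$), counted with multiplicities. Then the following hold, where in each existence assertion $\mu_0\in\mathbb R^{2(n+m+2)}$ is a parameter with $M_1(\cdot\,;\mu_0)\equiv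 0$: (i) If $p$ and $q$ are both odd, then $Z(M_2)^{+}\le K$ and $Z(M_2)^-\le K$. Moreover, there exists $\mu_0$ such that $M_2(\cdot\,;\mu_0)$ has $2K$ simple zeros in $J\setminus\{0\}$. (ii) If $p$ is odd and $q$ is even, then $Z(M_2)^{+}\le K$ and $Z(M_2)^-\le K$, and the two equalities cannot hold simultaneously. Moreover: (ii.1) when $p<q$, there exists $\mu_0$ such that $M_2(\cdot\,;\mu_0)$ has $2K-1$ simple zeros in $J\setminus\{0\}$; (ii.2) when $p>q$, there exists $\mu_0$ such that $M_2(\cdot\,;\mu_0)$ has $2(K-1)$ simple zeros in $J\setminus\{0\}$. (iii) If $p$ is even, $q$ is odd and $p<q$, then $Z(M_2)^{+}+Z(M_2)^-\le K$. Moreover, there exists $\mu_0$ such that $M_2(\cdot\,;\mu_0)$ has $K$ simple zeros in $J\setminus\{0\}$. (iv) If $p$ is even and either $q$ is even or $p>q$, then $Z(M_2)^{+}+Z(M_2)^-\le K+1$. Moreover, there exists $\mu_0$ such that $M_2(\cdot\,;\mu_0)$ has $K+1$ simple zeros in $J\setminus\{0\}$.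
   Context: Family. Fix $T>0$. $\mathcal F=\{f_i\}_{i=0}^\infty$ is a sequence of real-analytic functions on an open neighborhood of $[-T,T]$ with $f_0(t)>0$ on $[-T,T]$ and $\int_{-T}^Tf_k(t)\,dt=0$ for all $k\ge1$. Put $\mathcal F_k=\{f_0,\dots,f_k\}$. The even and odd parts of $f_i$ are $f_i^e(t)=\frac{f_i(t)+f_i(-t)}2$ and $f_i^o(t)=\frac{f_i(t)-f_i(-t)}2$, and $F_i^e(t)=\int_{-T}^tf_i^e(s)\,ds$. Index sets and relabeling. $\mathcal N_k=\{0,1,\dots,k\}$, $\mathcal N_k^{\text{odd}}=\{i\in\mathcal N_k: f_i^e\equiv0\text{ on }[-T,T]\}$ and $\mathcal N_k^{\text{non-odd}}=\{i\in\mathcal N_k: f_i^e\not\equiv0\text{ on }[-T,T]\}$. Set $m_1=\#\mathcal N_m^{\text{non-odd}}-1$ and $n_1=\#\mathcal N_n^{\text{non-odd}}-1$. List the indices $i$ with $f_i^e\not\equiv0$ in increasing order as $0=i_0<i_1<i_2<\cdots$ and the indices with $f_i^e\equiv 0$ in increasing order as $j_1<j_2<\cdots$; set $\tilde f_l^e=f_{i_l}^e$, $\tilde F_l^e=F_{i_l}^e$ ($l\ge0$) and $\tilde f_k^o=f_{j_k}^o=f_{j_k}$ ($k\ge1$). (Assumption (c) includes that these are defined for all indices $l,k\ge1$, i.e. $\mathcal F$ contains infinitely many odd and infinitely many non-odd functions. Under (a), $\tilde f_1^o=f_1$.) For $r\ge1$ let $\mathcal B_r=\operatorname{span}\{\tilde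 F_1^e\tilde f_1^o,\dots,\tilde F_r^e\tilde f_1^o\}$ (real span of functions on $[-T,T]$), and $\mathcal B_0=\{0\}$. CT-system. An ordered set $(g_0,\dots,g_n)$ of analytic functions on an open interval $I$ is a complete Chebyshev system (CT-system) on $I$ if for every $k\in\{0,\dots,n\}$ every linear combination $\alpha_0g_0+\dots+\alpha_kg_k$ with $(\alpha_0,\dots,\alpha_k)\ne 0$ has at most $k$ zeros on $I$ (in particular it is not identically zero). Perturbed equation. For $i=1,2$, $P_i=\sum_{j=0}^na_{ij}f_j$ and $Q_i=\sum_{j=0}^mb_{ij}f_j$ with real coefficients; $\mu\in\mathbb R^{2(n+m+2)}$ is the vector of all coefficients $a_{ij}$ ($i=1,2$, $0\le j\le n$) and $b_{ij}$ ($i=1,2$, $0\le j\le m$). Let $x_\varepsilon(t,\rho;\mu)$ be the solution with $x_\varepsilon(-T,\rho;\mu)=\rho$. With $F_1(t)=\int_{-T}^tf_1(s)\,ds$, for $\varepsilon=0$ it is $x_0(t,\rho)=\rho\,\big(1+(1-p)\rho^{p-1}F_1(t)\big)^{-1/(p-1)}$, defined on $[-T,T]$ for $\rho$ in $J=\{\rho\in\mathbb R: 1+(1-p)\rho^{p-1}F_1(t)>0\ \text{for all }t\in[-T,T]\}$, and $x_0(T,\rho)=\rho$ for $\rho\in J$. For $\rho\in J$ one has the expansion $x_\varepsilon(T,\rho;\mu)-\rho=\sum_{i\ge1}\varepsilon^iM_i(\rho;\mu)$ for small $\varepsilon$, with $M_i$ analytic on $J\times\mathbb R^{2(n+m+2)}$;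 $M_i$ is the $i$-th order Melnikov function. *)

theory Defs
  imports "HOL-Analysis.Analysis"
begin

section \<open>Real-analytic functions, zeros and Chebyshev systems\<close>

definition real_analytic_on :: "(real \<Rightarrow> real) \<Rightarrow> real set \<Rightarrow> bool" where
  "real_analytic_on g S \<longleftrightarrow> (\<forall>x\<in>S. \<exists>G. (\<lambda>h. g (x + h)) has_fps_expansion G)"

text \<open>Multiplicity of the zero \<open>x\<close> of an analytic function: the order of the first
  non-vanishing derivative (infinite if the function is flat at \<open>x\<close>).\<close>

definition zero_multiplicity :: "(real \<Rightarrow> real) \<Rightarrow> real \<Rightarrow> enat" where
  "zero_multiplicity g x =
     (if \<exists>k. (deriv ^^ k) g x \<noteq> 0 then enat (LEAST k. (deriv ^^ k) g x \<noteq> 0) else \<infinity>)"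

definition num_zeros_mult :: "(real \<Rightarrow> real) \<Rightarrow> real set \<Rightarrow> enat" where
  "num_zeros_mult g S =
     (if finite {x \<in> S. g x = 0} then (\<Sum>x\<in>{x \<in> S. g x = 0}. zero_multiplicity g x) else \<infinity>)"

definition simple_zeros :: "(real \<Rightarrow> real) \<Rightarrow> real set \<Rightarrow> real set" where
  "simple_zeros g S = {x \<in> S. g x = 0 \<and> (\<exists>D. D \<noteq> 0 \<and> (g has_real_derivative D) (at x))}"

text \<open>The list \<open>gs\<close> is the ordered set \<open>(g\<^sub>0, \<dots>, g\<^sub>n)\<close>, where \<open>length gs = n + 1\<close>.\<close>

definition CT_system :: "(real \<Rightarrow> real) list \<Rightarrow> real set \<Rightarrow> bool" where
  "CT_system gs I \<longleftrightarrow>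
     (\<forall>g\<in>set gs. real_analytic_on g I) \<and>
     (\<forall>k<length gs. \<forall>\<alpha>::nat \<Rightarrow> real. (\<exists>i\<le>k. \<alpha> i \<noteq> 0) \<longrightarrow>
        finite {t \<in> I. (\<Sum>i\<le>k. \<alpha> i * (gs ! i) t) = 0} \<and>
        card {t \<in> I. (\<Sum>i\<le>k. \<alpha> i * (gs ! i) t) = 0} \<le> k)"


section \<open>The family of coefficient functions\<close>

definition even_part :: "(real \<Rightarrow> real) \<Rightarrow> real \<Rightarrow> real" where
  "even_part g t = (g t + g (- t)) / 2"

definition odd_indices :: "(nat \<Rightarrow> real \<Rightarrow> real) \<Rightarrow> real \<Rightarrow> nat set" where
  "odd_indices f T = {i. \<forall>t\<in>{-T..T}. even_part (f i) t = 0}"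

definition nonodd_indices :: "(nat \<Rightarrow> real \<Rightarrow> real) \<Rightarrow> real \<Rightarrow> nat set" where
  "nonodd_indices f T = {i. \<exists>t\<in>{-T..T}. even_part (f i) t \<noteq> 0}"

definition nonodd_upto :: "(nat \<Rightarrow> real \<Rightarrow> real) \<Rightarrow> real \<Rightarrow> nat \<Rightarrow> nat set" where
  "nonodd_upto f T k = {i \<in> {0..k}. i \<in> nonodd_indices f T}"

text \<open>The relabelled functions. \<open>enumerate\<close> lists an infinite set of naturals increasingly,
  starting with argument 0; so \<open>i\<^sub>l\<close> is \<open>enumerate (nonodd_indices f T) l\<close> for \<open>l \<ge> 0\<close>, and
  \<open>j\<^sub>k\<close> is \<open>enumerate (odd_indices f T) (k - 1)\<close> for \<open>k \<ge> 1\<close>.\<close>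

definition F_tilde_even :: "(nat \<Rightarrow> real \<Rightarrow> real) \<Rightarrow> real \<Rightarrow> nat \<Rightarrow> real \<Rightarrow> real" where
  "F_tilde_even f T l t = integral {-T..t} (even_part (f (enumerate (nonodd_indices f T) l)))"

definition f_tilde_odd :: "(nat \<Rightarrow> real \<Rightarrow> real) \<Rightarrow> real \<Rightarrow> nat \<Rightarrow> real \<Rightarrow> real" where
  "f_tilde_odd f T k = f (enumerate (odd_indices f T) (k - 1))"

text \<open>The span \<open>\<B>\<^sub>r\<close>, a space of functions on \<open>[-T, T]\<close>: membership of a function on the whole
  line depends only on its restriction to \<open>[-T, T]\<close>.\<close>

definition B_space :: "(nat \<Rightarrow> real \<Rightarrow> real) \<Rightarrow> real \<Rightarrow> nat \<Rightarrow> (real \<Rightarrow> real) set" where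
  "B_space f T r =
     {g. \<exists>c::nat \<Rightarrow> real. \<forall>t\<in>{-T..T}. g t = (\<Sum>i=1..r. c i * (F_tilde_even f T i t * f_tilde_odd f T 1 t))}"


section \<open>The perturbed equation and its Melnikov functions\<close>

text \<open>A parameter \<open>\<mu> = (a, b)\<close> consists of the coefficients \<open>a i j\<close> (\<open>i = 1, 2\<close>, \<open>j \<le> n\<close>) and
  \<open>b i j\<close> (\<open>i = 1, 2\<close>, \<open>j \<le> m\<close>); the values at all other indices are never used, so
  quantifying over \<open>params\<close> amounts to quantifying over real vectors of length \<open>2 (n + m + 2)\<close>.\<close>

type_synonym params = "(nat \<Rightarrow> nat \<Rightarrow> real) \<times> (nat \<Rightarrow> nat \<Rightarrow> real)"

definition P_pert :: "(nat \<Rightarrow> real \<Rightarrow> real) \<Rightarrow> nat \<Rightarrow> params \<Rightarrow> nat \<Rightarrow> real \<Rightarrow> real" where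
  "P_pert f n \<mu> i t = (\<Sum>j=0..n. fst \<mu> i j * f j t)"

definition Q_pert :: "(nat \<Rightarrow> real \<Rightarrow> real) \<Rightarrow> nat \<Rightarrow> params \<Rightarrow> nat \<Rightarrow> real \<Rightarrow> real" where
  "Q_pert f m \<mu> i t = (\<Sum>j=0..m. snd \<mu> i j * f j t)"

definition is_solution ::
  "(nat \<Rightarrow> real \<Rightarrow> real) \<Rightarrow> real \<Rightarrow> nat \<Rightarrow> nat \<Rightarrow> nat \<Rightarrow> nat \<Rightarrow> params \<Rightarrow> real \<Rightarrow> (real \<Rightarrow> real) \<Rightarrow> bool" where
  "is_solution f T p q n m \<mu> \<epsilon> x \<longleftrightarrow>
     (\<forall>t\<in>{-T..T}. (x has_real_derivative
        ((f 1 t + \<epsilon> * P_pert f n \<mu> 1 t + \<epsilon>\<^sup>2 * P_pert f n \<mu> 2 t) * x t ^ p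
         + (\<epsilon> * Q_pert f m \<mu> 1 t + \<epsilon>\<^sup>2 * Q_pert f m \<mu> 2 t) * x t ^ q)) (at t within {-T..T}))"

text \<open>The value \<open>x\<^sub>\<epsilon>(T, \<rho>; \<mu>)\<close> of the solution starting at \<open>x\<^sub>\<epsilon>(-T, \<rho>; \<mu>) = \<rho>\<close> (unspecified if
  that solution does not exist up to time \<open>T\<close>).\<close>

definition end_value ::
  "(nat \<Rightarrow> real \<Rightarrow> real) \<Rightarrow> real \<Rightarrow> nat \<Rightarrow> nat \<Rightarrow> nat \<Rightarrow> nat \<Rightarrow> params \<Rightarrow> real \<Rightarrow> real \<Rightarrow> real" where
  "end_value f T p q n m \<mu> \<rho> \<epsilon> =
     (THE y. \<exists>x. is_solution f T p q n m \<mu> \<epsilon> x \<and> x (- T) = \<rho> \<and> x T = y)"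

text \<open>The coefficient of \<open>\<epsilon>\<^sup>i\<close> in the power series expansion of
  \<open>x\<^sub>\<epsilon>(T, \<rho>; \<mu>) - \<rho>\<close> at \<open>\<epsilon> = 0\<close>; relevant for \<open>\<rho>\<close> in \<open>J\<close> only.\<close>

definition melnikov ::
  "(nat \<Rightarrow> real \<Rightarrow> real) \<Rightarrow> real \<Rightarrow> nat \<Rightarrow> nat \<Rightarrow> nat \<Rightarrow> nat \<Rightarrow> nat \<Rightarrow> params \<Rightarrow> real \<Rightarrow> real" where
  "melnikov f T p q n m i \<mu> \<rho> =
     fps_nth (THE G. (\<lambda>\<epsilon>. end_value f T p q n m \<mu> \<rho> \<epsilon> - \<rho>) has_fps_expansion G) i"

definition J_domain :: "(nat \<Rightarrow> real \<Rightarrow> real) \<Rightarrow> real \<Rightarrow> nat \<Rightarrow> real set" where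
  "J_domain f T p =
     {\<rho>. \<forall>t\<in>{-T..T}. 1 + (1 - real p) * \<rho> ^ (p - 1) * integral {-T..t} (f 1) > 0}"

end

theory Submission
  imports Defs
begin

text \<open>
  In the variable \<open>s = (p - 1) \<rho>\<^sup>p\<^sup>-\<^sup>1\<close> and with \<open>\<alpha> = (q - p)/(p - 1)\<close> the second Melnikov function,
  once the first one vanishes, has the form
  \<open>M\<^sub>2(\<rho>) = A \<rho>\<^sup>p + \<rho>\<^sup>q \<integral> g(t) (1 - s F\<^sub>1(t))\<^sup>-\<^sup>\<alpha> dt\<close>, where \<open>g\<close> runs through the span of the even parts
  \<open>f\<^sub>0\<^sup>e, \<dots>\<close> once the products \<open>F\<^sup>e f\<^sup>o\<close> have been integrated by parts into that span.
  Dividing by \<open>\<rho>\<^sup>p\<close> and differentiating removes \<open>A\<close> and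
  leaves \<open>\<rho>\<^sup>q\<^sup>-\<^sup>p\<^sup>-\<^sup>1\<close> times an integral of the same kind with exponent \<open>\<alpha> + 1\<close>.
  Since \<open>F\<^sub>1\<close> is monotone on \<open>[0, T]\<close>, the kernel is totally positive, so such an integral has at most
  as many zeros as \<open>g\<close> has sign changes, and the Chebyshev property bounds those.
  The expansion in \<open>\<epsilon>\<close> comes from solving the equation in power series in \<open>\<epsilon>\<close>, whose
  convergence is controlled by geometric majorants.
  For sharpness one prescribes zeros in the Chebyshev space, reflects them by parity, and creates the
  remaining ones by splitting the zero at \<open>\<rho> = 0\<close> with small perturbations.\<close>

section \<open>Integrals with a power kernel\<close>

text \<open>The count is governed by \<open>K = L + 1\<close>: \<open>g\<close> runs through a space
  of dimension \<open>L + 1\<close>, so a nonzero \<open>g\<close> has at most \<open>L\<close>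
  zeros in (0, T), and removing \<open>A\<close> by Rolle costs one more zero for each interval on
  which Rolle applies. The parity cases differ in how \<rho> maps to \<open>s\<close> and in what
  happens at \<rho> = 0. For odd \<open>p\<close> the points \<rho> and -\<rho> share one
  \<open>s\<close>, so each side has its own budget; for even \<open>p\<close> the map is injective
  and both sides share one. In the latter case Rolle can cross 0 if \<rho>^(q-p-1) is regular there
  and keeps its sign, that is, if p < q and \<open>q\<close> is odd. The exponents \<alpha>,
  \<alpha> + 1, ... never vanish, since \<alpha> + 1 = (q-1)/(p-1) > 0 and p \<noteq> q; a zero
  exponent would stop the differentiation. The Melnikov functions are definite descriptions of a
  solution value and of a series, so existence, uniqueness and convergence must be settled before
  any formula is available. Sharpness needs every coefficient vector of \<open>g\<close>, whereas
  the products of first-order coefficients give only a bilinear image; the inequality between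
  \<open>m\<close>, \<open>m1\<close>, \<open>n1\<close> makes that image large enough.\<close>

lemma homogeneous_system_nontrivial_solution:
  fixes M :: "'i \<Rightarrow> 'j \<Rightarrow> real"
  assumes "finite I" "finite J" "card I < card J"
  shows "\<exists>c. (\<exists>j\<in>J. c j \<noteq> 0) \<and> (\<forall>i\<in>I. (\<Sum>j\<in>J. c j * M i j) = 0)"
  using assms
proof (induction I arbitrary: J M rule: finite_induct)
  case empty
  then have "J \<noteq> {}" by auto
  then show ?case by (intro exI[of _ "\<lambda>_. 1"]) auto
next
  case (insert i I)
  show ?case
  proof (cases "\<forall>j\<in>J. M i j = 0")
    case True
    have "card I < card J" using insert by simp
    from insert.IH[OF insert.prems(1) this, of M] True show ?thesis by auto
  next
    case False
    then obtain j0 where j0: "j0 \<in> J" "M i j0 \<noteq> 0" by auto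
    \<comment> \<open>Gaussian elimination with pivot \<open>M i j0\<close>: the other rows lose the
      unknown \<open>j0\<close>, whose value is recovered from row \<open>i\<close> in
      \<open>d\<close>.\<close>
    let ?J = "J - {j0}"
    have "card I < card ?J" using insert j0 by simp
    from insert.IH[OF _ this, of "\<lambda>i' j. M i' j - M i' j0 * M i j / M i j0"] insert.prems
    obtain c where c: "\<exists>j\<in>?J. c j \<noteq> 0"
      "\<And>i'. i' \<in> I \<Longrightarrow> (\<Sum>j\<in>?J. c j * (M i' j - M i' j0 * M i j / M i j0)) = 0" by auto
    define d where "d = c(j0 := - (\<Sum>j\<in>?J. c j * M i j) / M i j0)"
    have split: "(\<Sum>j\<in>J. d j * N j) = d j0 * N j0 + (\<Sum>j\<in>?J. c j * N j)" for N
      using insert.prems j0 by (subst sum.remove[of _ j0]) (auto simp: d_def intro!: sum.cong)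
    have "(\<Sum>j\<in>J. d j * M i' j) = 0" if "i' \<in> I" for i'
      unfolding split using c(2)[OF that] j0
      by (simp add: d_def algebra_simps sum_subtractf sum_distrib_left sum_divide_distrib)
    moreover have "(\<Sum>j\<in>J. d j * M i j) = 0"
      unfolding split using j0 by (simp add: d_def)
    moreover have "\<exists>j\<in>J. d j \<noteq> 0" using c(1) by (auto simp: d_def)
    ultimately show ?thesis by (intro exI[of _ d]) auto
  qed
qed

text \<open>Bookkeeping for Rolle: one point is picked in each gap between neighbours. The clause
  that each \<open>y\<close> lies below some \<open>x\<close> carries the induction on the maximum,
  since it makes a point chosen above \<open>Max A\<close> new.\<close>

lemma finite_gap_points:
  fixes X :: "real set"
  assumes "finite X" "\<And>a b. a \<in> X \<Longrightarrow> b \<in> X \<Longrightarrow> a < b \<Longrightarrow> \<exists>y>a. y < b \<and> Q y"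
  shows "\<exists>Y. finite Y \<and> card X \<le> card Y + 1 \<and> Y \<inter> X = {} \<and> (\<forall>y\<in>Y. Q y \<and> (\<exists>x\<in>X. y < x))"
  using assms
proof (induction X rule: finite_linorder_max_induct)
  case empty
  show ?case by (intro exI[of _ "{}"]) auto
next
  case (insert b A)
  then obtain Y where Y: "finite Y" "card A \<le> card Y + 1" "Y \<inter> A = {}"
    "\<forall>y\<in>Y. Q y \<and> (\<exists>x\<in>A. y < x)" by (metis insertI2)
  show ?case
  proof (cases "A = {}")
    case True
    then show ?thesis by (intro exI[of _ "{}"]) auto
  next
    case False
    let ?a = "Max A"
    have a: "?a \<in> A" "?a < b" "\<And>x. x \<in> A \<Longrightarrow> x \<le> ?a" using False insert by auto
    obtain y where y: "y > ?a" "y < b" "Q y" using insert.prems[of ?a b] a by auto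
    have "y \<notin> Y" using Y(4) a(3) y(1) by force
    moreover have "b \<notin> A" using insert.hyps by auto
    ultimately have "card (insert b A) \<le> card (insert y Y) + 1"
      using Y insert.hyps by simp
    moreover have "y \<notin> A" using a(3)[of y] y(1) by auto
    moreover have "b \<notin> Y" using Y(4) insert.hyps(2) by (meson not_less_iff_gr_or_eq)
    ultimately show ?thesis using Y y a(1) by (intro exI[of _ "insert y Y"]) auto
  qed
qed

locale power_kernel =
  fixes T :: real and F :: "real \<Rightarrow> real"
  assumes T_pos: "T > 0"
    and cont_F: "continuous_on {0..T} F"
    and mono_F: "strict_mono_on {0..T} F"
begin

text \<open>The parameters for which the base of the kernel is positive on all of [0, T]; as
  \<open>F\<close> is monotone, the two endpoint conditions suffice, and they make \<open>S\<close>
  an intersection of two half-lines (or whole lines).\<close>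

definition S :: "real set" where "S = {s. 0 < 1 - s * F 0 \<and> 0 < 1 - s * F T}"

definition N :: "(real \<Rightarrow> real) \<Rightarrow> real \<Rightarrow> real \<Rightarrow> real" where
  "N G \<gamma> s = integral {0..T} (\<lambda>t. G t * (1 - s * F t) powr (-\<gamma>))"

text \<open>Up to nonzero factors the integrals below are the first \<open>k\<close> derivatives of \<open>N G \<gamma>\<close> at \<open>s\<close>.\<close>

definition vanishes :: "(real \<Rightarrow> real) \<Rightarrow> real \<Rightarrow> real \<Rightarrow> nat \<Rightarrow> bool" where
  "vanishes G \<gamma> s k \<longleftrightarrow> (\<forall>j<k. N (\<lambda>t. G t * F t ^ j) (\<gamma> + real j) s = 0)"

lemma S_pos: "s \<in> S \<Longrightarrow> t \<in> {0..T} \<Longrightarrow> 0 < 1 - s * F t"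
proof -
  assume s: "s \<in> S" and t: "t \<in> {0..T}"
  have F: "F 0 \<le> F t" "F t \<le> F T"
    using mono_F[THEN strict_mono_on_leD, of 0 t] mono_F[THEN strict_mono_on_leD, of t T] t T_pos
    by auto
  show ?thesis
  proof (cases "s \<ge> 0")
    case True
    then have "s * F t \<le> s * F T" using F by (simp add: mult_left_mono)
    then show ?thesis using s by (simp add: S_def)
  next
    case False
    then have "s * F t \<le> s * F 0" using F by (simp add: mult_left_mono_neg)
    then show ?thesis using s by (simp add: S_def)
  qed
qed

lemma open_S: "open S"
proof -
  have "S = {s. 0 < 1 - s * F 0} \<inter> {s. 0 < 1 - s * F T}" by (auto simp: S_def)
  then show ?thesis by (auto intro!: open_Int open_Collect_less continuous_intros)
qed

lemma convex_S: "convex S"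
proof -
  have "S = {s. F 0 * s < 1} \<inter> {s. F T * s < 1}" by (auto simp: S_def mult.commute)
  then show ?thesis
    using convex_halfspace_lt[of "F 0" 1] convex_halfspace_lt[of "F T" 1]
    by (auto intro!: convex_Int)
qed

lemma S_interval: "a \<in> S \<Longrightarrow> b \<in> S \<Longrightarrow> a \<le> x \<Longrightarrow> x \<le> b \<Longrightarrow> x \<in> S"
  using convex_S convex_contains_segment[of S] closed_segment_eq_real_ivl1[of a b] by force

lemma zero_in_S [simp]: "0 \<in> S" by (simp add: S_def)

lemma continuous_integrand:
  assumes "continuous_on {0..T} G" "s \<in> S"
  shows "continuous_on {0..T} (\<lambda>t. G t * (1 - s * F t) powr \<gamma>)"
  using assms S_pos[OF assms(2)]
  by (auto intro!: continuous_intros cont_F simp: less_imp_neq[symmetric])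

lemma integrable_integrand:
  assumes "continuous_on {0..T} G" "s \<in> S"
  shows "(\<lambda>t. G t * (1 - s * F t) powr \<gamma>) integrable_on {0..T}"
  using continuous_integrand[OF assms] by (rule integrable_continuous_interval)

lemma N_deriv:
  assumes G: "continuous_on {0..T} G" and s: "s \<in> S"
  shows "(N G \<gamma> has_real_derivative \<gamma> * N (\<lambda>t. G t * F t) (\<gamma> + 1) s) (at s)"
proof -
  let ?fx = "\<lambda>s t. \<gamma> * (G t * F t * (1 - s * F t) powr (-(\<gamma> + 1)))"
  have "((\<lambda>s. integral (cbox 0 T) (\<lambda>t. G t * (1 - s * F t) powr (-\<gamma>))) has_real_derivative
          integral (cbox 0 T) (?fx s)) (at s within S)"
  proof (rule leibniz_rule_field_derivative)
    fix x t assume x: "x \<in> S" "t \<in> cbox 0 T"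
    have "0 < 1 - x * F t" using S_pos x by simp
    then show "((\<lambda>x. G t * (1 - x * F t) powr (-\<gamma>)) has_field_derivative ?fx x t) (at x within S)"
      by (auto intro!: derivative_eq_intros simp: minus_diff_commute)
  next
    have "continuous_on (S \<times> cbox 0 T) (\<lambda>x. F (snd x))"
      by (rule continuous_on_compose2[OF cont_F]) (auto intro!: continuous_intros)
    moreover have "continuous_on (S \<times> cbox 0 T) (\<lambda>x. G (snd x))"
      by (rule continuous_on_compose2[OF G]) (auto intro!: continuous_intros)
    ultimately show "continuous_on (S \<times> cbox 0 T) (\<lambda>(x, t). ?fx x t)"
      unfolding split_beta by (intro continuous_intros) (use S_pos in \<open>force+\<close>)
  qed (use s convex_S integrable_integrand[OF G] in auto)
  then show ?thesis
    using s open_S by (simp add: N_def[abs_def] at_within_open[of s S])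
qed

text \<open>Splits off one factor 1 - s F(t) from the kernel. Every passage between the exponents
  \<gamma> and \<gamma> + 1 that is not a differentiation goes through this identity.\<close>

lemma N_shift:
  assumes G: "continuous_on {0..T} G" and s: "s \<in> S"
  shows "N G \<gamma> s = N G (\<gamma> + 1) s - s * N (\<lambda>t. G t * F t) (\<gamma> + 1) s"
proof -
  have "N G \<gamma> s = integral {0..T} (\<lambda>t. G t * (1 - s * F t) powr (-(\<gamma> + 1)) -
          s * (G t * F t * (1 - s * F t) powr (-(\<gamma> + 1))))"
    unfolding N_def
  proof (rule integral_cong)
    fix t assume "t \<in> {0..T}"
    then have w: "0 < 1 - s * F t" using S_pos s by blast
    have "(1 - s * F t) powr (-\<gamma>) = (1 - s * F t) powr (-(\<gamma> + 1)) * (1 - s * F t)"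
      using powr_add[of "1 - s * F t" "-(\<gamma> + 1)" 1] w by simp
    then show "G t * (1 - s * F t) powr - \<gamma> = G t * (1 - s * F t) powr (-(\<gamma> + 1)) -
          s * (G t * F t * (1 - s * F t) powr (-(\<gamma> + 1)))"
      by (simp only:) (simp add: algebra_simps)
  qed
  also have "\<dots> = N G (\<gamma> + 1) s - s * N (\<lambda>t. G t * F t) (\<gamma> + 1) s"
    unfolding N_def using G s cont_F
    by (subst integral_diff)
       (auto intro!: integrable_on_mult_right integrable_integrand continuous_intros)
  finally show ?thesis .
qed

lemma N_linear:
  assumes "continuous_on {0..T} G" "continuous_on {0..T} H" "s \<in> S"
  shows "N (\<lambda>t. a * G t + b * H t) \<gamma> s = a * N G \<gamma> s + b * N H \<gamma> s"
proof -
  have "N (\<lambda>t. a * G t + b * H t) \<gamma> s = integral {0..T} (\<lambda>t. a * (G t * (1 - s * F t) powr (-\<gamma>))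
      + b * (H t * (1 - s * F t) powr (-\<gamma>)))"
    unfolding N_def by (simp add: algebra_simps)
  also have "\<dots> = a * N G \<gamma> s + b * N H \<gamma> s"
    unfolding N_def using assms
    by (subst integral_add) (auto intro!: integrable_on_mult_right integrable_integrand)
  finally show ?thesis .
qed

lemma N_sum:
  assumes "finite A" "\<And>l. l \<in> A \<Longrightarrow> continuous_on {0..T} (G l)" "s \<in> S"
  shows "N (\<lambda>t. \<Sum>l\<in>A. c l * G l t) \<gamma> s = (\<Sum>l\<in>A. c l * N (G l) \<gamma> s)"
proof -
  have "N (\<lambda>t. \<Sum>l\<in>A. c l * G l t) \<gamma> s =
      integral {0..T} (\<lambda>t. \<Sum>l\<in>A. c l * (G l t * (1 - s * F t) powr (-\<gamma>)))"
    unfolding N_def by (simp add: sum_distrib_right mult.assoc)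
  also have "\<dots> = (\<Sum>l\<in>A. c l * N (G l) \<gamma> s)"
    unfolding N_def using assms
    by (subst integral_sum) (auto intro!: integrable_on_mult_right integrable_integrand)
  finally show ?thesis .
qed

lemma N_pos:
  assumes G: "continuous_on {0..T} G" and s: "s \<in> S"
    and nonneg: "\<And>t. t \<in> {0..T} \<Longrightarrow> 0 \<le> G t" and ex: "\<exists>t\<in>{0..T}. G t \<noteq> 0"
  shows "0 < N G \<gamma> s"
proof -
  let ?h = "\<lambda>t. G t * (1 - s * F t) powr (-\<gamma>)"
  have nn: "0 \<le> ?h t" if "t \<in> {0..T}" for t using nonneg[OF that] by simp
  obtain t where t: "t \<in> {0..T}" "G t \<noteq> 0" using ex by blast
  have "0 < 1 - s * F t" using S_pos s t by blast
  then have "?h t \<noteq> 0" using t by simp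
  have "N G \<gamma> s \<noteq> 0"
    unfolding N_def using integral_eq_0_iff[OF continuous_integrand[OF G s, of "-\<gamma>"] _ nn] T_pos
      \<open>?h t \<noteq> 0\<close> t by auto
  moreover have "N G \<gamma> s \<ge> 0" unfolding N_def using nn
    by (intro integral_nonneg integrable_integrand G s)
  ultimately show ?thesis by simp
qed

text \<open>Raising the exponent of the j-th integral costs \<open>s\<close> times the next
  integral, which also vanishes; so one order is lost, and F(t) may be replaced by F(t) - y for any
  \<open>y\<close>.\<close>

lemma vanishes_step:
  assumes G: "continuous_on {0..T} G" and s: "s \<in> S" and v: "vanishes G \<gamma> s (Suc k)"
  shows "vanishes (\<lambda>t. G t * (F t - y)) (\<gamma> + 1) s k"
  unfolding vanishes_def
proof (intro allI impI)
  fix j assume j: "j < k"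
  let ?G = "\<lambda>i t. G t * F t ^ i"
  have c: "continuous_on {0..T} (?G i)" for i by (intro continuous_intros G cont_F)
  have 0: "N (?G j) (\<gamma> + real j) s = 0" "N (?G (Suc j)) (\<gamma> + real (Suc j)) s = 0"
    using v j unfolding vanishes_def by (meson less_Suc_eq, blast)
  have e: "(\<lambda>t. ?G j t * F t) = ?G (Suc j)" by (auto simp: algebra_simps)
  have 1: "N (?G j) (\<gamma> + 1 + real j) s = 0"
    using N_shift[OF c s, of j "\<gamma> + real j"] 0 unfolding e by (simp add: algebra_simps)
  have "(\<lambda>t. G t * (F t - y) * F t ^ j) = (\<lambda>t. 1 * ?G (Suc j) t + (-y) * ?G j t)"
    by (auto simp: algebra_simps)
  then show "N (\<lambda>t. G t * (F t - y) * F t ^ j) (\<gamma> + 1 + real j) s = 0"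
    using N_linear[OF c c s, of 1 "Suc j" "-y" j "\<gamma> + 1 + real j"] 0 1
    by (simp add: algebra_simps)
qed

text \<open>The kernel is totally positive: multiplying \<open>N G \<gamma>\<close> by \<open>(1 - s F(z))\<^sup>\<gamma>\<close> and
  differentiating removes the sign change of \<open>G\<close> at \<open>z\<close>, and Rolle's theorem loses only one zero.\<close>

theorem zeros_le_sign_changes:
  assumes "finite Z" "Z \<subseteq> {0..T}" "continuous_on {0..T} G"
    and "\<And>t. t \<in> {0..T} \<Longrightarrow> 0 \<le> \<sigma> * (G t * (\<Prod>z\<in>Z. F t - F z))"
    and "\<exists>t\<in>{0..T}. \<sigma> * (G t * (\<Prod>z\<in>Z. F t - F z)) \<noteq> 0"
    and "\<And>i::nat. \<gamma> + real i \<noteq> 0"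
    and "finite X" "X \<subseteq> S" "\<And>s. s \<in> X \<Longrightarrow> vanishes G \<gamma> s (ms s)"
  shows "sum ms X \<le> card Z"
  using assms
proof (induction Z arbitrary: G \<gamma> X ms rule: finite_induct)
  case empty
  have "ms s = 0" if s: "s \<in> X" for s
  proof (rule ccontr)
    assume "ms s \<noteq> 0"
    then have "N G \<gamma> s = 0" using empty.prems(8)[OF s] unfolding vanishes_def by force
    moreover have "0 < N (\<lambda>t. \<sigma> * G t) \<gamma> s"
      using empty.prems s by (intro N_pos continuous_intros) auto
    moreover have "N (\<lambda>t. \<sigma> * G t) \<gamma> s = \<sigma> * N G \<gamma> s"
      unfolding N_def by (simp add: mult.assoc)
    ultimately show False by simp
  qed
  then show ?case by simp
next
  case (insert z Z)
  note G = insert.prems(2)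
  \<comment> \<open>Points of order 0 contribute nothing to the sum but would be false data for
    Rolle.\<close>
  define X1 where "X1 = {s \<in> X. ms s > 0}"
  have fin: "finite X1" "X1 \<subseteq> S" using insert.prems X1_def by auto
  define G' where "G' = (\<lambda>t. G t * (F t - F z))"
  have G': "continuous_on {0..T} G'" unfolding G'_def by (intro continuous_intros G cont_F)
  have z: "z \<in> {0..T}" using insert.prems by auto
  \<comment> \<open>The factor is chosen because (1 - s F(z)) F(t) - F(z) (1 - s F(t)) = F(t) -
    F(z): in the derivative the variable \<open>s\<close> cancels and \<open>G\<close> acquires
    exactly the factor that changes sign at \<open>z\<close>.\<close>
  define W where "W s = (1 - s * F z) powr \<gamma> * N G \<gamma> s" for s
  have W': "(W has_real_derivative \<gamma> * (1 - s * F z) powr (\<gamma> - 1) * N G' (\<gamma> + 1) s) (at s)"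
    if s: "s \<in> S" for s
  proof -
    have w: "0 < 1 - s * F z" using S_pos s z by blast
    have G'N: "N G' (\<gamma> + 1) s = N (\<lambda>t. G t * F t) (\<gamma> + 1) s - F z * N G (\<gamma> + 1) s"
      using N_linear[of "\<lambda>t. G t * F t" G s 1 "- F z" "\<gamma> + 1"] G s cont_F
      by (simp add: G'_def algebra_simps continuous_on_mult)
    have p: "(1 - s * F z) powr \<gamma> = (1 - s * F z) powr (\<gamma> - 1) * (1 - s * F z)"
      using powr_add[of "1 - s * F z" "\<gamma> - 1" 1] w by simp
    have "((\<lambda>s. 1 - s * F z) has_real_derivative - F z) (at s)"
      by (auto intro!: derivative_eq_intros)
    from DERIV_fun_powr[OF this w, of \<gamma>]
    have "((\<lambda>s. (1 - s * F z) powr \<gamma>) has_real_derivative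
        \<gamma> * (1 - s * F z) powr (\<gamma> - 1) * (- F z)) (at s)" by simp
    from DERIV_mult[OF this N_deriv[OF G s, of \<gamma>]]
    show ?thesis unfolding W_def[abs_def] G'N
      by (rule DERIV_cong) (simp only: p N_shift[OF G s, of \<gamma>], simp add: algebra_simps)
  qed
  have W0: "W s = 0" if "s \<in> X1" for s
    using insert.prems(8)[of s] that unfolding W_def X1_def vanishes_def by force
  have "\<exists>y>a. y < b \<and> (y \<in> S \<and> N G' (\<gamma> + 1) y = 0)" if ab: "a \<in> X1" "b \<in> X1" "a < b" for a b
  proof -
    have S: "x \<in> S" if "a \<le> x" "x \<le> b" for x using S_interval that ab fin by blast
    have "\<exists>y>a. y < b \<and> (W has_real_derivative 0) (at y)"
    proof (rule Rolle[OF ab(3)])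
      show "W a = W b" using W0 ab by simp
      show "continuous_on {a..b} W"
        using W' S by (intro DERIV_continuous_on) (auto intro: DERIV_subset)
      show "W differentiable (at x)" if "a < x" "x < b" for x
        using W'[OF S, of x] that by (auto simp: real_differentiable_def)
    qed
    then obtain y where y: "a < y" "y < b" "(W has_real_derivative 0) (at y)" by blast
    have "y \<in> S" using S y by simp
    have "\<gamma> * (1 - y * F z) powr (\<gamma> - 1) * N G' (\<gamma> + 1) y = 0"
      using DERIV_unique[OF W'[OF \<open>y \<in> S\<close>] y(3)] .
    moreover have "\<gamma> \<noteq> 0" using insert.prems(5)[of 0] by simp
    moreover have "0 < 1 - y * F z" using S_pos \<open>y \<in> S\<close> z by blast
    ultimately show ?thesis using y \<open>y \<in> S\<close> by auto
  qed
  from finite_gap_points[OF fin(1) this] obtain Y where Y: "finite Y" "card X1 \<le> card Y + 1"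
    "Y \<inter> X1 = {}" "\<And>y. y \<in> Y \<Longrightarrow> y \<in> S" "\<And>y. y \<in> Y \<Longrightarrow> N G' (\<gamma> + 1) y = 0" by blast
  \<comment> \<open>Old zeros lose one order and each Rolle point counts once, so the total drops by
    at most one while \<open>Z\<close> loses one element.\<close>
  define ms' where "ms' s = (if s \<in> X1 then ms s - 1 else 1)" for s
  have prod: "G' t * (\<Prod>z\<in>Z. F t - F z) = G t * (\<Prod>z\<in>insert z Z. F t - F z)" for t
    using insert.hyps by (simp add: G'_def)
  have "sum ms' (X1 \<union> Y) \<le> card Z"
  proof (rule insert.IH)
    show "Z \<subseteq> {0..T}" using insert.prems by simp
    show "\<And>t. t \<in> {0..T} \<Longrightarrow> 0 \<le> \<sigma> * (G' t * (\<Prod>z\<in>Z. F t - F z))"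
      "\<exists>t\<in>{0..T}. \<sigma> * (G' t * (\<Prod>z\<in>Z. F t - F z)) \<noteq> 0"
      unfolding prod using insert.prems(3,4) by blast+
    show "\<gamma> + 1 + real i \<noteq> 0" for i using insert.prems(5)[of "Suc i"] by (simp add: add.assoc)
    show "vanishes G' (\<gamma> + 1) s (ms' s)" if "s \<in> X1 \<union> Y" for s
    proof (cases "s \<in> X1")
      case True
      then have "vanishes G \<gamma> s (Suc (ms s - 1))" using insert.prems(8) by (simp add: X1_def)
      from vanishes_step[OF G _ this, of "F z"] True fin show ?thesis
        unfolding ms'_def G'_def by auto
    next
      case False
      then show ?thesis using that Y by (auto simp: ms'_def vanishes_def)
    qed
  qed (use G' fin Y in auto)
  moreover have "sum ms' (X1 \<union> Y) = (\<Sum>s\<in>X1. ms s - 1) + card Y"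
  proof -
    have "sum ms' Y = card Y" using Y(3) by (simp add: ms'_def disjoint_iff)
    then show ?thesis using Y fin by (subst sum.union_disjoint) (auto simp: ms'_def)
  qed
  moreover have "sum ms X = sum ms X1"
    unfolding X1_def using insert.prems(6) by (intro sum.mono_neutral_right) auto
  moreover have "sum ms X1 = (\<Sum>s\<in>X1. ms s - 1) + card X1"
  proof -
    have "sum ms X1 = (\<Sum>s\<in>X1. (ms s - 1) + 1)" by (rule sum.cong) (auto simp: X1_def)
    then show ?thesis by (simp only: sum.distrib) simp
  qed
  ultimately show ?case using Y insert.hyps by simp
qed

end

section \<open>Counting zeros with multiplicity\<close>

lemma constant_sign_if_no_zeros:
  fixes G :: "real \<Rightarrow> real"
  assumes "continuous_on {a..b} G" "\<And>t. a < t \<Longrightarrow> t < b \<Longrightarrow> G t \<noteq> 0"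
  shows "\<exists>\<sigma>\<in>{1, -1}. \<forall>t\<in>{a..b}. 0 \<le> \<sigma> * G t"
proof (rule ccontr)
  assume "\<not> ?thesis"
  then obtain t1 t2 where t: "t1 \<in> {a..b}" "G t1 < 0" "t2 \<in> {a..b}" "0 < G t2" by force
  define l r where "l = min t1 t2" and "r = max t1 t2"
  have lr: "a \<le> l" "l < r" "r \<le> b" "G l * G r < 0"
    using t by (cases t1 t2 rule: linorder_cases; force simp: l_def r_def mult_less_0_iff)+
  have c: "continuous_on {l..r} G" using assms(1) lr by (auto intro: continuous_on_subset)
  have "\<exists>x. l \<le> x \<and> x \<le> r \<and> G x = 0"
    using IVT'[of G l 0 r] IVT2'[of G r 0 l] c lr by (auto simp: mult_less_0_iff)
  then obtain x where "l \<le> x" "x \<le> r" "G x = 0" by blast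
  moreover from this lr have "x \<noteq> l" "x \<noteq> r" by auto
  ultimately show False using assms(2)[of x] lr by auto
qed

context power_kernel
begin

lemma F_less: "0 \<le> x \<Longrightarrow> x < y \<Longrightarrow> y \<le> T \<Longrightarrow> F x < F y"
  using mono_F by (auto simp: strict_mono_on_def)

lemma F_le: "0 \<le> x \<Longrightarrow> x \<le> y \<Longrightarrow> y \<le> T \<Longrightarrow> F x \<le> F y"
  using F_less[of x y] by (cases "x = y") auto

text \<open>\<open>Y\<close> collects those zeros at which the sign really changes. Induction on the
  largest zero \<open>z\<close>: the sign pattern up to \<open>z\<close> is compared with the
  constant sign beyond \<open>z\<close>, and \<open>z\<close> joins \<open>Y\<close> exactly if the
  two disagree.\<close>

lemma sign_pattern:
  assumes "finite Z" "Z \<subseteq> {0<..<b}" "continuous_on {0..b} G" "0 < b" "b \<le> T"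
    and "\<And>t. 0 < t \<Longrightarrow> t < b \<Longrightarrow> G t = 0 \<Longrightarrow> t \<in> Z"
  shows "\<exists>Y\<subseteq>Z. \<exists>\<sigma>\<in>{1, -1}. \<forall>t\<in>{0..b}. 0 \<le> \<sigma> * (G t * (\<Prod>z\<in>Y. F t - F z))"
  using assms
proof (induction Z arbitrary: b rule: finite_linorder_max_induct)
  case empty
  then show ?case using constant_sign_if_no_zeros[of 0 b G] by auto
next
  case (insert z A)
  have z: "0 < z" "z < b" using insert.prems by auto
  have "\<exists>Y\<subseteq>A. \<exists>\<sigma>\<in>{1, -1}. \<forall>t\<in>{0..z}. 0 \<le> \<sigma> * (G t * (\<Prod>z\<in>Y. F t - F z))"
  proof (rule insert.IH)
    show "A \<subseteq> {0<..<z}" using insert by auto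
    show "continuous_on {0..z} G" using insert.prems(2) z by (auto intro: continuous_on_subset)
    show "\<And>t. 0 < t \<Longrightarrow> t < z \<Longrightarrow> G t = 0 \<Longrightarrow> t \<in> A"
      using insert.prems(5) z by force
  qed (use z insert.prems in auto)
  then obtain Y \<sigma> where Y: "Y \<subseteq> A" "\<sigma> \<in> {1, -1}"
    "\<And>t. t \<in> {0..z} \<Longrightarrow> 0 \<le> \<sigma> * (G t * (\<Prod>z\<in>Y. F t - F z))" by blast
  have "\<exists>\<tau>\<in>{1, -1}. \<forall>t\<in>{z..b}. 0 \<le> \<tau> * G t"
  proof (rule constant_sign_if_no_zeros)
    show "continuous_on {z..b} G" using insert.prems(2) z by (auto intro: continuous_on_subset)
    show "G t \<noteq> 0" if "z < t" "t < b" for t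
      using insert.prems(5)[of t] insert.hyps(2) that z by force
  qed
  then obtain \<tau> where \<tau>: "\<tau> \<in> {1, -1}" "\<And>t. t \<in> {z..b} \<Longrightarrow> 0 \<le> \<tau> * G t" by blast
  have fY: "finite Y" "z \<notin> Y" using Y insert.hyps finite_subset by auto
  have pos: "0 \<le> (\<Prod>y\<in>Y. F t - F y)" if "t \<in> {z..b}" for t
  proof (rule prod_nonneg)
    fix y assume "y \<in> Y"
    then have "y \<le> t" "0 \<le> y" using Y(1) insert.hyps(2) insert.prems(1) that by force+
    then show "0 \<le> F t - F y" using F_le[of y t] that insert.prems by auto
  qed
  show ?case
  proof (cases "\<tau> = \<sigma>")
    case True
    have "0 \<le> \<sigma> * (G t * (\<Prod>y\<in>Y. F t - F y))" if "t \<in> {0..b}" for t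
      using Y(3)[of t] \<tau>(2)[of t] pos[of t] that True
      by (cases "t \<le> z") (auto simp: mult.assoc[symmetric])
    then show ?thesis using Y by blast
  next
    case False
    then have \<tau>\<sigma>: "\<tau> = - \<sigma>" using \<tau> Y by auto
    have "0 \<le> \<tau> * (G t * (\<Prod>y\<in>insert z Y. F t - F y))" if t: "t \<in> {0..b}" for t
    proof (cases "t \<le> z")
      case True
      have "F t - F z \<le> 0" using F_le[of t z] True t z insert.prems by auto
      moreover have "0 \<le> \<sigma> * (G t * (\<Prod>y\<in>Y. F t - F y))" using Y(3) True t by auto
      ultimately have "0 \<le> \<sigma> * (G t * (\<Prod>y\<in>Y. F t - F y)) * - (F t - F z)"
        by (intro mult_nonneg_nonneg[of "\<sigma> * _"]) auto
      then show ?thesis using fY by (simp add: \<tau>\<sigma> algebra_simps)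
    next
      case False
      have "0 \<le> F t - F z" using F_le[of z t] False t z insert.prems by auto
      moreover have "0 \<le> \<tau> * G t" using \<tau> False t by auto
      ultimately have "0 \<le> \<tau> * G t * ((F t - F z) * (\<Prod>y\<in>Y. F t - F y))"
        using pos[of t] False t by (intro mult_nonneg_nonneg[of "\<tau> * _"] mult_nonneg_nonneg[of "F t - F z"]) auto
      then show ?thesis using fY by (simp add: algebra_simps)
    qed
    then show ?thesis using Y \<tau> by (intro exI[of _ "insert z Y"]) blast
  qed
qed

text \<open>Sign changes are among the interior zeros of \<open>G\<close>, so zeros at 0 or
  \<open>T\<close> do not enter; this matches a Chebyshev property that is known only on the open
  interval.\<close>

corollary zeros_le_card_zeros:
  assumes "continuous_on {0..T} G" "finite {t \<in> {0<..<T}. G t = 0}"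
    and "card {t \<in> {0<..<T}. G t = 0} \<le> L" and "\<And>i::nat. \<gamma> + real i \<noteq> 0"
    and "finite X" "X \<subseteq> S" "\<And>s. s \<in> X \<Longrightarrow> vanishes G \<gamma> s (ms s)"
  shows "sum ms X \<le> L"
proof -
  let ?Z = "{t \<in> {0<..<T}. G t = 0}"
  have "\<exists>Y\<subseteq>?Z. \<exists>\<sigma>\<in>{1, -1}. \<forall>t\<in>{0..T}. 0 \<le> \<sigma> * (G t * (\<Prod>z\<in>Y. F t - F z))"
    using assms T_pos by (intro sign_pattern) auto
  then obtain Y \<sigma> where Y: "Y \<subseteq> ?Z" "\<sigma> \<in> {1, -1}"
    "\<And>t. t \<in> {0..T} \<Longrightarrow> 0 \<le> \<sigma> * (G t * (\<Prod>z\<in>Y. F t - F z))" by blast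
  have "infinite {0<..<T}" using T_pos by simp
  then obtain t where t: "t \<in> {0<..<T}" "t \<notin> ?Z"
    using assms(2) by (meson infinite_super subsetI)
  have "finite Y" using Y assms finite_subset by blast
  have "sum ms X \<le> card Y"
  proof (rule zeros_le_sign_changes[where \<sigma> = \<sigma> and Z = Y and G = G and \<gamma> = \<gamma>])
    have "F t \<noteq> F z" if "z \<in> Y" for z
      using F_less[of t z] F_less[of z t] t Y(1) that by (cases t z rule: linorder_cases) auto
    then show "\<exists>t\<in>{0..T}. \<sigma> * (G t * (\<Prod>z\<in>Y. F t - F z)) \<noteq> 0"
      using t Y(2) \<open>finite Y\<close> by (intro bexI[of _ t]) auto
  qed (use assms Y \<open>finite Y\<close> in auto)
  also have "card Y \<le> L" using card_mono[OF assms(2) Y(1)] assms(3) by simp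
  finally show ?thesis .
qed

end

text \<open>Quantifying over all finite selections of points with lower bounds \<open>ms\<close> for
  their orders avoids \<open>enat\<close> arithmetic and treats infinitely many zeros and zeros of
  infinite order like all others.\<close>

definition zeros_bounded :: "(real \<Rightarrow> real) \<Rightarrow> real set \<Rightarrow> nat \<Rightarrow> bool" where
  "zeros_bounded u S N \<longleftrightarrow> (\<forall>X ms. finite X \<and> X \<subseteq> S \<and> (\<forall>x\<in>X. \<forall>j<ms x. (deriv ^^ j) u x = 0)
     \<longrightarrow> sum ms X \<le> N)"

lemma zeros_boundedI:
  assumes "\<And>X ms. finite X \<Longrightarrow> X \<subseteq> S \<Longrightarrow> (\<And>x. x \<in> X \<Longrightarrow> ms x > 0) \<Longrightarrow>
    (\<And>x j. x \<in> X \<Longrightarrow> j < ms x \<Longrightarrow> (deriv ^^ j) u x = 0) \<Longrightarrow> sum ms X \<le> N"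
  shows "zeros_bounded u S N"
  unfolding zeros_bounded_def
proof (intro allI impI)
  fix X and ms :: "real \<Rightarrow> nat"
  assume X: "finite X \<and> X \<subseteq> S \<and> (\<forall>x\<in>X. \<forall>j<ms x. (deriv ^^ j) u x = 0)"
  have "sum ms X = sum ms {x \<in> X. ms x > 0}"
    using X by (intro sum.mono_neutral_right) auto
  also have "\<dots> \<le> N" using X by (intro assms) auto
  finally show "sum ms X \<le> N" .
qed

lemma zeros_boundedD:
  "zeros_bounded u S N \<Longrightarrow> finite X \<Longrightarrow> X \<subseteq> S \<Longrightarrow>
    (\<And>x j. x \<in> X \<Longrightarrow> j < ms x \<Longrightarrow> (deriv ^^ j) u x = 0) \<Longrightarrow> sum ms X \<le> N"
  unfolding zeros_bounded_def by blast

text \<open>An infinite count is witnessed in two ways: by enough distinct zeros, or by a single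
  flat zero given the order \<open>a\<close>.\<close>

lemma enat_le_num_zeros_mult:
  assumes "enat a \<le> num_zeros_mult u S"
  shows "\<exists>X ms. finite X \<and> X \<subseteq> S \<and> (\<forall>x\<in>X. \<forall>j<ms x. (deriv ^^ j) u x = 0) \<and> a \<le> sum ms X"
proof (cases "finite {x \<in> S. u x = 0}")
  case False
  then obtain X where "X \<subseteq> {x \<in> S. u x = 0}" "finite X" "card X = a"
    using infinite_arbitrarily_large by blast
  then show ?thesis by (intro exI[of _ X] exI[of _ "\<lambda>_. 1"]) auto
next
  case fin: True
  let ?Z = "{x \<in> S. u x = 0}"
  show ?thesis
  proof (cases "\<exists>x\<in>?Z. zero_multiplicity u x = \<infinity>")
    case True
    then obtain x where x: "x \<in> S" "zero_multiplicity u x = \<infinity>" by auto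
    then have "\<forall>j. (deriv ^^ j) u x = 0" unfolding zero_multiplicity_def by (auto split: if_splits)
    then show ?thesis using x by (intro exI[of _ "{x}"] exI[of _ "\<lambda>_. a"]) auto
  next
    case False
    define ms where "ms x = (LEAST k. (deriv ^^ k) u x \<noteq> 0)" for x
    have ms: "zero_multiplicity u x = enat (ms x)" if "x \<in> ?Z" for x
      using False that unfolding zero_multiplicity_def ms_def by (auto split: if_splits)
    have "num_zeros_mult u S = (\<Sum>x\<in>?Z. enat (ms x))"
      using fin ms by (simp add: num_zeros_mult_def)
    also have "\<dots> = enat (sum ms ?Z)"
      using fin by (induction rule: finite_induct) (auto simp: zero_enat_def)
    finally have "a \<le> sum ms ?Z" using assms by simp
    moreover have "(deriv ^^ j) u x = 0" if "j < ms x" for x j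
      using not_less_Least[of j "\<lambda>k. (deriv ^^ k) u x \<noteq> 0"] that by (auto simp: ms_def)
    ultimately show ?thesis using fin by (intro exI[of _ ?Z] exI[of _ ms]) auto
  qed
qed

lemma num_zeros_mult_add_le:
  assumes "zeros_bounded u (S1 \<union> S2) N" "S1 \<inter> S2 = {}"
  shows "num_zeros_mult u S1 + num_zeros_mult u S2 \<le> enat N"
proof (rule ccontr)
  assume neg: "\<not> ?thesis"
  \<comment> \<open>If the two counts exceed \<open>N\<close> together, finite lower bounds adding
    up to exactly \<open>Suc N\<close> can be chosen, even if one count is infinite; the joined
    selections then violate the bound.\<close>
  have "\<exists>a b. enat a \<le> x \<and> enat b \<le> y \<and> a + b = Suc N" if "\<not> x + y \<le> enat N" for x y
  proof (cases x)
    case (enat a)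
    show ?thesis
    proof (cases "a \<le> Suc N")
      case True
      then have "enat (Suc N - a) \<le> y" using that enat by (cases y) auto
      then show ?thesis using enat True by (intro exI[of _ a] exI[of _ "Suc N - a"]) auto
    next
      case False
      then show ?thesis using enat by (intro exI[of _ "Suc N"] exI[of _ 0]) (auto simp: zero_enat_def[symmetric])
    qed
  next
    case infinity
    then show ?thesis by (intro exI[of _ "Suc N"] exI[of _ 0]) (auto simp: zero_enat_def[symmetric])
  qed
  from this[OF neg] obtain a b where ab: "enat a \<le> num_zeros_mult u S1" "enat b \<le> num_zeros_mult u S2"
    "a + b = Suc N" by blast
  obtain X ms where X: "finite X" "X \<subseteq> S1" "\<forall>x\<in>X. \<forall>j<ms x. (deriv ^^ j) u x = 0" "a \<le> sum ms X"
    using enat_le_num_zeros_mult[OF ab(1)] by blast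
  obtain Y ns where Y: "finite Y" "Y \<subseteq> S2" "\<forall>x\<in>Y. \<forall>j<ns x. (deriv ^^ j) u x = 0" "b \<le> sum ns Y"
    using enat_le_num_zeros_mult[OF ab(2)] by blast
  let ?ms = "\<lambda>x. if x \<in> X then ms x else ns x"
  have dis: "X \<inter> Y = {}" using X Y assms(2) by blast
  have "sum ?ms (X \<union> Y) \<le> N"
    using X Y by (intro zeros_boundedD[OF assms(1)]) (auto split: if_splits)
  moreover have "sum ?ms (X \<union> Y) = sum ms X + sum ns Y"
  proof -
    have "sum ?ms Y = sum ns Y" using dis by (intro sum.cong) auto
    then show ?thesis using X Y dis by (subst sum.union_disjoint) auto
  qed
  ultimately show False using ab X Y by simp
qed

lemma num_zeros_mult_le: "zeros_bounded u S N \<Longrightarrow> num_zeros_mult u S \<le> enat N"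
  using num_zeros_mult_add_le[of u S "{}" N] by (simp add: num_zeros_mult_def)

lemma zeros_bounded_Un:
  assumes "zeros_bounded u S1 N1" "zeros_bounded u S2 N2"
  shows "zeros_bounded u (S1 \<union> S2) (N1 + N2)"
proof (rule zeros_boundedI)
  fix X ms
  assume X: "finite X" "X \<subseteq> S1 \<union> S2" "\<And>x j. x \<in> X \<Longrightarrow> j < ms x \<Longrightarrow> (deriv ^^ j) u x = 0"
  have "sum ms X = sum ms (X \<inter> S1) + sum ms (X - S1)"
    using X sum.Int_Diff[of X ms S1] by simp
  also have "\<dots> \<le> N1 + N2"
    using X by (intro add_mono zeros_boundedD[OF assms(1)] zeros_boundedD[OF assms(2)]) auto
  finally show "sum ms X \<le> N1 + N2" .
qed

lemma zeros_bounded_subset: "zeros_bounded u S N \<Longrightarrow> S' \<subseteq> S \<Longrightarrow> zeros_bounded u S' N"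
  unfolding zeros_bounded_def by blast

text \<open>When the known zeros already exhaust the bound, a further zero or a vanishing derivative
  at a known one would exceed it. This is how simplicity is obtained without computing
  derivatives.\<close>

lemma simple_zeros_eq:
  assumes b: "zeros_bounded u S N" and X: "finite X" "X \<subseteq> S" "card X = N" "\<And>x. x \<in> X \<Longrightarrow> u x = 0"
    and d: "\<And>x. x \<in> S \<Longrightarrow> u differentiable (at x)"
  shows "simple_zeros u S = X"
proof (intro equalityI subsetI)
  fix y assume y: "y \<in> simple_zeros u S"
  then have y': "y \<in> S" "u y = 0" by (auto simp: simple_zeros_def)
  show "y \<in> X"
  proof (rule ccontr)
    assume n: "y \<notin> X"
    have "sum (\<lambda>_. 1::nat) (insert y X) \<le> N"
      using X y' by (intro zeros_boundedD[OF b]) auto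
    then show False using X n by simp
  qed
next
  fix x assume x: "x \<in> X"
  then obtain D where D: "(u has_real_derivative D) (at x)"
    using d[of x] X(2) unfolding real_differentiable_def by blast
  have "D \<noteq> 0"
  proof
    assume "D = 0"
    then have z: "deriv u x = 0" using D DERIV_imp_deriv by blast
    have "sum (\<lambda>y. if y = x then 2 else 1::nat) X \<le> N"
      using X z x by (intro zeros_boundedD[OF b]) (auto split: if_splits simp: less_2_cases_iff)
    moreover have "sum (\<lambda>y. if y = x then 2 else 1::nat) X = card X + 1"
    proof -
      have "sum (\<lambda>y. if y = x then 2 else 1::nat) X = 2 + card (X - {x})"
        using X x by (subst sum.remove[of _ x]) auto
      then show ?thesis using card.remove[of X x] X(1) x by linarith
    qed
    ultimately show False using X by simp
  qed
  then show "x \<in> simple_zeros u S" using D x X by (auto simp: simple_zeros_def)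
qed

lemma zeros_bounded_mono: "zeros_bounded u S N \<Longrightarrow> N \<le> N' \<Longrightarrow> zeros_bounded u S N'"
  unfolding zeros_bounded_def using le_trans by blast

text \<open>The coefficients that arise when u is differentiated repeatedly away from 0. What
  matters is closure under differentiation, which keeps the derivative chain below inside one class
  at every stage.\<close>

inductive laurent :: "(real \<Rightarrow> real) \<Rightarrow> bool" where
  const: "laurent (\<lambda>_. c)"
| ident: "laurent (\<lambda>z. z)"
| inv: "laurent inverse"
| add: "laurent f \<Longrightarrow> laurent g \<Longrightarrow> laurent (\<lambda>z. f z + g z)"
| mult: "laurent f \<Longrightarrow> laurent g \<Longrightarrow> laurent (\<lambda>z. f z * g z)"

lemma laurent_power: "laurent f \<Longrightarrow> laurent (\<lambda>z. f z ^ n)"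
  by (induction n) (auto intro: laurent.intros)

lemma laurent_deriv:
  assumes "laurent f"
  shows "\<exists>f'. laurent f' \<and> (\<forall>z. z \<noteq> 0 \<longrightarrow> (f has_real_derivative f' z) (at z))"
  using assms
proof induction
  case (const c)
  show ?case by (intro exI[of _ "\<lambda>_. 0"]) (auto intro: laurent.intros)
next
  case ident
  show ?case by (intro exI[of _ "\<lambda>_. 1"]) (auto intro: laurent.intros)
next
  case inv
  have "laurent (\<lambda>z. (-1) * (inverse z * inverse z))" by (intro laurent.intros)
  then show ?case
    by (intro exI[of _ "\<lambda>z. (-1) * (inverse z * inverse z)"])
      (auto intro!: derivative_eq_intros simp: power2_eq_square)
next
  case (add f g)
  then obtain f' g' where *: "laurent f'" "laurent g'"
    "\<forall>z. z \<noteq> 0 \<longrightarrow> (f has_real_derivative f' z) (at z)"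
    "\<forall>z. z \<noteq> 0 \<longrightarrow> (g has_real_derivative g' z) (at z)" by blast
  then show ?case
    by (intro exI[of _ "\<lambda>z. f' z + g' z"]) (auto intro: laurent.intros DERIV_add)
next
  case (mult f g)
  then obtain f' g' where *: "laurent f'" "laurent g'"
    "\<forall>z. z \<noteq> 0 \<longrightarrow> (f has_real_derivative f' z) (at z)"
    "\<forall>z. z \<noteq> 0 \<longrightarrow> (g has_real_derivative g' z) (at z)" by blast
  then have "laurent (\<lambda>z. f' z * g z + g' z * f z)" using mult by (intro laurent.intros)
  then show ?case using *
    by (intro exI[of _ "\<lambda>z. f' z * g z + g' z * f z"]) (auto intro: DERIV_mult)
qed

text \<open>By the chain rule of the system the i-th derivative of \<open>u\<close> is a combination
  of \<open>y 0\<close>, ..., \<open>y i\<close> whose last coefficient is a product of values of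
  \<open>b\<close>, hence nonzero. The system is triangular, so vanishing derivatives force
  vanishing \<open>y j\<close> one after another.\<close>

lemma vanishing_derivs_chain:
  fixes y :: "nat \<Rightarrow> real \<Rightarrow> real"
  assumes U: "open U" "0 \<notin> U" "x \<in> U"
    and y: "\<And>i z. z \<in> U \<Longrightarrow> (y i has_real_derivative a i z * y i z + b i z * y (Suc i) z) (at z)"
    and lau: "\<And>i. laurent (a i)" "\<And>i. laurent (b i)"
    and b: "\<And>i z. z \<in> U \<Longrightarrow> b i z \<noteq> 0"
    and u: "\<And>z. z \<in> U \<Longrightarrow> u z = y 0 z"
    and van: "\<And>j. j < k \<Longrightarrow> (deriv ^^ j) u x = 0" and j: "j < k"
  shows "y j x = 0"
proof -
  have ex: "\<exists>r. (\<forall>l. laurent (r l)) \<and> (\<forall>z\<in>U. r i z \<noteq> 0) \<and>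
      (\<forall>z\<in>U. (deriv ^^ i) u z = (\<Sum>l\<le>i. r l z * y l z))" for i
  proof (induction i)
    case 0
    show ?case using u by (intro exI[of _ "\<lambda>_ _. 1"]) (auto intro: laurent.const)
  next
    case (Suc i)
    then obtain r where r: "\<And>l. laurent (r l)" "\<And>z. z \<in> U \<Longrightarrow> r i z \<noteq> 0"
      "\<And>z. z \<in> U \<Longrightarrow> (deriv ^^ i) u z = (\<Sum>l\<le>i. r l z * y l z)" by blast
    obtain r' where r': "\<And>l. laurent (r' l)"
      "\<And>l z. z \<noteq> 0 \<Longrightarrow> (r l has_real_derivative r' l z) (at z)"
      using laurent_deriv[OF r(1)] by metis
    define p where "p l = (if l \<le> i then (\<lambda>z. r' l z + r l z * a l z) else (\<lambda>_. 0))" for l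
    define q where "q l = (case l of 0 \<Rightarrow> (\<lambda>_. 0) | Suc m \<Rightarrow> (\<lambda>z. r m z * b m z))" for l
    have p: "laurent (p l)" for l unfolding p_def using r r' lau by (auto intro!: laurent.intros)
    have q: "laurent (q l)" for l unfolding q_def
      using r lau by (auto intro!: laurent.intros split: nat.splits)
    have "(deriv ^^ Suc i) u z = (\<Sum>l\<le>Suc i. (p l z + q l z) * y l z)" if z: "z \<in> U" for z
    proof -
      have z0: "z \<noteq> 0" using z U by auto
      have "((\<lambda>z. \<Sum>l\<le>i. r l z * y l z) has_real_derivative
          (\<Sum>l\<le>i. r' l z * y l z + (a l z * y l z + b l z * y (Suc l) z) * r l z)) (at z)"
        by (intro DERIV_sum DERIV_mult r'(2)[OF z0] y[OF z])
      then have "((deriv ^^ i) u has_real_derivative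
          (\<Sum>l\<le>i. r' l z * y l z + (a l z * y l z + b l z * y (Suc l) z) * r l z)) (at z)"
        using U(1) z r(3) by (subst DERIV_cong_ev[OF refl _ refl])
          (auto simp: eventually_nhds intro!: exI[of _ U])
      then have "(deriv ^^ Suc i) u z =
          (\<Sum>l\<le>i. r' l z * y l z + (a l z * y l z + b l z * y (Suc l) z) * r l z)"
        using DERIV_imp_deriv by simp
      also have "\<dots> = (\<Sum>l\<le>i. p l z * y l z) + (\<Sum>l\<le>i. q (Suc l) z * y (Suc l) z)"
        unfolding sum.distrib[symmetric] by (intro sum.cong) (auto simp: p_def q_def algebra_simps)
      also have "(\<Sum>l\<le>i. q (Suc l) z * y (Suc l) z) = (\<Sum>l\<le>Suc i. q l z * y l z)"
        by (subst sum.atMost_Suc_shift) (simp add: q_def)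
      also have "(\<Sum>l\<le>i. p l z * y l z) = (\<Sum>l\<le>Suc i. p l z * y l z)" by (simp add: p_def)
      finally show ?thesis by (simp only: sum.distrib distrib_right)
    qed
    moreover have "p (Suc i) z + q (Suc i) z \<noteq> 0" if "z \<in> U" for z
      using r(2) b that by (auto simp: p_def q_def)
    ultimately show ?case using p q
      by (intro exI[of _ "\<lambda>l z. p l z + q l z"]) (auto intro: laurent.add)
  qed
  show ?thesis using j
  proof (induction j rule: less_induct)
    case (less j)
    obtain r where r: "\<forall>z\<in>U. r j z \<noteq> 0" "\<forall>z\<in>U. (deriv ^^ j) u z = (\<Sum>l\<le>j. r l z * y l z)"
      using ex[of j] by blast
    have "(\<Sum>l\<le>j. r l x * y l x) = (\<Sum>l\<in>{j}. r l x * y l x)"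
      using less by (intro sum.mono_neutral_right) auto
    then have "r j x * y j x = 0" using r U van[OF less.prems] by simp
    then show ?case using r U by auto
  qed
qed

section \<open>Power series solutions of differential equations\<close>

lemma sum_inverse_squares_le: "(\<Sum>i\<le>k. 1 / (real i + 1)^2) \<le> 2 - 1 / (real k + 1)"
proof (induction k)
  case (Suc k)
  have "1 / (real k + 2)^2 \<le> 1 / (real k + 1) - 1 / (real k + 2)"
  proof -
    have "1 / (real k + 1) - 1 / (real k + 2) = 1 / ((real k + 1) * (real k + 2))"
      by (simp add: field_simps)
    moreover have "1 / (real k + 2)^2 \<le> 1 / ((real k + 1) * (real k + 2))"
      unfolding power2_eq_square by (intro divide_left_mono mult_right_mono) auto
    ultimately show ?thesis by simp
  qed
  then show ?case using Suc by (simp add: add.commute)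
qed simp

text \<open>With x + y = k + 2 one has 1/(xy) = (1/x + 1/y)/(x + y); squaring and (u + v)^2 \<le> 2
  (u^2 + v^2) reduce the sum to two sums of inverse squares, each at most 2. Hence the constant
  8.\<close>

lemma convolution_inverse_squares_le:
  "(\<Sum>i\<le>k. 1 / ((real i + 1)^2 * (real (k - i) + 1)^2)) \<le> 8 / (real k + 1)^2"
proof -
  let ?f = "\<lambda>i. 1 / (real i + 1)^2"
  have "(\<Sum>i\<le>k. 1 / ((real i + 1)^2 * (real (k - i) + 1)^2))
      \<le> (\<Sum>i\<le>k. 2 / (real k + 1)^2 * (?f i + ?f (k - i)))"
  proof (rule sum_mono)
    fix i assume "i \<in> {..k}"
    define x y where "x = real i + 1" and "y = real (k - i) + 1"
    have xy: "x > 0" "y > 0" "x + y = real k + 2" using \<open>i \<in> {..k}\<close> by (auto simp: x_def y_def of_nat_diff)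
    have "1 / (x^2 * y^2) = (1/x + 1/y)^2 / (x + y)^2"
    proof -
      have "1/x + 1/y = (x + y) / (x * y)" using xy by (simp add: field_simps)
      then show ?thesis using xy by (simp add: power_divide power_mult_distrib)
    qed
    also have "\<dots> \<le> (2 * (1/x^2 + 1/y^2)) / (x + y)^2"
    proof (rule divide_right_mono)
      have "(1/x + 1/y)^2 + (1/x - 1/y)^2 = 2 * (1/x^2 + 1/y^2)"
        by (simp add: power2_eq_square algebra_simps)
      then show "(1/x + 1/y)^2 \<le> 2 * (1/x^2 + 1/y^2)"
        using zero_le_power2[of "1/x - 1/y"] by linarith
    qed simp
    also have "\<dots> \<le> (2 * (1/x^2 + 1/y^2)) / (real k + 1)^2"
      using xy by (intro divide_left_mono) (auto intro!: power_mono add_nonneg_nonneg)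
    finally show "1 / ((real i + 1)^2 * (real (k - i) + 1)^2)
        \<le> 2 / (real k + 1)^2 * (?f i + ?f (k - i))"
      by (simp add: x_def y_def)
  qed
  also have "\<dots> = 2 / (real k + 1)^2 * ((\<Sum>i\<le>k. ?f i) + (\<Sum>i\<le>k. ?f (k - i)))"
    by (simp add: sum_distrib_left sum.distrib distrib_left)
  also have "(\<Sum>i\<le>k. ?f (k - i)) = (\<Sum>i\<le>k. ?f i)"
    by (rule sum.reindex_bij_witness[of _ "\<lambda>i. k - i" "\<lambda>i. k - i"]) auto
  also have "2 / (real k + 1)^2 * ((\<Sum>i\<le>k. ?f i) + (\<Sum>i\<le>k. ?f i)) \<le> 2 / (real k + 1)^2 * 4"
  proof (rule mult_left_mono)
    have "(\<Sum>i\<le>k. ?f i) \<le> 2" using sum_inverse_squares_le[of k]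
      by (smt (verit) divide_nonneg_nonneg of_nat_0_le_iff)
    then show "(\<Sum>i\<le>k. ?f i) + (\<Sum>i\<le>k. ?f i) \<le> 4" by linarith
  qed simp
  finally show ?thesis by simp
qed

text \<open>The weight \<open>1/(k+1)\<^sup>2\<close> makes the geometric majorants stable under multiplication of
  power series.\<close>

definition majorized :: "real \<Rightarrow> real \<Rightarrow> real fps \<Rightarrow> bool" where
  "majorized R C A \<longleftrightarrow> (\<forall>k. \<bar>fps_nth A k\<bar> \<le> C * R ^ k / (real k + 1)^2)"

lemma majorized_mult:
  assumes A: "majorized R C A" and B: "majorized R D B" and "R \<ge> 0"
  shows "majorized R (8 * C * D) (A * B)"
  unfolding majorized_def
proof
  fix k
  have C: "C \<ge> 0" "D \<ge> 0" using A B unfolding majorized_def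
    by (auto dest!: spec[of _ 0])
  have "\<bar>fps_nth (A * B) k\<bar> \<le> (\<Sum>i\<le>k. \<bar>fps_nth A i\<bar> * \<bar>fps_nth B (k - i)\<bar>)"
    unfolding fps_mult_nth atLeast0AtMost abs_mult[symmetric] by (rule sum_abs)
  also have "\<dots> \<le> (\<Sum>i\<le>k. (C * R ^ i / (real i + 1)^2) * (D * R ^ (k - i) / (real (k - i) + 1)^2))"
    using A B C assms(3) unfolding majorized_def
    by (intro sum_mono mult_mono) (auto simp del: of_nat_diff)
  also have "\<dots> = (\<Sum>i\<le>k. C * D * R ^ k * (1 / ((real i + 1)^2 * (real (k - i) + 1)^2)))"
  proof (rule sum.cong)
    fix i assume "i \<in> {..k}"
    then have "R ^ k = R ^ i * R ^ (k - i)" by (simp add: power_add[symmetric])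
    then show "(C * R ^ i / (real i + 1)^2) * (D * R ^ (k - i) / (real (k - i) + 1)^2) =
      C * D * R ^ k * (1 / ((real i + 1)^2 * (real (k - i) + 1)^2))" by simp
  qed simp
  also have "\<dots> = C * D * R ^ k * (\<Sum>i\<le>k. 1 / ((real i + 1)^2 * (real (k - i) + 1)^2))"
    by (rule sum_distrib_left[symmetric])
  also have "\<dots> \<le> C * D * R ^ k * (8 / (real k + 1)^2)"
    using C assms(3) by (intro mult_left_mono convolution_inverse_squares_le) auto
  finally show "\<bar>fps_nth (A * B) k\<bar> \<le> 8 * C * D * R ^ k / (real k + 1)^2"
    by (simp add: mult_ac)
qed

lemma majorized_power:
  assumes "majorized R C A" "R \<ge> 0"
  shows "majorized R ((8 * C) ^ j) (A ^ j)"
proof (induction j)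
  case 0
  show ?case using assms(2) by (auto simp: majorized_def)
next
  case (Suc j)
  show ?case using majorized_mult[OF assms(1) Suc assms(2)] by (simp add: mult_ac)
qed

lemma majorized_conv_radius:
  assumes "majorized R C A" "R > 0"
  shows "fps_conv_radius A \<ge> ereal (1 / R)"
  unfolding fps_conv_radius_def
proof (rule conv_radius_geI_ex)
  fix r :: real assume r: "0 < r" "ereal r < ereal (1 / R)"
  have C: "C \<ge> 0" using assms(1) unfolding majorized_def by (auto dest!: spec[of _ 0])
  have "summable (\<lambda>k. C * (R * r) ^ k)"
    using r assms by (intro summable_mult summable_geometric) (auto simp: field_simps)
  then have "summable (\<lambda>k. fps_nth A k * r ^ k)"
  proof (rule summable_comparison_test[rotated], intro exI allI impI)
    fix k
    have "\<bar>fps_nth A k\<bar> \<le> C * R ^ k / (real k + 1)^2" using assms by (simp add: majorized_def)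
    also have "\<dots> \<le> C * R ^ k / 1" using assms C by (intro divide_left_mono) auto
    finally show "norm (fps_nth A k * r ^ k) \<le> C * (R * r) ^ k"
      using r by (simp add: abs_mult power_mult_distrib mult_right_mono mult.assoc[symmetric])
  qed
  then show "\<exists>z. norm z = r \<and> summable (\<lambda>k. fps_nth A k * z ^ k)"
    using r by (intro exI[of _ r]) auto
qed

lemma fps_power_agree:
  assumes "\<And>k. k < n \<Longrightarrow> fps_nth A k = fps_nth (B :: real fps) k" "k < n"
  shows "fps_nth (A ^ j) k = fps_nth (B ^ j) k"
  using assms(2)
proof (induction j arbitrary: k)
  case (Suc j)
  have "fps_nth (A * A ^ j) k = fps_nth (B * B ^ j) k"
    unfolding fps_mult_nth using Suc assms(1) by (intro sum.cong) auto
  then show ?case by simp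
qed simp

text \<open>The equation \<open>z' = \<Sum> s i j t \<epsilon>^i z^j\<close>, \<open>z a = 0\<close>, whose right-hand side does not involve \<open>z\<close>
  when \<open>\<epsilon> = 0\<close>, solved by Picard iteration on power series in \<open>\<epsilon>\<close>.\<close>

locale fps_ode =
  fixes a b :: real and n :: nat and s :: "nat \<Rightarrow> nat \<Rightarrow> real \<Rightarrow> real"
  assumes ab: "a < b"
    and cont: "\<And>i j. continuous_on {a..b} (s i j)"
    and s0: "\<And>j t. s 0 (Suc j) t = 0"
begin

definition rhs :: "real \<Rightarrow> real fps \<Rightarrow> real fps" where
  "rhs t A = (\<Sum>i\<le>n. \<Sum>j\<le>n. fps_const (s i j t) * (fps_X ^ i * A ^ j))"

primrec picard :: "nat \<Rightarrow> real \<Rightarrow> real fps" where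
  "picard 0 t = 0"
| "picard (Suc k) t = Abs_fps (\<lambda>l. integral {a..t} (\<lambda>x. fps_nth (rhs x (picard k x)) l))"

text \<open>A diagonal reading of the iterates: coefficient \<open>k\<close> is final from iterate
  \<open>Suc k\<close> on, so no limit has to be taken.\<close>

definition sol :: "real \<Rightarrow> real fps" where
  "sol t = Abs_fps (\<lambda>k. fps_nth (picard (Suc k) t) k)"

lemma rhs_nth:
  "fps_nth (rhs t A) k = (\<Sum>i\<le>n. \<Sum>j\<le>n. s i j t * (if k < i then 0 else fps_nth (A ^ j) (k - i)))"
  by (simp add: rhs_def fps_sum_nth fps_X_power_mult_nth)

lemma continuous_on_power_nth:
  assumes "\<And>k. continuous_on I (\<lambda>t. fps_nth (A t) k)"
  shows "continuous_on I (\<lambda>t. fps_nth (A t ^ j) k :: real)"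
proof (induction j arbitrary: k)
  case (Suc j)
  then show ?case using assms by (auto simp: fps_mult_nth intro!: continuous_intros)
qed simp

lemma continuous_on_rhs:
  assumes "\<And>k. continuous_on {a..b} (\<lambda>t. fps_nth (A t) k)"
  shows "continuous_on {a..b} (\<lambda>t. fps_nth (rhs t (A t)) k)"
proof -
  have "continuous_on {a..b} (\<lambda>t. if k < i then 0 else fps_nth (A t ^ j) (k - i))" for i j
    by (cases "k < i") (auto intro: continuous_on_power_nth[OF assms])
  then show ?thesis unfolding rhs_nth by (intro continuous_on_sum continuous_on_mult cont)
qed

lemma continuous_on_picard: "continuous_on {a..b} (\<lambda>t. fps_nth (picard m t) k)"
proof (induction m arbitrary: k)
  case (Suc m)
  have "(\<lambda>x. fps_nth (rhs x (picard m x)) k) integrable_on {a..b}"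
    by (intro integrable_continuous_interval continuous_on_rhs Suc)
  then show ?case by (simp add: indefinite_integral_continuous_1)
qed simp

text \<open>Terms with i \<ge> 1 shift the index by at least one, and by \<open>s0\<close> the terms
  with i = 0 contain no power of the unknown. Coefficient \<open>k\<close> of the right-hand side
  therefore only sees coefficients below \<open>k\<close>.\<close>

lemma rhs_agree:
  assumes "\<And>k. k < m \<Longrightarrow> fps_nth A k = fps_nth B k" "k \<le> m"
  shows "fps_nth (rhs t A) k = fps_nth (rhs t B) k"
  unfolding rhs_nth
proof (intro sum.cong refl)
  fix i j
  show "s i j t * (if k < i then 0 else fps_nth (A ^ j) (k - i)) =
    s i j t * (if k < i then 0 else fps_nth (B ^ j) (k - i))"
  proof (cases "i = 0")
    case True
    then show ?thesis using s0 by (cases j) auto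
  next
    case False
    then show ?thesis using fps_power_agree[of m A B "k - i" j] assms by auto
  qed
qed

lemma picard_stable: "t \<in> {a..b} \<Longrightarrow> k < m \<Longrightarrow> fps_nth (picard (Suc m) t) k = fps_nth (picard m t) k"
proof (induction m arbitrary: k t)
  case (Suc m)
  have "fps_nth (rhs x (picard (Suc m) x)) k = fps_nth (rhs x (picard m x)) k" if "x \<in> {a..t}" for x
    using Suc that by (intro rhs_agree[of m]) auto
  then show ?case unfolding picard.simps(2)[of "Suc m"] picard.simps(2)[of m]
    by (auto intro!: integral_cong)
qed simp

lemma sol_eq_picard: "t \<in> {a..b} \<Longrightarrow> k < m \<Longrightarrow> fps_nth (sol t) k = fps_nth (picard m t) k"
proof (induction m)
  case (Suc m)
  then show ?case
  proof (cases "k = m")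
    case False
    then show ?thesis using Suc picard_stable[of t k m] by simp
  qed (simp add: sol_def)
qed simp

lemma sol_nth: "t \<in> {a..b} \<Longrightarrow> fps_nth (sol t) k = integral {a..t} (\<lambda>x. fps_nth (rhs x (sol x)) k)"
proof -
  assume t: "t \<in> {a..b}"
  have "fps_nth (sol t) k = fps_nth (picard (Suc k) t) k" by (simp add: sol_def)
  also have "\<dots> = integral {a..t} (\<lambda>x. fps_nth (rhs x (picard k x)) k)" by simp
  also have "\<dots> = integral {a..t} (\<lambda>x. fps_nth (rhs x (sol x)) k)"
    using t by (intro integral_cong rhs_agree[of k]) (auto simp: sol_eq_picard)
  finally show ?thesis .
qed

lemma continuous_on_sol: "continuous_on {a..b} (\<lambda>t. fps_nth (sol t) k)"
  unfolding sol_def by (simp only: fps_nth_Abs_fps continuous_on_picard)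

lemma rhs_nth_0: "fps_nth (rhs t A) 0 = s 0 0 t"
proof -
  have "s 0 j t = 0" if "j > 0" for j using s0 that by (cases j) auto
  then have "(\<Sum>j\<le>n. s 0 j t * fps_nth (A ^ j) 0) = (\<Sum>j\<in>{0}. s 0 j t * fps_nth (A ^ j) 0)"
    by (intro sum.mono_neutral_right) auto
  moreover have "fps_nth (rhs t A) 0 = (\<Sum>i\<in>{0}. \<Sum>j\<le>n. s i j t * fps_nth (A ^ j) 0)"
    unfolding rhs_nth by (intro sum.mono_neutral_cong_right) auto
  ultimately show ?thesis by simp
qed

lemma sol_nth_0: "t \<in> {a..b} \<Longrightarrow> fps_nth (sol t) 0 = integral {a..t} (s 0 0)"
  by (simp add: sol_nth rhs_nth_0)

lemma sol_nth_1:
  assumes "t \<in> {a..b}" "n \<ge> 1"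
  shows "fps_nth (sol t) 1 = integral {a..t} (\<lambda>x. \<Sum>j\<le>n. s 1 j x * fps_nth (sol x) 0 ^ j)"
proof -
  have pow: "fps_nth (A ^ j) 0 = fps_nth A 0 ^ j" for A :: "real fps" and j
    by (induction j) (auto simp: fps_mult_nth)
  have "fps_nth (rhs x A) 1 = (\<Sum>j\<le>n. s 1 j x * fps_nth A 0 ^ j)" for x A
  proof -
    have z: "(\<Sum>j\<le>n. s 0 j x * fps_nth (A ^ j) (Suc 0)) = 0"
      by (intro sum.neutral ballI) (metis fps_one_nth mult_eq_0_iff nat.distinct(1) not0_implies_Suc power_0 s0)
    have "fps_nth (rhs x A) 1 =
      (\<Sum>i\<in>{0,1}. \<Sum>j\<le>n. s i j x * (if 1 < i then 0 else fps_nth (A ^ j) (1 - i)))"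
      unfolding rhs_nth using assms(2) by (intro sum.mono_neutral_right) auto
    also have "\<dots> = (\<Sum>j\<le>n. s 1 j x * fps_nth A 0 ^ j)" using z by (simp add: pow)
    finally show ?thesis .
  qed
  then show ?thesis using assms by (simp only: sol_nth)
qed

lemma majorized_sol:
  "\<exists>R>0. \<exists>C. \<exists>D. \<forall>t\<in>{a..b}. majorized R C (sol t) \<and> majorized R D (rhs t (sol t))"
proof -
  have "\<exists>B>0. \<forall>i\<le>n. \<forall>j\<le>n. \<forall>t\<in>{a..b}. \<bar>s i j t\<bar> \<le> B"
  proof -
    have "\<exists>B. \<forall>t\<in>{a..b}. \<bar>s i j t\<bar> \<le> B" for i j
      using compact_imp_bounded[OF compact_continuous_image[OF cont compact_Icc, of i j]]
      unfolding bounded_iff by auto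
    then obtain B where B: "\<And>i j t. t \<in> {a..b} \<Longrightarrow> \<bar>s i j t\<bar> \<le> B i j" by metis
    have B0: "0 \<le> B i j" for i j using B[of a i j] ab by auto
    have "\<bar>s i j t\<bar> \<le> (\<Sum>i\<le>n. \<Sum>j\<le>n. B i j) + 1" if "i \<le> n" "j \<le> n" "t \<in> {a..b}" for i j t
    proof -
      have "B i j \<le> (\<Sum>j\<le>n. B i j)" using that B0 by (intro member_le_sum) auto
      also have "\<dots> \<le> (\<Sum>i\<le>n. \<Sum>j\<le>n. B i j)"
        using that B0 by (intro member_le_sum[of i "{..n}" "\<lambda>i. \<Sum>j\<le>n. B i j"]) (auto intro: sum_nonneg)
      finally show ?thesis using B[OF that(3), of i j] by linarith
    qed
    moreover have "(\<Sum>i\<le>n. \<Sum>j\<le>n. B i j) + 1 > 0"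
      by (intro add_nonneg_pos sum_nonneg B0) auto
    ultimately show ?thesis by blast
  qed
  then obtain B where B: "B > 0" "\<And>i j t. i \<le> n \<Longrightarrow> j \<le> n \<Longrightarrow> t \<in> {a..b} \<Longrightarrow> \<bar>s i j t\<bar> \<le> B" by blast
  \<comment> \<open>\<open>C\<close> is what integrating a bound \<open>B\<close> over the interval
    yields. In \<open>R\<close>, the weights (i + 1)^2 pay for comparing 1/(k - i + 1)^2 with 1/(k +
    1)^2; because i \<ge> 1 one power of \<open>R\<close> is left over, and it absorbs the double
    sum \<open>R - 1\<close>.\<close>
  define C where "C = (b - a) * B"
  define R where "R = 1 + (\<Sum>i\<le>n. \<Sum>j\<le>n. (8 * C) ^ j * (real i + 1)^2)"
  have C: "C > 0" using B ab by (simp add: C_def)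
  have R: "R \<ge> 1" unfolding R_def using C by (auto intro!: sum_nonneg)
  have rhs: "majorized R B (rhs t A)" if A: "majorized R C A" and t: "t \<in> {a..b}" for A t
    unfolding majorized_def
  proof
    fix k
    show "\<bar>fps_nth (rhs t A) k\<bar> \<le> B * R ^ k / (real k + 1)^2"
    proof (cases k)
      case 0
      show ?thesis using 0 B(2)[of 0 0 t] t rhs_nth_0[of t A] by simp
    next
      case (Suc k')
      have entry: "\<bar>s i j t * (if k < i then 0 else fps_nth (A ^ j) (k - i))\<bar>
          \<le> B * R ^ k' / (real k + 1)^2 * ((8 * C) ^ j * (real i + 1)^2)" if ij: "i \<le> n" "j \<le> n" for i j
      proof (cases "i = 0 \<or> k < i")
        case True
        have "s i j t * (if k < i then 0 else fps_nth (A ^ j) (k - i)) = 0"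
          using True Suc s0 by (cases j) auto
        moreover have "0 \<le> B * R ^ k' / (real k + 1)^2 * ((8 * C) ^ j * (real i + 1)^2)"
          using B(1) C R by simp
        ultimately show ?thesis by (simp only: abs_zero)
      next
        case False
        have ik: "(real k + 1) \<le> (real (k - i) + 1) * (real i + 1)"
        proof -
          obtain d where "k = i + d" using False by (metis le_iff_add not_less)
          then show ?thesis by (simp add: algebra_simps)
        qed
        have "\<bar>fps_nth (A ^ j) (k - i)\<bar> \<le> (8 * C) ^ j * R ^ (k - i) / (real (k - i) + 1)^2"
          using majorized_power[OF A, of j] R by (auto simp: majorized_def)
        also have "\<dots> \<le> (8 * C) ^ j * R ^ k' / (real (k - i) + 1)^2"
          using False Suc R C by (intro divide_right_mono mult_left_mono power_increasing) auto
        also have "\<dots> \<le> (8 * C) ^ j * R ^ k' * ((real i + 1)^2 / (real k + 1)^2)"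
        proof -
          have "1 / (real (k - i) + 1)^2 \<le> (real i + 1)^2 / (real k + 1)^2"
          proof -
            have "(real k + 1)^2 \<le> ((real (k - i) + 1) * (real i + 1))^2"
              using ik by (intro power_mono) auto
            then have le: "(real k + 1)^2 \<le> (real (k - i) + 1)^2 * (real i + 1)^2"
              by (simp only: power_mult_distrib)
            have "1 / u \<le> v / w" if "0 < u" "0 < w" "w \<le> u * v" for u v w :: real
              using that by (simp add: field_simps)
            from this[OF _ _ le] show ?thesis by simp
          qed
          then have "(8 * C) ^ j * R ^ k' * (1 / (real (k - i) + 1)^2)
            \<le> (8 * C) ^ j * R ^ k' * ((real i + 1)^2 / (real k + 1)^2)"
            using C R by (intro mult_left_mono) auto
          then show ?thesis by simp
        qed
        finally have le: "\<bar>fps_nth (A ^ j) (k - i)\<bar> \<le> (8 * C) ^ j * R ^ k' * ((real i + 1)^2 / (real k + 1)^2)" .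
        have "\<bar>s i j t\<bar> * \<bar>fps_nth (A ^ j) (k - i)\<bar>
           \<le> B * ((8 * C) ^ j * R ^ k' * ((real i + 1)^2 / (real k + 1)^2))"
          using B(2)[OF ij t] le B(1) by (intro mult_mono) auto
        then show ?thesis using False by (simp add: abs_mult mult_ac)
      qed
      have "\<bar>fps_nth (rhs t A) k\<bar> \<le>
          (\<Sum>i\<le>n. \<bar>\<Sum>j\<le>n. s i j t * (if k < i then 0 else fps_nth (A ^ j) (k - i))\<bar>)"
        unfolding rhs_nth by (rule sum_abs)
      also have "\<dots> \<le> (\<Sum>i\<le>n. \<Sum>j\<le>n. \<bar>s i j t * (if k < i then 0 else fps_nth (A ^ j) (k - i))\<bar>)"
        by (intro sum_mono sum_abs)
      also have "\<dots> \<le> (\<Sum>i\<le>n. \<Sum>j\<le>n. B * R ^ k' / (real k + 1)^2 * ((8 * C) ^ j * (real i + 1)^2))"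
        by (intro sum_mono entry) auto
      also have "\<dots> = B * R ^ k' / (real k + 1)^2 * (R - 1)"
        unfolding R_def by (simp add: sum_distrib_left)
      also have "\<dots> \<le> B * R ^ k' / (real k + 1)^2 * R"
        using B R by (intro mult_left_mono) auto
      finally show ?thesis using Suc by (simp add: mult_ac)
    qed
  qed
  have pic: "majorized R C (picard m t)" if "t \<in> {a..b}" for m t
    using that
  proof (induction m arbitrary: t)
    case 0
    then show ?case using C R by (auto simp: majorized_def)
  next
    case (Suc m)
    show ?case unfolding majorized_def
    proof
      fix k
      have "\<bar>fps_nth (picard (Suc m) t) k\<bar> = norm (integral {a..t} (\<lambda>x. fps_nth (rhs x (picard m x)) k))"
        by simp
      also have "\<dots> \<le> (B * R ^ k / (real k + 1)^2) * (t - a)"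
      proof (rule integral_bound)
        show "continuous_on {a..t} (\<lambda>x. fps_nth (rhs x (picard m x)) k)"
          using Suc.prems by (intro continuous_on_subset[OF continuous_on_rhs[OF continuous_on_picard]]) auto
        show "norm (fps_nth (rhs x (picard m x)) k) \<le> B * R ^ k / (real k + 1)^2" if "x \<in> {a..t}" for x
          using rhs[OF Suc.IH, of x x] that Suc.prems by (auto simp: majorized_def)
      qed (use Suc.prems in auto)
      also have "\<dots> \<le> (B * R ^ k / (real k + 1)^2) * (b - a)"
        using Suc.prems B R by (intro mult_left_mono) auto
      finally show "\<bar>fps_nth (picard (Suc m) t) k\<bar> \<le> C * R ^ k / (real k + 1)^2"
        by (simp add: C_def mult_ac)
    qed
  qed
  have sol: "majorized R C (sol t)" if "t \<in> {a..b}" for t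
    using pic[OF that] unfolding majorized_def sol_def by (simp only: fps_nth_Abs_fps) blast
  show ?thesis using R rhs sol
    by (intro exI[of _ R] conjI exI[of _ C] exI[of _ B]) auto
qed

text \<open>The majorants are uniform in \<open>t\<close>, so the series of right-hand sides
  converges uniformly and the coefficientwise integral equations may be summed; the integral
  equation for the sum is then differentiated. The radius 1/R does not depend on
  \<open>t\<close>.\<close>

theorem eval_sol:
  "\<exists>r>0. (\<forall>t\<in>{a..b}. fps_conv_radius (sol t) \<ge> ereal r) \<and>
    (\<forall>\<epsilon>. \<bar>\<epsilon>\<bar> < r \<longrightarrow> (\<forall>t\<in>{a..b}. ((\<lambda>t. eval_fps (sol t) \<epsilon>) has_real_derivative
       (\<Sum>i\<le>n. \<Sum>j\<le>n. s i j t * (\<epsilon> ^ i * eval_fps (sol t) \<epsilon> ^ j))) (at t within {a..b})))"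
proof -
  obtain R C D where R: "R > 0" and sol: "\<And>t. t \<in> {a..b} \<Longrightarrow> majorized R C (sol t)"
    and rhs: "\<And>t. t \<in> {a..b} \<Longrightarrow> majorized R D (rhs t (sol t))"
    using majorized_sol by blast
  have "((\<lambda>t. eval_fps (sol t) \<epsilon>) has_real_derivative
       (\<Sum>i\<le>n. \<Sum>j\<le>n. s i j t * (\<epsilon> ^ i * eval_fps (sol t) \<epsilon> ^ j))) (at t within {a..b})"
    if \<epsilon>: "\<bar>\<epsilon>\<bar> < 1 / R" and t: "t \<in> {a..b}" for \<epsilon> t
  proof -
    have cr: "ereal (norm \<epsilon>) < fps_conv_radius (sol x)" "ereal (norm \<epsilon>) < fps_conv_radius (rhs x (sol x))"
      if "x \<in> {a..b}" for x
      using majorized_conv_radius[OF sol[OF that] R] majorized_conv_radius[OF rhs[OF that] R] \<epsilon>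
      by (simp_all add: less_le_trans[of _ "ereal (1 / R)"])
    let ?r = "\<lambda>x. eval_fps (rhs x (sol x)) \<epsilon>"
    have eval_rhs: "?r x = (\<Sum>i\<le>n. \<Sum>j\<le>n. s i j x * (\<epsilon> ^ i * eval_fps (sol x) \<epsilon> ^ j))"
      if x: "x \<in> {a..b}" for x
    proof -
      \<comment> \<open>Couples convergence at \<epsilon> with the value there, so that evaluation
        passes through sums and products of series without separate radius bookkeeping.\<close>
      let ?F = "\<lambda>A r. ereal (norm \<epsilon>) < fps_conv_radius A \<and> eval_fps A \<epsilon> = (r::real)"
      have add: "?F A p \<Longrightarrow> ?F B q \<Longrightarrow> ?F (A + B) (p + q)" for A B p q
        using fps_conv_radius_add[of A B] eval_fps_add[of \<epsilon> A B]
        by (metis (no_types, lifting) less_le_trans min_less_iff_conj)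
      have mult: "?F A p \<Longrightarrow> ?F B q \<Longrightarrow> ?F (A * B) (p * q)" for A B p q
        using fps_conv_radius_mult[of A B] eval_fps_mult[of \<epsilon> A B]
        by (metis (no_types, lifting) less_le_trans min_less_iff_conj)
      have sum: "(\<And>i. i \<le> m \<Longrightarrow> ?F (A i) (p i)) \<Longrightarrow> ?F (\<Sum>i\<le>m. A i) (\<Sum>i\<le>m. p i)" for m :: nat and A p
        by (induction m) (simp, simp only: sum.atMost_Suc, intro add, auto)
      have pow: "?F (sol x ^ j) (eval_fps (sol x) \<epsilon> ^ j)" for j :: nat
        by (induction j) (simp, simp only: power_Suc, intro mult, use cr[OF x] in auto)
      have "?F (rhs x (sol x)) (\<Sum>i\<le>n. \<Sum>j\<le>n. s i j x * (\<epsilon> ^ i * eval_fps (sol x) \<epsilon> ^ j))"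
        unfolding rhs_def by (intro sum mult pow) auto
      then show ?thesis by blast
    qed
    have ul: "uniform_limit {a..b} (\<lambda>m x. \<Sum>k<m. fps_nth (rhs x (sol x)) k * \<epsilon> ^ k) ?r sequentially"
      unfolding eval_fps_def
    proof (rule Weierstrass_m_test)
      show "summable (\<lambda>k. \<bar>D\<bar> * (R * \<bar>\<epsilon>\<bar>) ^ k)"
        using \<epsilon> R by (intro summable_mult summable_geometric) (auto simp: field_simps abs_mult)
      fix k x assume x: "x \<in> {a..b}"
      have "\<bar>fps_nth (rhs x (sol x)) k\<bar> \<le> D * R ^ k / (real k + 1)^2" using rhs[OF x] by (simp add: majorized_def)
      also have "\<dots> \<le> \<bar>D\<bar> * R ^ k / (real k + 1)^2" using R by (intro divide_right_mono mult_right_mono) auto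
      also have "\<dots> \<le> \<bar>D\<bar> * R ^ k / 1" using R by (intro divide_left_mono) auto
      finally show "norm (fps_nth (rhs x (sol x)) k * \<epsilon> ^ k) \<le> \<bar>D\<bar> * (R * \<bar>\<epsilon>\<bar>) ^ k"
        by (simp add: abs_mult power_mult_distrib power_abs mult_right_mono mult.assoc[symmetric])
    qed
    have cr': "continuous_on {a..b} (\<lambda>x. fps_nth (rhs x (sol x)) k)" for k
      by (rule continuous_on_rhs[OF continuous_on_sol])
    have cont_r: "continuous_on {a..b} ?r"
      by (rule uniform_limit_theorem[OF _ ul]) (auto intro!: always_eventually continuous_intros cr')
    have eq: "eval_fps (sol x) \<epsilon> = integral {a..x} ?r" if x: "x \<in> {a..b}" for x
    proof -
      have ulx: "uniform_limit (cbox a x) (\<lambda>m x. \<Sum>k<m. fps_nth (rhs x (sol x)) k * \<epsilon> ^ k) ?r sequentially"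
        using x by (intro uniform_limit_on_subset[OF ul]) auto
      have cx: "continuous_on (cbox a x) (\<lambda>x. fps_nth (rhs x (sol x)) k)" for k
        using x by (intro continuous_on_subset[OF cr']) auto
      obtain I J where IJ:
        "\<And>m. ((\<lambda>x. \<Sum>k<m. fps_nth (rhs x (sol x)) k * \<epsilon> ^ k) has_integral I m) (cbox a x)"
        "(?r has_integral J) (cbox a x)" "I \<longlonglongrightarrow> J"
        by (rule uniform_limit_integral_cbox[OF ulx]) (auto intro!: continuous_intros cx[simplified])
      have "I m = (\<Sum>k<m. fps_nth (sol x) k * \<epsilon> ^ k)" for m
      proof -
        have "I m = integral (cbox a x) (\<lambda>x. \<Sum>k<m. fps_nth (rhs x (sol x)) k * \<epsilon> ^ k)"
          by (rule integral_unique[OF IJ(1), symmetric])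
        also have "\<dots> = (\<Sum>k<m. integral (cbox a x) (\<lambda>x. fps_nth (rhs x (sol x)) k * \<epsilon> ^ k))"
          by (rule integral_sum) (auto intro!: integrable_continuous_interval continuous_intros cx[simplified])
        also have "\<dots> = (\<Sum>k<m. fps_nth (sol x) k * \<epsilon> ^ k)"
          using x by (simp add: sol_nth)
        finally show ?thesis .
      qed
      then have "I \<longlonglongrightarrow> eval_fps (sol x) \<epsilon>"
        using sums_eval_fps[OF cr(1)[OF x]] unfolding sums_def by presburger
      then have "J = eval_fps (sol x) \<epsilon>" using IJ(3) LIMSEQ_unique by blast
      then show ?thesis using IJ(2) by (simp add: integral_unique)
    qed
    have "((\<lambda>x. integral {a..x} ?r) has_real_derivative ?r t) (at t within {a..b})"
      by (rule integral_has_real_derivative[OF cont_r t])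
    then show ?thesis
      unfolding eval_rhs[OF t] using eq t
      by (auto intro: has_field_derivative_transform_within[of _ _ _ _ 1])
  qed
  moreover have "1 / R > 0" using R by simp
  ultimately show ?thesis using majorized_conv_radius[OF sol R]
    by (intro exI[of _ "1 / R"]) auto
qed

end

section \<open>Uniqueness for the perturbed equation\<close>

lemma polynomial_ode_unique:
  fixes g h x y :: "real \<Rightarrow> real"
  assumes g: "continuous_on {a..b} g" and h: "continuous_on {a..b} h"
    and x: "\<And>t. t \<in> {a..b} \<Longrightarrow> (x has_real_derivative g t * x t ^ p + h t * x t ^ q) (at t within {a..b})"
    and y: "\<And>t. t \<in> {a..b} \<Longrightarrow> (y has_real_derivative g t * y t ^ p + h t * y t ^ q) (at t within {a..b})"
    and eq: "x a = y a" and t: "t \<in> {a..b}"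
  shows "x t = y t"
proof -
  have c: "continuous_on {a..b} x" "continuous_on {a..b} y" using DERIV_continuous_on[OF x] DERIV_continuous_on[OF y] by auto
  \<comment> \<open>Since x^p - y^p = (x - y) times a polynomial in x and y, the difference of two
    solutions satisfies a linear equation with continuous coefficient \<open>A\<close>; multiplied
    by its integrating factor it is constant.\<close>
  define A where "A t = g t * (\<Sum>i<p. y t ^ (p - Suc i) * x t ^ i) + h t * (\<Sum>i<q. y t ^ (q - Suc i) * x t ^ i)" for t
  have A: "continuous_on {a..b} A" unfolding A_def by (intro continuous_intros g h c)
  define e where "e t = (x t - y t) * exp (- integral {a..t} A)" for t
  have "(e has_real_derivative 0) (at t within {a..b})" if t: "t \<in> {a..b}" for t
  proof -
    have "((\<lambda>t. integral {a..t} A) has_real_derivative A t) (at t within {a..b})"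
      by (rule integral_has_real_derivative[OF A t])
    then have 1: "((\<lambda>t. exp (- integral {a..t} A)) has_real_derivative exp (- integral {a..t} A) * (- A t)) (at t within {a..b})"
      by (auto intro!: derivative_eq_intros)
    have 2: "((\<lambda>t. x t - y t) has_real_derivative A t * (x t - y t)) (at t within {a..b})"
    proof (rule DERIV_cong[OF DERIV_diff[OF x[OF t] y[OF t]]])
      have "g t * x t ^ p + h t * x t ^ q - (g t * y t ^ p + h t * y t ^ q) =
          g t * (x t ^ p - y t ^ p) + h t * (x t ^ q - y t ^ q)" by (simp add: algebra_simps)
      also have "\<dots> = A t * (x t - y t)"
        unfolding power_diff_sumr2 A_def by (simp add: algebra_simps)
      finally show "g t * x t ^ p + h t * x t ^ q - (g t * y t ^ p + h t * y t ^ q) = A t * (x t - y t)" .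
    qed
    show ?thesis unfolding e_def by (rule DERIV_cong[OF DERIV_mult[OF 2 1]]) (simp add: algebra_simps)
  qed
  then obtain c where c: "\<And>t. t \<in> {a..b} \<Longrightarrow> e t = c"
    using has_field_derivative_zero_constant[of "{a..b}" e] by auto
  have "e t = e a" using c t by auto
  then show ?thesis using eq by (simp add: e_def)
qed

section \<open>Expansion along an unperturbed orbit\<close>

lemma has_fps_expansion_eventually_nonzero:
  fixes g :: "real \<Rightarrow> real"
  assumes g: "g has_fps_expansion G" and "G \<noteq> 0"
  shows "eventually (\<lambda>h. g h \<noteq> 0) (at 0)"
proof -
  \<comment> \<open>Dividing out the leading power leaves a series with nonzero value at 0, whose
    sum stays nonzero nearby by continuity.\<close>
  define H where "H = fps_shift (subdegree G) G"
  have G: "G = H * fps_X ^ subdegree G" unfolding H_def by (rule subdegree_decompose)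
  have rad: "fps_conv_radius H > 0" using g by (simp add: H_def has_fps_expansion_def)
  then have "eval_fps H has_fps_expansion H" by (rule eval_fps_has_fps_expansion)
  then have "isCont (eval_fps H) 0" by (rule has_fps_expansion_imp_continuous)
  moreover have "eval_fps H 0 \<noteq> 0" using \<open>G \<noteq> 0\<close> by (simp add: eval_fps_at_0 H_def)
  ultimately have "eventually (\<lambda>h. eval_fps H h \<noteq> 0) (at 0)"
    by (metis continuous_within tendsto_imp_eventually_ne)
  moreover have "eventually (\<lambda>h. eval_fps G h = g h) (at 0)"
    using g unfolding has_fps_expansion_def by (auto simp: eventually_at_filter elim: eventually_mono)
  moreover have "eventually (\<lambda>h::real. h \<noteq> 0) (at 0)" by (simp add: eventually_at_filter)
  moreover have "eventually (\<lambda>h::real. ereal (norm h) < fps_conv_radius H) (at 0)"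
  proof -
    obtain r where r: "0 < r" "ereal r \<le> fps_conv_radius H"
      using rad by (metis ereal_less(2) less_ereal.simps(1) order_less_imp_le ereal_dense2)
    have "eventually (\<lambda>h::real. norm h < r) (at 0)"
      using r by (auto simp: eventually_at intro!: exI[of _ r])
    then show ?thesis
    proof (rule eventually_mono)
      fix h :: real assume "norm h < r"
      then have "ereal (norm h) < ereal r" by simp
      then show "ereal (norm h) < fps_conv_radius H" using r(2) by (rule less_le_trans)
    qed
  qed
  ultimately show ?thesis
  proof eventually_elim
    case (elim h)
    have "eval_fps G h = eval_fps H h * h ^ subdegree G"
      by (subst G, subst eval_fps_mult) (use elim in auto)
    then show ?case using elim by simp
  qed
qed

lemma has_fps_expansion_unique:
  fixes g :: "real \<Rightarrow> real"
  assumes "g has_fps_expansion G" "g has_fps_expansion H"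
  shows "G = H"
proof (rule ccontr)
  assume "G \<noteq> H"
  then have "G - H \<noteq> 0" by simp
  moreover have "(\<lambda>_. 0) has_fps_expansion (G - H)"
    using has_fps_expansion_diff[OF assms] by simp
  ultimately have "eventually (\<lambda>h::real. (0::real) \<noteq> 0) (at 0)"
    using has_fps_expansion_eventually_nonzero by blast
  then show False by simp
qed

text \<open>Near each point an analytic function either vanishes identically or has no zero except
  possibly the point itself. So the set of points of local vanishing is both open and closed in the
  connected interval.\<close>

lemma real_analytic_zero_extend:
  assumes an: "real_analytic_on g U" and I: "{a..b} \<subseteq> U" "a < c" "c < d" "d < b"
    and 0: "\<And>t. t \<in> {c..d} \<Longrightarrow> g t = 0" and t: "t \<in> {a..b}"
  shows "g t = 0"
proof -
  define A where "A = {x \<in> {a..b}. \<exists>e>0. \<forall>y. \<bar>y - x\<bar> < e \<longrightarrow> g y = 0}"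
  have dich: "(\<exists>e>0. \<forall>y. \<bar>y - x\<bar> < e \<longrightarrow> g y = 0) \<or> (\<exists>e>0. \<forall>y. y \<noteq> x \<and> \<bar>y - x\<bar> < e \<longrightarrow> g y \<noteq> 0)"
    if x: "x \<in> {a..b}" for x
  proof -
    obtain G where G: "(\<lambda>h. g (x + h)) has_fps_expansion G"
      using an I(1) x unfolding real_analytic_on_def by blast
    show ?thesis
    proof (cases "G = 0")
      case True
      then have "eventually (\<lambda>h. g (x + h) = 0) (nhds 0)"
        using G by (auto simp: has_fps_expansion_def elim: eventually_mono)
      then obtain e where "e > 0" "\<And>h. \<bar>h\<bar> < e \<Longrightarrow> g (x + h) = 0"
        by (auto simp: eventually_nhds_metric)
      then show ?thesis by (metis add.commute diff_add_cancel)
    next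
      case False
      then have "eventually (\<lambda>h. g (x + h) \<noteq> 0) (at 0)"
        using G has_fps_expansion_eventually_nonzero by blast
      then obtain e where "e > 0" "\<And>h. h \<noteq> 0 \<Longrightarrow> \<bar>h\<bar> < e \<Longrightarrow> g (x + h) \<noteq> 0"
        by (auto simp: eventually_at)
      then show ?thesis
        by (intro disjI2 exI[of _ e]) (metis add.commute diff_add_cancel diff_self eq_iff_diff_eq_0)
    qed
  qed
  have "openin (top_of_set {a..b}) A"
    unfolding openin_euclidean_subtopology_iff
  proof (intro conjI ballI)
    fix x assume "x \<in> A"
    then obtain e where e: "e > 0" "\<And>y. \<bar>y - x\<bar> < e \<Longrightarrow> g y = 0" by (auto simp: A_def)
    have "x' \<in> A" if x': "x' \<in> {a..b}" "dist x' x < e" for x'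
      unfolding A_def using x' e
      by (auto simp: dist_real_def intro!: exI[of _ "e - \<bar>x' - x\<bar>"])
    then show "\<exists>e>0. \<forall>x'\<in>{a..b}. dist x' x < e \<longrightarrow> x' \<in> A" using e by blast
  qed (auto simp: A_def)
  moreover have "openin (top_of_set {a..b}) ({a..b} - A)"
    unfolding openin_euclidean_subtopology_iff
  proof (intro conjI ballI)
    fix x assume "x \<in> {a..b} - A"
    then have x: "x \<in> {a..b}" "\<not> (\<exists>e>0. \<forall>y. \<bar>y - x\<bar> < e \<longrightarrow> g y = 0)" by (auto simp: A_def)
    then obtain e where e: "e > 0" "\<And>y. y \<noteq> x \<Longrightarrow> \<bar>y - x\<bar> < e \<Longrightarrow> g y \<noteq> 0" using dich by meson
    have "x' \<notin> A" if x': "dist x' x < e" for x'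
    proof
      assume "x' \<in> A"
      then obtain e' where e': "e' > 0" "\<And>y. \<bar>y - x'\<bar> < e' \<Longrightarrow> g y = 0" by (auto simp: A_def)
      show False
      proof (cases "x' = x")
        case True
        then show ?thesis using e' x by blast
      next
        case False
        then show ?thesis using e(2)[of x'] e' x' by (auto simp: dist_real_def)
      qed
    qed
    then show "\<exists>e>0. \<forall>x'\<in>{a..b}. dist x' x < e \<longrightarrow> x' \<in> {a..b} - A" using e by blast
  qed auto
  moreover have "connected {a..b}" by simp
  moreover have "A \<subseteq> {a..b}" by (auto simp: A_def)
  ultimately have "A = {} \<or> A = {a..b}"
    unfolding connected_clopen closedin_def by (metis topspace_euclidean_subtopology)
  moreover have "(c + d) / 2 \<in> A"
  proof -
    have "g y = 0" if "\<bar>y - (c + d) / 2\<bar> < (d - c) / 2" for y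
    proof (rule 0)
      show "y \<in> {c..d}" using that[unfolded abs_less_iff] by (auto simp: field_simps)
    qed
    then show ?thesis unfolding A_def using I by (auto intro!: exI[of _ "(d - c) / 2"])
  qed
  ultimately have "t \<in> A" using t by blast
  then show ?thesis by (auto simp: A_def)
qed

section \<open>Reduction of the perturbed equation to a power series equation along
  \<open>\<rho> * W\<close>\<close>

locale unperturbed_orbit =
  fixes f :: "nat \<Rightarrow> real \<Rightarrow> real" and T :: real and p q n m :: nat and \<rho> :: real
    and W :: "real \<Rightarrow> real"
  assumes T: "T > 0" and pq: "p \<ge> 2" "q \<ge> 2"
    and f: "\<And>i. continuous_on {-T..T} (f i)"
    and W_pos: "\<And>t. t \<in> {-T..T} \<Longrightarrow> W t > 0"
    and W_deriv: "\<And>t. t \<in> {-T..T} \<Longrightarrow>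
      (W has_real_derivative \<rho> ^ (p - 1) * f 1 t * W t ^ p) (at t within {-T..T})"
    and W_ends: "W (-T) = 1" "W T = 1"
begin

lemma cont_W: "continuous_on {-T..T} W"
  using W_deriv by (rule DERIV_continuous_on)

lemma cont_P: "continuous_on {-T..T} (P_pert f n \<mu> i)"
  unfolding P_pert_def by (intro continuous_intros f)

lemma cont_Q: "continuous_on {-T..T} (Q_pert f m \<mu> i)"
  unfolding Q_pert_def by (intro continuous_intros f)

definition x0 :: "real \<Rightarrow> real" where "x0 t = \<rho> * W t"

text \<open>A solution of the variational equation along \<open>x0\<close>, positive and equal to 1
  at both ends. Substituting x = x0 + \<epsilon> E z removes the term linear in z that carries no
  \<epsilon>. Dividing the orbit by \<rho> in \<open>W\<close> keeps \<open>E\<close> usable at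
  \<rho> = 0.\<close>

definition E :: "real \<Rightarrow> real" where "E t = W t ^ p"

lemma x0_deriv: "t \<in> {-T..T} \<Longrightarrow> (x0 has_real_derivative f 1 t * x0 t ^ p) (at t within {-T..T})"
proof -
  have "\<rho> ^ p = \<rho> * \<rho> ^ (p - 1)" using pq by (simp add: power_eq_if)
  then show "t \<in> {-T..T} \<Longrightarrow> ?thesis"
    unfolding x0_def by (intro DERIV_cong[OF DERIV_cmult[OF W_deriv]]) (simp_all add: power_mult_distrib)
qed

lemma E_deriv:
  "t \<in> {-T..T} \<Longrightarrow> (E has_real_derivative real p * f 1 t * x0 t ^ (p - 1) * E t) (at t within {-T..T})"
  unfolding E_def[abs_def] x0_def
  by (rule DERIV_cong[OF DERIV_power[OF W_deriv]]) (auto simp: power_mult_distrib)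

lemma E_pos: "t \<in> {-T..T} \<Longrightarrow> E t > 0"
  using W_pos by (simp add: E_def)

text \<open>The coefficients of \<epsilon>^i z^j after the substitution x = x0 + \<epsilon> E z and
  division by \<epsilon> E. The three summands come from \<open>f 1\<close> and from the
  perturbations of order 1 and 2, which shifts \<open>i\<close> to j - 1, j and j + 1. For
  \<open>f 1\<close> the terms j = 0 and j = 1 are cancelled by the equations of \<open>x0\<close>
  and \<open>E\<close>. For j > p or j > q the binomial is 0, so truncated subtraction does no
  harm.\<close>

definition coeff :: "params \<Rightarrow> nat \<Rightarrow> nat \<Rightarrow> real \<Rightarrow> real" where
  "coeff \<mu> i j t =
     ((if 2 \<le> j \<and> i = j - 1 then f 1 t * (real (p choose j) * x0 t ^ (p - j)) else 0) +
      (if i = j then P_pert f n \<mu> 1 t * (real (p choose j) * x0 t ^ (p - j)) +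
         Q_pert f m \<mu> 1 t * (real (q choose j) * x0 t ^ (q - j)) else 0) +
      (if i = j + 1 then P_pert f n \<mu> 2 t * (real (p choose j) * x0 t ^ (p - j)) +
         Q_pert f m \<mu> 2 t * (real (q choose j) * x0 t ^ (q - j)) else 0)) * E t ^ j / E t"

lemma coeff_ode: "fps_ode (-T) T (coeff \<mu>)"
proof
  have x0: "continuous_on {-T..T} x0" unfolding x0_def by (intro continuous_intros cont_W)
  have E: "continuous_on {-T..T} E" unfolding E_def by (intro continuous_intros cont_W)
  have E0: "E t \<noteq> 0" if "t \<in> {-T..T}" for t using E_pos[OF that] by simp
  show "continuous_on {-T..T} (coeff \<mu> i j)" for i j
    unfolding coeff_def
    by (cases "2 \<le> j \<and> i = j - 1"; cases "i = j"; cases "i = j + 1")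
      (auto intro!: continuous_intros x0 E cont_P cont_Q f E0)
qed (use T in \<open>auto simp: coeff_def\<close>)

text \<open>One range serves for both indices: nonzero terms have j \<le> max p q and i \<le> j + 1,
  hence both are at most p + q + 1. The proof is the binomial expansion of both powers.\<close>

lemma sum_coeff:
  assumes t: "t \<in> {-T..T}"
  defines "d \<equiv> p + q + 1"
  shows "\<epsilon> * E t * (\<Sum>i\<le>d. \<Sum>j\<le>d. coeff \<mu> i j t * (\<epsilon> ^ i * z ^ j)) =
    (f 1 t + \<epsilon> * P_pert f n \<mu> 1 t + \<epsilon>\<^sup>2 * P_pert f n \<mu> 2 t) * (x0 t + \<epsilon> * E t * z) ^ p
    + (\<epsilon> * Q_pert f m \<mu> 1 t + \<epsilon>\<^sup>2 * Q_pert f m \<mu> 2 t) * (x0 t + \<epsilon> * E t * z) ^ q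
    - f 1 t * x0 t ^ p - real p * f 1 t * x0 t ^ (p - 1) * (\<epsilon> * E t * z)"
proof -
  define y where "y = \<epsilon> * E t * z"
  have E0: "E t \<noteq> 0" using E_pos[OF t] by simp
  define B where "B r j = real (r choose j) * x0 t ^ (r - j)" for r j
  have binom: "(x0 t + y) ^ r = (\<Sum>j\<le>r. B r j * y ^ j)" for r
    unfolding B_def by (subst add.commute, subst binomial_ring) (simp add: mult_ac)
  have ext: "(\<Sum>j\<le>k. B r j * y ^ j) = (x0 t + y) ^ r" if "r \<le> k" for r k
    unfolding binom B_def using that by (intro sum.mono_neutral_right) auto
  have "\<epsilon> * E t * (\<Sum>i\<le>d. \<Sum>j\<le>d. coeff \<mu> i j t * (\<epsilon> ^ i * z ^ j)) =
      (\<Sum>j\<le>d. \<Sum>i\<le>d. \<epsilon> * E t * (coeff \<mu> i j t * (\<epsilon> ^ i * z ^ j)))"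
    by (subst sum.swap) (simp add: sum_distrib_left)
  also have "\<dots> = (\<Sum>j\<le>d. (if 2 \<le> j then f 1 t * B p j * y ^ j else 0) +
        \<epsilon> * (P_pert f n \<mu> 1 t * B p j + Q_pert f m \<mu> 1 t * B q j) * y ^ j +
        (if j < d then \<epsilon>\<^sup>2 * (P_pert f n \<mu> 2 t * B p j + Q_pert f m \<mu> 2 t * B q j) * y ^ j else 0))"
  proof (rule sum.cong[OF refl])
    fix j assume j: "j \<in> {..d}"
    define R where "R i = (P_pert f n \<mu> i t * B p j + Q_pert f m \<mu> i t * B q j)" for i
    have "\<epsilon> * E t * (coeff \<mu> i j t * (\<epsilon> ^ i * z ^ j)) =
        (if i = j - 1 then (if 2 \<le> j then f 1 t * B p j * (\<epsilon> ^ Suc i * E t ^ j * z ^ j) else 0) else 0) +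
        (if i = j then R 1 * (\<epsilon> ^ Suc i * E t ^ j * z ^ j) else 0) +
        (if i = j + 1 then R 2 * (\<epsilon> ^ Suc i * E t ^ j * z ^ j) else 0)" for i
    proof -
      have key: "\<epsilon> * E t * (a * E t ^ j / E t * (\<epsilon> ^ i * z ^ j)) = a * (\<epsilon> ^ Suc i * E t ^ j * z ^ j)" for a
        using E0 by simp
      have distr: "((if c1 \<and> c2 then u else 0) + (if c3 then v else 0) + (if c4 then w else 0)) * X =
          (if c2 then (if c1 then u * X else 0) else 0) + (if c3 then v * X else 0) + (if c4 then w * X else 0)"
        for c1 c2 c3 c4 and u v w X :: real by (auto simp: distrib_right)
      show ?thesis unfolding coeff_def key B_def R_def by (rule distr)
    qed
    then have "(\<Sum>i\<le>d. \<epsilon> * E t * (coeff \<mu> i j t * (\<epsilon> ^ i * z ^ j))) =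
        (if 2 \<le> j then f 1 t * B p j * (\<epsilon> ^ Suc (j - 1) * E t ^ j * z ^ j) else 0) +
        R 1 * (\<epsilon> ^ Suc j * E t ^ j * z ^ j) +
        (if Suc j \<le> d then R 2 * (\<epsilon> ^ Suc (Suc j) * E t ^ j * z ^ j) else 0)"
      using j less_imp_diff_less[of j "Suc d" 1] by (simp add: sum.distrib sum.delta)
    also have "\<dots> = (if 2 \<le> j then f 1 t * B p j * y ^ j else 0) + \<epsilon> * R 1 * y ^ j +
        (if j < d then \<epsilon>\<^sup>2 * R 2 * y ^ j else 0)"
      by (auto simp: y_def power_mult_distrib power2_eq_square)
    finally show "(\<Sum>i\<le>d. \<epsilon> * E t * (coeff \<mu> i j t * (\<epsilon> ^ i * z ^ j))) =
        (if 2 \<le> j then f 1 t * B p j * y ^ j else 0) +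
        \<epsilon> * (P_pert f n \<mu> 1 t * B p j + Q_pert f m \<mu> 1 t * B q j) * y ^ j +
        (if j < d then \<epsilon>\<^sup>2 * (P_pert f n \<mu> 2 t * B p j + Q_pert f m \<mu> 2 t * B q j) * y ^ j else 0)"
      by (simp add: R_def)
  qed
  also have "\<dots> = (\<Sum>j\<le>d. if 2 \<le> j then f 1 t * B p j * y ^ j else 0) +
      \<epsilon> * (P_pert f n \<mu> 1 t * (\<Sum>j\<le>d. B p j * y ^ j) + Q_pert f m \<mu> 1 t * (\<Sum>j\<le>d. B q j * y ^ j)) +
      \<epsilon>\<^sup>2 * (P_pert f n \<mu> 2 t * (\<Sum>j\<le>p + q. B p j * y ^ j) + Q_pert f m \<mu> 2 t * (\<Sum>j\<le>p + q. B q j * y ^ j))"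
  proof -
    have "(\<Sum>j\<le>d. if j < d then g j else 0) = (\<Sum>j\<le>p + q. g j)" for g :: "nat \<Rightarrow> real"
      unfolding d_def by (intro sum.mono_neutral_cong_right) auto
    then show ?thesis
      by (simp add: sum.distrib sum_distrib_left algebra_simps)
  qed
  also have "(\<Sum>j\<le>d. if 2 \<le> j then f 1 t * B p j * y ^ j else 0) =
      f 1 t * (x0 t + y) ^ p - f 1 t * x0 t ^ p - real p * f 1 t * x0 t ^ (p - 1) * y"
  proof -
    have "(\<Sum>j\<le>d. if 2 \<le> j then f 1 t * B p j * y ^ j else 0) =
        (\<Sum>j\<le>d. f 1 t * (B p j * y ^ j) - (if j = 0 then f 1 t * B p j * y ^ j else 0)
          - (if j = 1 then f 1 t * B p j * y ^ j else 0))"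
      by (intro sum.cong) auto
    also have "\<dots> = f 1 t * (\<Sum>j\<le>d. B p j * y ^ j) - f 1 t * B p 0 - f 1 t * B p 1 * y"
    proof -
      have "(\<Sum>j\<le>d. if j = 0 then g j else 0) = g 0" "(\<Sum>j\<le>d. if j = 1 then g j else 0) = g 1"
        for g :: "nat \<Rightarrow> real" by (simp_all add: sum.delta d_def del: sum.atMost_Suc)
      then show ?thesis by (simp only: sum_subtractf sum_distrib_left[symmetric]) simp
    qed
    finally show ?thesis using ext[of p d] by (simp add: d_def B_def mult_ac)
  qed
  finally have eq: "\<epsilon> * E t * (\<Sum>i\<le>d. \<Sum>j\<le>d. coeff \<mu> i j t * (\<epsilon> ^ i * z ^ j)) =
      f 1 t * (x0 t + y) ^ p - f 1 t * x0 t ^ p - real p * f 1 t * x0 t ^ (p - 1) * y +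
      \<epsilon> * (P_pert f n \<mu> 1 t * (\<Sum>j\<le>d. B p j * y ^ j) + Q_pert f m \<mu> 1 t * (\<Sum>j\<le>d. B q j * y ^ j)) +
      \<epsilon>\<^sup>2 * (P_pert f n \<mu> 2 t * (\<Sum>j\<le>p + q. B p j * y ^ j) + Q_pert f m \<mu> 2 t * (\<Sum>j\<le>p + q. B q j * y ^ j))" .
  have "p \<le> d" "q \<le> d" by (auto simp: d_def)
  then show ?thesis
    unfolding eq y_def[symmetric] by (simp add: ext algebra_simps del: sum.atMost_Suc)
qed

text \<open>At \<open>T\<close> both \<open>W\<close> and \<open>E\<close> equal 1, so the
  displacement is \<epsilon> z(T); the factor \<epsilon> accounts for the index shift. Uniqueness of
  solutions and of expansions resolves the two definite descriptions.\<close>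

lemma melnikov_eq_sol:
  "melnikov f T p q n m (Suc k) \<mu> \<rho> = fps_nth (fps_ode.sol (-T) (p + q + 1) (coeff \<mu>) T) k"
proof -
  interpret fps_ode "-T" T "p + q + 1" "coeff \<mu>" by (rule coeff_ode)
  obtain r where r: "r > 0" "\<And>t. t \<in> {-T..T} \<Longrightarrow> fps_conv_radius (sol t) \<ge> ereal r"
    and d: "\<And>\<epsilon> t. \<bar>\<epsilon>\<bar> < r \<Longrightarrow> t \<in> {-T..T} \<Longrightarrow> ((\<lambda>t. eval_fps (sol t) \<epsilon>) has_real_derivative
       (\<Sum>i\<le>p + q + 1. \<Sum>j\<le>p + q + 1. coeff \<mu> i j t * (\<epsilon> ^ i * eval_fps (sol t) \<epsilon> ^ j))) (at t within {-T..T})"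
    using eval_sol by blast
  have T_in: "T \<in> {-T..T}" "-T \<in> {-T..T}" using T by auto
  have end_val: "end_value f T p q n m \<mu> \<rho> \<epsilon> = \<rho> + \<epsilon> * eval_fps (sol T) \<epsilon>" if \<epsilon>: "\<bar>\<epsilon>\<bar> < r" for \<epsilon>
  proof -
    define x where "x t = x0 t + \<epsilon> * E t * eval_fps (sol t) \<epsilon>" for t
    have "is_solution f T p q n m \<mu> \<epsilon> x"
      unfolding is_solution_def
    proof
      fix t assume t: "t \<in> {-T..T}"
      let ?z = "eval_fps (sol t) \<epsilon>"
      let ?R = "\<Sum>i\<le>p + q + 1. \<Sum>j\<le>p + q + 1. coeff \<mu> i j t * (\<epsilon> ^ i * ?z ^ j)"
      have "(x has_real_derivative f 1 t * x0 t ^ p +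
          (\<epsilon> * (real p * f 1 t * x0 t ^ (p - 1) * E t) * ?z + ?R * (\<epsilon> * E t))) (at t within {-T..T})"
        unfolding x_def[abs_def]
        by (intro DERIV_add DERIV_mult DERIV_cmult x0_deriv E_deriv d \<epsilon> t)
      then show "(x has_real_derivative
        (f 1 t + \<epsilon> * P_pert f n \<mu> 1 t + \<epsilon>\<^sup>2 * P_pert f n \<mu> 2 t) * x t ^ p
         + (\<epsilon> * Q_pert f m \<mu> 1 t + \<epsilon>\<^sup>2 * Q_pert f m \<mu> 2 t) * x t ^ q) (at t within {-T..T})"
        by (rule DERIV_cong)
          (use sum_coeff[OF t, of \<epsilon> \<mu> ?z] in \<open>simp add: x_def mult_ac\<close>)
    qed
    moreover have "fps_nth (sol (-T)) k = 0" for k using T sol_nth[of "-T" k] by simp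
    then have "sol (-T) = 0" by (simp add: fps_eq_iff)
    then have "x (-T) = \<rho>" by (simp add: x_def x0_def W_ends)
    moreover have "x T = \<rho> + \<epsilon> * eval_fps (sol T) \<epsilon>" by (simp add: x_def x0_def E_def W_ends)
    moreover have "y T = x T" if y: "is_solution f T p q n m \<mu> \<epsilon> y" "y (-T) = \<rho>" for y
    proof (rule polynomial_ode_unique[where a = "-T" and b = T and x = y and y = x and t = T and p = p and q = q])
      show "continuous_on {-T..T} (\<lambda>t. f 1 t + \<epsilon> * P_pert f n \<mu> 1 t + \<epsilon>\<^sup>2 * P_pert f n \<mu> 2 t)"
        "continuous_on {-T..T} (\<lambda>t. \<epsilon> * Q_pert f m \<mu> 1 t + \<epsilon>\<^sup>2 * Q_pert f m \<mu> 2 t)"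
        by (intro continuous_intros f cont_P cont_Q)+
      show "y (-T) = x (-T)" using y \<open>x (-T) = \<rho>\<close> by simp
      show "T \<in> {-T..T}" using T by simp
    qed (use y(1) \<open>is_solution f T p q n m \<mu> \<epsilon> x\<close> in \<open>simp_all add: is_solution_def\<close>)
    ultimately show ?thesis
      unfolding end_value_def by (intro the_equality) (metis, metis)
  qed
  have X: "(\<lambda>\<epsilon>. \<epsilon> * eval_fps (sol T) \<epsilon>) has_fps_expansion (fps_X * sol T)"
    by (intro fps_expansion_intros eval_fps_has_fps_expansion)
      (use r(1) r(2)[OF T_in(1)] in \<open>auto intro: less_le_trans[of _ "ereal r"]\<close>)
  have "eventually (\<lambda>\<epsilon>. \<bar>\<epsilon>\<bar> < r) (nhds (0::real))"
    using r(1) by (auto simp: eventually_nhds_metric)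
  then have "eventually (\<lambda>\<epsilon>. \<epsilon> * eval_fps (sol T) \<epsilon> = end_value f T p q n m \<mu> \<rho> \<epsilon> - \<rho>) (nhds 0)"
    by eventually_elim (simp add: end_val)
  moreover have "eventually (\<lambda>\<epsilon>. eval_fps (fps_X * sol T) \<epsilon> = \<epsilon> * eval_fps (sol T) \<epsilon>) (nhds 0)"
    using X by (simp add: has_fps_expansion_def)
  ultimately have "eventually (\<lambda>\<epsilon>. eval_fps (fps_X * sol T) \<epsilon> = end_value f T p q n m \<mu> \<rho> \<epsilon> - \<rho>) (nhds 0)"
    by eventually_elim simp
  then have "(\<lambda>\<epsilon>. end_value f T p q n m \<mu> \<rho> \<epsilon> - \<rho>) has_fps_expansion (fps_X * sol T)"
    using X by (simp add: has_fps_expansion_def)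
  then have "(THE G. (\<lambda>\<epsilon>. end_value f T p q n m \<mu> \<rho> \<epsilon> - \<rho>) has_fps_expansion G) = fps_X * sol T"
    using has_fps_expansion_unique by (intro the_equality) blast+
  then show ?thesis by (simp add: melnikov_def)
qed

text \<open>The power W^(q-p), written as a quotient because q - p may be negative. Its derivative
  is a multiple of \<open>f 1\<close> times W^(q-1), which is what the later integration by parts
  uses.\<close>

definition V :: "real \<Rightarrow> real" where "V t = W t ^ q / W t ^ p"

lemma V_deriv:
  assumes t: "t \<in> {-T..T}"
  shows "(V has_real_derivative (real q - real p) * \<rho> ^ (p - 1) * f 1 t * W t ^ (q - 1)) (at t within {-T..T})"
proof -
  obtain p' q' where pq': "p = Suc p'" "q = Suc q'" using pq by (metis Suc_le_D numeral_2_eq_2)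
  have W: "W t > 0" using W_pos t by blast
  have "(V has_real_derivative (real q * (\<rho> ^ (p - 1) * f 1 t * W t ^ p * W t ^ (q - 1)) * W t ^ p -
      W t ^ q * (real p * (\<rho> ^ (p - 1) * f 1 t * W t ^ p * W t ^ (p - 1)))) / (W t ^ p * W t ^ p))
      (at t within {-T..T})"
    unfolding V_def[abs_def]
    using DERIV_divide[OF DERIV_power[OF W_deriv[OF t], of q] DERIV_power[OF W_deriv[OF t], of p]] W
    by simp
  then show ?thesis
    by (rule DERIV_cong) (use W in \<open>simp add: pq' field_simps\<close>)
qed

lemma cont_V: "continuous_on {-T..T} V"
  using V_deriv by (rule DERIV_continuous_on)

text \<open>The coefficient of z at \<epsilon> = 0, that is, the first-order displacement along the
  orbit divided by \<open>E\<close>.\<close>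

definition D0 :: "params \<Rightarrow> real \<Rightarrow> real" where
  "D0 \<mu> t = integral {-T..t} (\<lambda>t. \<rho> ^ p * P_pert f n \<mu> 1 t + \<rho> ^ q * (Q_pert f m \<mu> 1 t * V t))"

lemma coeff_first_order: "t \<in> {-T..T} \<Longrightarrow> coeff \<mu> 0 0 t = \<rho> ^ p * P_pert f n \<mu> 1 t + \<rho> ^ q * (Q_pert f m \<mu> 1 t * V t)"
  and coeff_second_order: "t \<in> {-T..T} \<Longrightarrow> coeff \<mu> 1 0 t = \<rho> ^ p * P_pert f n \<mu> 2 t + \<rho> ^ q * (Q_pert f m \<mu> 2 t * V t)"
  using W_pos[of t] by (simp_all add: coeff_def x0_def E_def V_def power_mult_distrib add_divide_distrib)

lemma melnikov_1_integral:
  "melnikov f T p q n m 1 \<mu> \<rho> = D0 \<mu> T"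
proof -
  interpret fps_ode "-T" T "p + q + 1" "coeff \<mu>" by (rule coeff_ode)
  have "melnikov f T p q n m 1 \<mu> \<rho> = fps_nth (sol T) 0" using melnikov_eq_sol[of 0] by simp
  also have "\<dots> = D0 \<mu> T"
    unfolding D0_def using T by (subst sol_nth_0) (auto intro!: integral_cong simp: coeff_first_order)
  finally show ?thesis .
qed

lemma D0_deriv:
  "t \<in> {-T..T} \<Longrightarrow> (D0 \<mu> has_real_derivative
     \<rho> ^ p * P_pert f n \<mu> 1 t + \<rho> ^ q * (Q_pert f m \<mu> 1 t * V t)) (at t within {-T..T})"
  unfolding D0_def[abs_def]
  by (rule integral_has_real_derivative) (auto intro!: continuous_intros cont_P cont_Q cont_V)

lemma cont_D0: "continuous_on {-T..T} (D0 \<mu>)"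
  using D0_deriv by (rule DERIV_continuous_on)

text \<open>The terms quadratic and linear in \<open>D0\<close> combine after an integration by parts, since
  \<open>D0\<close> vanishes at both ends.\<close>

lemma melnikov_2_integral:
  assumes \<rho>: "\<rho> \<noteq> 0" and D0_T: "D0 \<mu> T = 0"
  shows "melnikov f T p q n m 2 \<mu> \<rho> =
    integral {-T..T} (\<lambda>t. \<rho> ^ p * P_pert f n \<mu> 2 t + \<rho> ^ q * (Q_pert f m \<mu> 2 t * V t)) +
    (real q - real p) * \<rho> ^ (q - 1) * integral {-T..T} (\<lambda>t. D0 \<mu> t * (Q_pert f m \<mu> 1 t * W t ^ (q - 1)))"
proof -
  interpret fps_ode "-T" T "p + q + 1" "coeff \<mu>" by (rule coeff_ode)
  let ?P = "P_pert f n \<mu> 1" and ?Q = "Q_pert f m \<mu> 1"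
  let ?e0 = "\<lambda>t. \<rho> ^ p * P_pert f n \<mu> 2 t + \<rho> ^ q * (Q_pert f m \<mu> 2 t * V t)"
  let ?h = "\<lambda>t. D0 \<mu> t * (?Q t * W t ^ (q - 1))"
  \<comment> \<open>Its derivative contains the whole quadratic term and the whole P-part of the
    linear term; from the Q-part, which carries the factor q, it takes p times, so that q - p is
    left.\<close>
  define k where "k t = real p / (2 * \<rho>) * (W t ^ (p - 1) * (D0 \<mu> t)^2)" for t
  define k' where "k' t = real p / (2 * \<rho>) * (real (p - 1) * (\<rho> ^ (p - 1) * f 1 t * W t ^ p * W t ^ (p - 2)) * (D0 \<mu> t)^2 +
      2 * ((\<rho> ^ p * ?P t + \<rho> ^ q * (?Q t * V t)) * D0 \<mu> t) * W t ^ (p - 1))" for t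
  have p2: "p - Suc (Suc 0) = p - 2" by simp
  have k: "(k has_real_derivative k' t) (at t within {-T..T})" if t: "t \<in> {-T..T}" for t
    unfolding k_def[abs_def] k'_def
    using DERIV_cmult[OF DERIV_mult[OF DERIV_power[OF W_deriv[OF t], of "p - 1"] DERIV_power[OF D0_deriv[OF t, of \<mu>], of 2]], of "real p / (2 * \<rho>)"]
    by (simp add: p2)
  have "(k' has_integral (k T - k (-T))) {-T..T}"
    using T k by (intro fundamental_theorem_of_calculus)
      (auto simp: has_real_derivative_iff_has_vector_derivative[symmetric])
  moreover have "k T = 0" "k (-T) = 0" using D0_T by (simp_all add: k_def D0_def)
  ultimately have k'0: "(k' has_integral 0) {-T..T}" by simp
  have "melnikov f T p q n m 2 \<mu> \<rho> = fps_nth (sol T) 1"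
    using melnikov_eq_sol[of 1 \<mu>] by (simp add: numeral_2_eq_2)
  also have "\<dots> = integral {-T..T} (\<lambda>x. \<Sum>j\<le>p + q + 1. coeff \<mu> 1 j x * fps_nth (sol x) 0 ^ j)"
    using T by (subst sol_nth_1) auto
  also have "\<dots> = integral {-T..T} (\<lambda>t. ?e0 t + (k' t + (real q - real p) * \<rho> ^ (q - 1) * ?h t))"
  proof (rule integral_cong)
    fix t assume t: "t \<in> {-T..T}"
    have D0: "fps_nth (sol t) 0 = D0 \<mu> t"
      unfolding D0_def using t by (subst sol_nth_0) (auto intro!: integral_cong simp: coeff_first_order)
    have "(\<Sum>j\<le>p + q + 1. coeff \<mu> 1 j t * D0 \<mu> t ^ j) = (\<Sum>j\<in>{0,1,2}. coeff \<mu> 1 j t * D0 \<mu> t ^ j)"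
      using pq by (intro sum.mono_neutral_right) (auto simp: coeff_def)
    also have "\<dots> = ?e0 t + (coeff \<mu> 1 1 t * D0 \<mu> t + coeff \<mu> 1 2 t * (D0 \<mu> t)^2)"
      using coeff_second_order[OF t, of \<mu>] by simp
    also have "coeff \<mu> 1 1 t * D0 \<mu> t + coeff \<mu> 1 2 t * (D0 \<mu> t)^2 =
        k' t + (real q - real p) * \<rho> ^ (q - 1) * ?h t"
    proof -
      obtain p' q' where pq': "p = Suc (Suc p')" "q = Suc (Suc q')"
        using pq by (metis add_2_eq_Suc le_Suc_ex)
      have W: "W t > 0" using W_pos t by blast
      have ch: "real (p choose 2) = real p * real (p - 1) / 2"
      proof -
        have "even (p * (p - 1))" using pq by (cases "even p") auto
        then show ?thesis by (simp only: choose_two real_of_nat_div) simp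
      qed
      have 1: "coeff \<mu> 1 1 t = ?P t * (real p * (\<rho> * W t) ^ (p - 1)) + ?Q t * (real q * (\<rho> * W t) ^ (q - 1))"
        using W by (simp add: coeff_def E_def x0_def)
      have 2: "coeff \<mu> 1 2 t = f 1 t * (real p * real (p - 1) / 2 * (\<rho> * W t) ^ (p - 2)) * W t ^ p"
        using W unfolding coeff_def E_def x0_def ch by (simp add: power2_eq_square)
      show ?thesis unfolding 1 2 k'_def V_def using W \<rho>
        by (simp add: pq' field_simps power_mult_distrib power2_eq_square)
    qed
    finally show "(\<Sum>j\<le>p + q + 1. coeff \<mu> 1 j t * fps_nth (sol t) 0 ^ j) =
        ?e0 t + (k' t + (real q - real p) * \<rho> ^ (q - 1) * ?h t)" by (simp only: D0)
  qed
  also have "\<dots> = integral {-T..T} ?e0 + (0 + (real q - real p) * \<rho> ^ (q - 1) * integral {-T..T} ?h)"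
  proof (rule integral_unique, intro has_integral_add k'0 has_integral_mult_right integrable_integral)
    show "?e0 integrable_on {-T..T}" "?h integrable_on {-T..T}"
      by (intro integrable_continuous_interval continuous_intros cont_P cont_Q cont_V cont_D0 cont_W)+
  qed
  finally show ?thesis by simp
qed

end

section \<open>The first two Melnikov functions\<close>

lemma integral_symmetric_interval:
  fixes g :: "real \<Rightarrow> real"
  assumes g: "continuous_on {-a..a} g" and a: "0 \<le> a"
  shows "integral {-a..a} g = integral {0..a} (\<lambda>t. g t + g (-t))"
proof -
  have i: "g integrable_on {-a..a}" "g integrable_on {0..a}" "g integrable_on {-a..0}"
    using a by (auto intro!: integrable_continuous_interval continuous_on_subset[OF g])
  have "integral {-a..0} g = integral {0..a} (\<lambda>t. g (-t))"
    using Henstock_Kurzweil_Integration.integral_reflect_real[of a 0 "\<lambda>t. g (-t)"] by simp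
  moreover have "(\<lambda>t. g (-t)) integrable_on {0..a}"
    using a by (intro integrable_continuous_interval continuous_on_compose2[OF g]) (auto intro!: continuous_intros)
  ultimately have "integral {0..a} (\<lambda>t. g t + g (-t)) = integral {0..a} g + integral {-a..0} g"
    using i by (simp add: integral_add)
  then show ?thesis using Henstock_Kurzweil_Integration.integral_combine[of "-a" 0 a g] i a by simp
qed

lemma integral_odd_function:
  fixes g :: "real \<Rightarrow> real"
  assumes "continuous_on {-a..a} g" "0 \<le> a" "\<And>t. t \<in> {0..a} \<Longrightarrow> g (-t) = - g t"
  shows "integral {-a..a} g = 0"
  unfolding integral_symmetric_interval[OF assms(1,2)] using assms(3)
  by (subst integral_cong[of _ _ "\<lambda>_. 0"]) auto

lemma even_part_minus: "even_part g (-t) = even_part g t"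
  by (simp add: even_part_def)

lemma even_part_sum: "even_part (\<lambda>t. \<Sum>j\<in>A. c j * g j t) t = (\<Sum>j\<in>A. c j * even_part (g j) t)"
  by (simp add: even_part_def sum.distrib[symmetric] sum_divide_distrib algebra_simps)

lemma continuous_on_even_part:
  assumes "continuous_on {-a..a} g"
  shows "continuous_on {-a..a} (even_part g)"
  unfolding even_part_def[abs_def] using assms
  by (auto intro!: continuous_intros continuous_on_compose2[OF assms])

lemma integral_even_part:
  assumes "continuous_on {-a..a} g" "0 \<le> a"
  shows "integral {-a..a} (even_part g) = integral {-a..a} g"
  using integral_symmetric_interval[OF continuous_on_even_part[OF assms(1)] assms(2)]
    integral_symmetric_interval[OF assms]
  by (simp add: even_part_minus) (simp add: even_part_def)

lemma integral_even_function:
  fixes g :: "real \<Rightarrow> real"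
  assumes g: "continuous_on {-a..a} g" and odd: "\<And>t. t \<in> {-a..a} \<Longrightarrow> g (-t) = - g t" and t: "t \<in> {-a..a}"
  shows "integral {-a..-t} g = integral {-a..t} g"
proof -
  have *: "integral {-a..-u} g = integral {-a..u} g" if u: "u \<in> {0..a}" for u
  proof -
    have "integral {-u..u} g = 0"
      using u odd by (intro integral_odd_function continuous_on_subset[OF g]) auto
    moreover have "integral {-a..-u} g + integral {-u..u} g = integral {-a..u} g"
      using u by (intro Henstock_Kurzweil_Integration.integral_combine integrable_continuous_interval continuous_on_subset[OF g]) auto
    ultimately show ?thesis by simp
  qed
  show ?thesis using *[of t] *[of "-t"] t by (cases "t \<ge> 0") auto
qed

locale abel_family =
  fixes f :: "nat \<Rightarrow> real \<Rightarrow> real" and T :: real and p q n m :: nat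
  assumes T: "T > 0" and pq: "p \<ge> 2" "q \<ge> 2" "p \<noteq> q"
    and f: "\<And>i. continuous_on {-T..T} (f i)"
    and f1_odd: "\<And>t. t \<in> {-T..T} \<Longrightarrow> f 1 (-t) = - f 1 t"
    and mean_zero: "\<And>k. k \<ge> 1 \<Longrightarrow> integral {-T..T} (f k) = 0"
    and F_mono: "strict_mono_on {0..T} (\<lambda>t. integral {-T..t} (f 1))"
begin

definition F :: "real \<Rightarrow> real" where "F t = integral {-T..t} (f 1)"

lemma F_cont: "continuous_on {-T..T} F"
  unfolding F_def by (intro indefinite_integral_continuous_1 integrable_continuous_interval f)

sublocale power_kernel T F
  using T F_mono F_cont unfolding F_def[abs_def]
  by unfold_locales (auto intro: continuous_on_subset)

lemma F_even: "t \<in> {-T..T} \<Longrightarrow> F (-t) = F t"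
  unfolding F_def by (rule integral_even_function[OF f f1_odd])

lemma F_ends: "F (-T) = 0" "F T = 0"
  using mean_zero[of 1] by (simp_all add: F_def)

definition \<sigma> :: "real \<Rightarrow> real" where "\<sigma> \<rho> = (real p - 1) * \<rho> ^ (p - 1)"

definition \<alpha> :: real where "\<alpha> = (real q - real p) / (real p - 1)"

definition w :: "real \<Rightarrow> real \<Rightarrow> real" where "w \<rho> t = 1 - \<sigma> \<rho> * F t"

lemma w_alt: "w \<rho> t = 1 + (1 - real p) * \<rho> ^ (p - 1) * integral {-T..t} (f 1)"
  by (simp add: w_def \<sigma>_def F_def algebra_simps)

text \<open>\<open>F\<close> is even and monotone on [0, T], so positivity on all of [-T, T] reduces
  to the two points 0 and \<open>T\<close>. Thus \<open>J\<close> is the preimage of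
  \<open>S\<close>, and the kernel theory applies at \<sigma>(\<rho>).\<close>

lemma J_iff: "\<rho> \<in> J_domain f T p \<longleftrightarrow> \<sigma> \<rho> \<in> S"
proof
  assume "\<rho> \<in> J_domain f T p"
  then have "w \<rho> t > 0" if "t \<in> {-T..T}" for t using that by (simp add: J_domain_def w_alt)
  from this[of 0] this[of T] show "\<sigma> \<rho> \<in> S" using T by (simp add: S_def w_def)
next
  assume S: "\<sigma> \<rho> \<in> S"
  have "w \<rho> t > 0" if t: "t \<in> {-T..T}" for t
  proof -
    have "F t = F \<bar>t\<bar>" using F_even[OF t] by (auto simp: abs_if)
    then show ?thesis using S_pos[OF S, of "\<bar>t\<bar>"] t by (auto simp: w_def)
  qed
  then show "\<rho> \<in> J_domain f T p" by (simp add: J_domain_def w_alt)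
qed

lemma w_pos: "\<rho> \<in> J_domain f T p \<Longrightarrow> t \<in> {-T..T} \<Longrightarrow> w \<rho> t > 0"
  by (simp add: J_domain_def w_alt)

definition W :: "real \<Rightarrow> real \<Rightarrow> real" where "W \<rho> t = w \<rho> t powr (-1 / (real p - 1))"

lemma W_pos: "\<rho> \<in> J_domain f T p \<Longrightarrow> t \<in> {-T..T} \<Longrightarrow> W \<rho> t > 0"
  using w_pos[of \<rho> t] by (simp add: W_def)

lemma W_power: "\<rho> \<in> J_domain f T p \<Longrightarrow> t \<in> {-T..T} \<Longrightarrow> W \<rho> t ^ k = w \<rho> t powr (- real k / (real p - 1))"
proof (induction k)
  case 0
  then show ?case using w_pos[of \<rho> t] by simp
next
  case (Suc k)
  then show ?case
    by (simp add: W_def powr_add[symmetric] diff_divide_distrib)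
qed

lemma unperturbed: "\<rho> \<in> J_domain f T p \<Longrightarrow> unperturbed_orbit f T p q \<rho> (W \<rho>)"
proof
  assume \<rho>: "\<rho> \<in> J_domain f T p"
  fix t assume t: "t \<in> {-T..T}"
  show "W \<rho> t > 0" using W_pos \<rho> t .
  have w: "w \<rho> t > 0" using w_pos \<rho> t .
  have "(F has_real_derivative f 1 t) (at t within {-T..T})"
    unfolding F_def[abs_def] by (rule integral_has_real_derivative[OF f t])
  then have wd: "(w \<rho> has_real_derivative - (\<sigma> \<rho> * f 1 t)) (at t within {-T..T})"
    unfolding w_def[abs_def] by (auto intro!: derivative_eq_intros)
  have "((\<lambda>x. x powr (-1 / (real p - 1))) has_real_derivative
      (-1 / (real p - 1)) * w \<rho> t powr (-1 / (real p - 1) - 1)) (at (w \<rho> t))"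
    using w by (rule has_real_derivative_powr)
  from DERIV_chain2[OF this wd]
  have "(W \<rho> has_real_derivative (-1 / (real p - 1)) * w \<rho> t powr (-1 / (real p - 1) - 1) * (- (\<sigma> \<rho> * f 1 t)))
      (at t within {-T..T})" by (simp add: W_def[abs_def])
  moreover have "-1 / (real p - 1) - 1 = - real p / (real p - 1)" using pq by (simp add: field_simps)
  ultimately show "(W \<rho> has_real_derivative \<rho> ^ (p - 1) * f 1 t * W \<rho> t ^ p) (at t within {-T..T})"
    unfolding W_power[OF \<rho> t] using pq by (elim DERIV_cong) (simp add: \<sigma>_def)
qed (use T pq f in \<open>auto simp: W_def w_def F_ends\<close>)

lemma V_eq: "\<rho> \<in> J_domain f T p \<Longrightarrow> t \<in> {-T..T} \<Longrightarrow> W \<rho> t ^ q / W \<rho> t ^ p = w \<rho> t powr (-\<alpha>)"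
  by (simp add: W_power powr_diff[symmetric] \<alpha>_def diff_divide_distrib[symmetric])
    (simp add: diff_divide_distrib)

lemma w_even: "t \<in> {-T..T} \<Longrightarrow> w \<rho> (-t) = w \<rho> t"
  by (simp add: w_def F_even)

lemma cont_w_powr: "\<rho> \<in> J_domain f T p \<Longrightarrow> continuous_on {-T..T} (\<lambda>t. w \<rho> t powr \<gamma>)"
  using w_pos[of \<rho>] unfolding w_def by (auto intro!: continuous_intros F_cont simp: less_imp_neq[symmetric])

text \<open>The weight is a function of the even function \<open>F\<close>, so the odd part of
  \<open>g\<close> integrates to zero.\<close>

lemma integral_weight_even:
  assumes \<rho>: "\<rho> \<in> J_domain f T p" and g: "continuous_on {-T..T} g"
  shows "integral {-T..T} (\<lambda>t. g t * w \<rho> t powr (-\<gamma>)) = N (\<lambda>t. 2 * even_part g t) \<gamma> (\<sigma> \<rho>)"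
proof -
  have "continuous_on {-T..T} (\<lambda>t. g t * w \<rho> t powr (-\<gamma>))"
    by (intro continuous_intros g cont_w_powr[OF \<rho>])
  from integral_symmetric_interval[OF this] T
  have "integral {-T..T} (\<lambda>t. g t * w \<rho> t powr (-\<gamma>)) =
      integral {0..T} (\<lambda>t. g t * w \<rho> t powr (-\<gamma>) + g (-t) * w \<rho> (-t) powr (-\<gamma>))" by simp
  also have "\<dots> = N (\<lambda>t. 2 * even_part g t) \<gamma> (\<sigma> \<rho>)"
    unfolding N_def
  proof (rule integral_cong)
    fix t assume "t \<in> {0..T}"
    then have "w \<rho> (-t) = w \<rho> t" by (intro w_even) auto
    then show "g t * w \<rho> t powr (-\<gamma>) + g (-t) * w \<rho> (-t) powr (-\<gamma>) =
        2 * even_part g t * (1 - \<sigma> \<rho> * F t) powr (-\<gamma>)"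
      unfolding w_def[of \<rho> t, symmetric] by (simp add: even_part_def distrib_right)
  qed
  finally show ?thesis .
qed

lemma cont_P: "continuous_on {-T..T} (P_pert f n \<mu> i)"
  unfolding P_pert_def by (intro continuous_intros f)

lemma cont_Q: "continuous_on {-T..T} (Q_pert f m \<mu> i)"
  unfolding Q_pert_def by (intro continuous_intros f)

lemma integral_P: "integral {-T..T} (P_pert f n \<mu> i) = fst \<mu> i 0 * integral {-T..T} (f 0)"
proof -
  have "integral {-T..T} (P_pert f n \<mu> i) = (\<Sum>j=0..n. fst \<mu> i j * integral {-T..T} (f j))"
    unfolding P_pert_def using f
    by (subst integral_sum) (auto intro!: integrable_continuous_interval continuous_intros)
  also have "\<dots> = (\<Sum>j\<in>{0}. fst \<mu> i j * integral {-T..T} (f j))"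
    by (intro sum.mono_neutral_right) (auto simp: mean_zero)
  finally show ?thesis by simp
qed

lemma PQ_integral:
  assumes \<rho>: "\<rho> \<in> J_domain f T p"
  shows "integral {-T..T} (\<lambda>t. \<rho> ^ p * P_pert f n \<mu> i t + \<rho> ^ q * (Q_pert f m \<mu> i t * (W \<rho> t ^ q / W \<rho> t ^ p))) =
    \<rho> ^ p * (fst \<mu> i 0 * integral {-T..T} (f 0)) + \<rho> ^ q * N (\<lambda>t. 2 * even_part (Q_pert f m \<mu> i) t) \<alpha> (\<sigma> \<rho>)"
proof -
  have "integral {-T..T} (\<lambda>t. \<rho> ^ p * P_pert f n \<mu> i t + \<rho> ^ q * (Q_pert f m \<mu> i t * (W \<rho> t ^ q / W \<rho> t ^ p))) =
    integral {-T..T} (\<lambda>t. \<rho> ^ p * P_pert f n \<mu> i t + \<rho> ^ q * (Q_pert f m \<mu> i t * w \<rho> t powr (-\<alpha>)))"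
    by (intro integral_cong) (simp add: V_eq[OF \<rho>])
  also have "\<dots> = \<rho> ^ p * integral {-T..T} (P_pert f n \<mu> i) +
      \<rho> ^ q * integral {-T..T} (\<lambda>t. Q_pert f m \<mu> i t * w \<rho> t powr (-\<alpha>))"
    by (subst integral_add)
      (auto intro!: integrable_on_mult_right integrable_continuous_interval continuous_intros cont_P cont_Q cont_w_powr[OF \<rho>])
  finally show ?thesis by (simp add: integral_P integral_weight_even[OF \<rho> cont_Q])
qed

theorem melnikov_1:
  assumes \<rho>: "\<rho> \<in> J_domain f T p"
  shows "melnikov f T p q n m 1 \<mu> \<rho> =
    \<rho> ^ p * (fst \<mu> 1 0 * integral {-T..T} (f 0)) + \<rho> ^ q * N (\<lambda>t. 2 * even_part (Q_pert f m \<mu> 1) t) \<alpha> (\<sigma> \<rho>)"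
proof -
  interpret unperturbed_orbit f T p q n m \<rho> "W \<rho>" by (rule unperturbed[OF \<rho>])
  show ?thesis unfolding melnikov_1_integral D0_def V_def PQ_integral[OF \<rho>] ..
qed

text \<open>Parity removes everything but the interaction of the even part of \<open>P\<close> with
  the odd function \<open>Q\<close>. Once their product is written through primitives of the
  functions \<phi> times \<open>f 1\<close>, it is integrated by parts against the power of
  \<open>W\<close>, and the primitives turn back into the \<phi> themselves.\<close>

theorem melnikov_2:
  assumes \<rho>: "\<rho> \<in> J_domain f T p"
    and a0: "fst \<mu> 1 0 = 0"
    and Q_odd: "\<And>t. t \<in> {-T..T} \<Longrightarrow> even_part (Q_pert f m \<mu> 1) t = 0"
    and \<phi>: "\<And>l. l \<in> A \<Longrightarrow> continuous_on {-T..T} (\<phi> l)" "\<And>l. l \<in> A \<Longrightarrow> integral {-T..T} (\<phi> l) = 0"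
      "\<And>l t. l \<in> A \<Longrightarrow> \<phi> l (-t) = \<phi> l t"
    and A: "finite A"
    and D: "\<And>t. t \<in> {-T..T} \<Longrightarrow> integral {-T..t} (even_part (P_pert f n \<mu> 1)) * Q_pert f m \<mu> 1 t =
      (\<Sum>l\<in>A. D l * (integral {-T..t} (\<phi> l) * f 1 t))"
  shows "melnikov f T p q n m 2 \<mu> \<rho> =
    \<rho> ^ p * (fst \<mu> 2 0 * integral {-T..T} (f 0)) +
    \<rho> ^ q * N (\<lambda>t. 2 * even_part (Q_pert f m \<mu> 2) t - 2 * (\<Sum>l\<in>A. D l * \<phi> l t)) \<alpha> (\<sigma> \<rho>)"
proof -
  interpret orb: unperturbed_orbit f T p q n m \<rho> "W \<rho>" by (rule unperturbed[OF \<rho>])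
  have S: "\<sigma> \<rho> \<in> S" using \<rho> J_iff by simp
  have D0_T: "orb.D0 \<mu> T = 0"
  proof -
    have "N (\<lambda>t. 2 * even_part (Q_pert f m \<mu> 1) t) \<alpha> (\<sigma> \<rho>) = N (\<lambda>t. 0) \<alpha> (\<sigma> \<rho>)"
      unfolding N_def
    proof (rule integral_cong)
      fix t assume "t \<in> {0..T}"
      then have "even_part (Q_pert f m \<mu> 1) t = 0" by (intro Q_odd) auto
      then show "2 * even_part (Q_pert f m \<mu> 1) t * (1 - \<sigma> \<rho> * F t) powr (-\<alpha>) =
          0 * (1 - \<sigma> \<rho> * F t) powr (-\<alpha>)" by simp
    qed
    then show ?thesis using melnikov_1[OF \<rho>, of \<mu>] a0 orb.melnikov_1_integral by (simp add: N_def)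
  qed
  show ?thesis
  proof (cases "\<rho> = 0")
    case True
    \<comment> \<open>The integral formula for the second order divides by \<rho>; at \<rho> = 0
      both powers vanish, and with them all contributing coefficients.\<close>
    have z: "\<rho> ^ p = 0" "\<rho> ^ q = 0" using True pq by auto
    have D0_0: "orb.D0 \<mu> t = 0" for t unfolding orb.D0_def z by simp
    have "melnikov f T p q n m 2 \<mu> \<rho> = 0"
    proof -
      interpret fps_ode "-T" T "p + q + 1" "orb.coeff \<mu>" by (rule orb.coeff_ode)
      have 0: "fps_nth (sol t) 0 = 0" if t: "t \<in> {-T..T}" for t
      proof -
        have "fps_nth (sol t) 0 = orb.D0 \<mu> t"
          unfolding orb.D0_def using t
          by (subst sol_nth_0) (auto intro!: integral_cong simp: orb.coeff_first_order)
        then show ?thesis using D0_0 by simp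
      qed
      have "melnikov f T p q n m 2 \<mu> \<rho> = fps_nth (sol T) 1"
        using orb.melnikov_eq_sol[of 1 \<mu>] by (simp add: numeral_2_eq_2)
      also have "\<dots> = integral {-T..T} (\<lambda>x. \<Sum>j\<le>p + q + 1. orb.coeff \<mu> 1 j x * fps_nth (sol x) 0 ^ j)"
        using T by (subst sol_nth_1) auto
      also have "\<dots> = integral {-T..T} (\<lambda>x. 0)"
      proof (intro integral_cong sum.neutral ballI)
        fix x j assume x: "x \<in> {-T..T}"
        show "orb.coeff \<mu> 1 j x * fps_nth (sol x) 0 ^ j = 0"
          using orb.coeff_second_order[OF x, of \<mu>] 0[OF x] by (cases j) (auto simp: z)
      qed
      finally show ?thesis by simp
    qed
    then show ?thesis unfolding z by simp
  next
    case False
    let ?Q = "Q_pert f m \<mu> 1" and ?P = "P_pert f n \<mu> 1"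
    define Pe where "Pe t = integral {-T..t} (even_part ?P)" for t
    define po where "po t = ?P t - even_part ?P t" for t
    \<comment> \<open>The odd part of the integrand of \<open>D0\<close>. Its primitive is even,
      hence contributes an odd integrand against the odd \<open>?Q\<close> and the even weight, and
      drops out.\<close>
    define v where "v t = \<rho> ^ p * po t + \<rho> ^ q * (?Q t * orb.V t)" for t
    have Qo: "?Q (-t) = - ?Q t" if "t \<in> {-T..T}" for t using Q_odd[OF that] by (simp add: even_part_def)
    have W_even: "W \<rho> (-t) = W \<rho> t" if "t \<in> {-T..T}" for t using w_even[OF that] by (simp add: W_def)
    have v_odd: "v (-t) = - v t" if "t \<in> {-T..T}" for t
      using Qo[OF that] W_even[OF that] by (simp add: v_def po_def orb.V_def even_part_def field_simps)
    have cv: "continuous_on {-T..T} v" unfolding v_def po_def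
      by (intro continuous_intros cont_P cont_Q orb.cont_V continuous_on_even_part)
    have cPe: "continuous_on {-T..T} Pe" unfolding Pe_def
      by (intro indefinite_integral_continuous_1 integrable_continuous_interval continuous_on_even_part cont_P)
    have D0: "orb.D0 \<mu> t = \<rho> ^ p * Pe t + integral {-T..t} v" if t: "t \<in> {-T..T}" for t
    proof -
      have s: "continuous_on {-T..t} g" if "continuous_on {-T..T} g" for g :: "real \<Rightarrow> real"
        using t by (intro continuous_on_subset[OF that]) auto
      have "orb.D0 \<mu> t = integral {-T..t} (\<lambda>t. \<rho> ^ p * even_part ?P t + v t)"
        unfolding orb.D0_def v_def po_def by (intro integral_cong) (simp add: algebra_simps)
      also have "\<dots> = \<rho> ^ p * Pe t + integral {-T..t} v"
        unfolding Pe_def by (subst integral_add)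
          (auto intro!: integrable_continuous_interval continuous_on_mult_left s continuous_on_even_part cont_P cv)
      finally show ?thesis .
    qed
    have W1: "continuous_on {-T..T} (\<lambda>t. W \<rho> t ^ k)" for k by (intro continuous_intros orb.cont_W)
    have "integral {-T..T} (\<lambda>t. orb.D0 \<mu> t * (?Q t * W \<rho> t ^ (q - 1))) =
      integral {-T..T} (\<lambda>t. \<rho> ^ p * (Pe t * ?Q t * W \<rho> t ^ (q - 1)) + integral {-T..t} v * (?Q t * W \<rho> t ^ (q - 1)))"
      by (intro integral_cong) (simp add: D0 algebra_simps)
    also have "\<dots> = \<rho> ^ p * integral {-T..T} (\<lambda>t. Pe t * ?Q t * W \<rho> t ^ (q - 1)) +
        integral {-T..T} (\<lambda>t. integral {-T..t} v * (?Q t * W \<rho> t ^ (q - 1)))"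
      by (subst integral_add)
        (auto intro!: integrable_continuous_interval continuous_on_mult_left continuous_on_mult W1 cont_Q cPe
          indefinite_integral_continuous_1 cv)
    also have "integral {-T..T} (\<lambda>t. integral {-T..t} v * (?Q t * W \<rho> t ^ (q - 1))) = 0"
    proof (rule integral_odd_function)
      show "continuous_on {-T..T} (\<lambda>t. integral {-T..t} v * (?Q t * W \<rho> t ^ (q - 1)))"
        by (intro continuous_on_mult W1 cont_Q indefinite_integral_continuous_1 integrable_continuous_interval cv)
      show "integral {-T..-t} v * (?Q (-t) * W \<rho> (-t) ^ (q - 1)) = - (integral {-T..t} v * (?Q t * W \<rho> t ^ (q - 1)))"
        if "t \<in> {0..T}" for t
        using that Qo[of t] W_even[of t] integral_even_function[OF cv v_odd, of t] by simp
    qed (use T in auto)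
    also have "integral {-T..T} (\<lambda>t. Pe t * ?Q t * W \<rho> t ^ (q - 1)) =
        integral {-T..T} (\<lambda>t. \<Sum>l\<in>A. D l * (integral {-T..t} (\<phi> l) * (f 1 t * W \<rho> t ^ (q - 1))))"
      unfolding Pe_def
      by (rule integral_cong, subst D, assumption) (simp only: sum_distrib_right mult.assoc)
    also have "\<dots> = (\<Sum>l\<in>A. D l * integral {-T..T} (\<lambda>t. integral {-T..t} (\<phi> l) * (f 1 t * W \<rho> t ^ (q - 1))))"
      using A by (subst integral_sum)
        (auto intro!: integrable_continuous_interval continuous_on_mult_left continuous_on_mult W1 f
          indefinite_integral_continuous_1 \<phi>)
    finally have int: "integral {-T..T} (\<lambda>t. orb.D0 \<mu> t * (?Q t * W \<rho> t ^ (q - 1))) =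
      \<rho> ^ p * (\<Sum>l\<in>A. D l * integral {-T..T} (\<lambda>t. integral {-T..t} (\<phi> l) * (f 1 t * W \<rho> t ^ (q - 1))))" by simp
    \<comment> \<open>The factors in front make the second integrand the derivative of
      \<open>orb.V\<close> times the primitive of \<open>\<phi> l\<close>. The boundary terms vanish
      because \<open>\<phi> l\<close> has mean zero.\<close>
    have parts: "(real q - real p) * \<rho> ^ (p - 1) * integral {-T..T} (\<lambda>t. integral {-T..t} (\<phi> l) * (f 1 t * W \<rho> t ^ (q - 1))) =
        - N (\<lambda>t. 2 * \<phi> l t) \<alpha> (\<sigma> \<rho>)" if l: "l \<in> A" for l
    proof -
      have "((\<lambda>t. integral {-T..t} (\<phi> l) * orb.V t) has_real_derivative
          \<phi> l t * orb.V t + (real q - real p) * \<rho> ^ (p - 1) * f 1 t * W \<rho> t ^ (q - 1) * integral {-T..t} (\<phi> l))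
          (at t within {-T..T})" if t: "t \<in> {-T..T}" for t
        by (intro DERIV_mult orb.V_deriv integral_has_real_derivative \<phi> l t)
      then have "((\<lambda>t. \<phi> l t * orb.V t + (real q - real p) * \<rho> ^ (p - 1) * f 1 t * W \<rho> t ^ (q - 1) * integral {-T..t} (\<phi> l))
          has_integral (integral {-T..T} (\<phi> l) * orb.V T - integral {-T..-T} (\<phi> l) * orb.V (-T))) {-T..T}"
        using T by (intro fundamental_theorem_of_calculus)
          (auto simp: has_real_derivative_iff_has_vector_derivative[symmetric])
      then have "integral {-T..T} (\<lambda>t. \<phi> l t * orb.V t +
          (real q - real p) * \<rho> ^ (p - 1) * (integral {-T..t} (\<phi> l) * (f 1 t * W \<rho> t ^ (q - 1)))) = 0"
        using \<phi>(2)[OF l] by (auto simp: mult_ac dest!: integral_unique)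
      also have "integral {-T..T} (\<lambda>t. \<phi> l t * orb.V t +
          (real q - real p) * \<rho> ^ (p - 1) * (integral {-T..t} (\<phi> l) * (f 1 t * W \<rho> t ^ (q - 1)))) =
        integral {-T..T} (\<lambda>t. \<phi> l t * orb.V t) +
          (real q - real p) * \<rho> ^ (p - 1) * integral {-T..T} (\<lambda>t. integral {-T..t} (\<phi> l) * (f 1 t * W \<rho> t ^ (q - 1)))"
        using l by (subst integral_add)
          (auto intro!: integrable_continuous_interval continuous_on_mult_left continuous_on_mult W1 f
            indefinite_integral_continuous_1 \<phi> orb.cont_V)
      also have "integral {-T..T} (\<lambda>t. \<phi> l t * orb.V t) = N (\<lambda>t. 2 * \<phi> l t) \<alpha> (\<sigma> \<rho>)"
      proof -
        have "integral {-T..T} (\<lambda>t. \<phi> l t * orb.V t) = integral {-T..T} (\<lambda>t. \<phi> l t * w \<rho> t powr (-\<alpha>))"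
          by (intro integral_cong) (simp add: orb.V_def V_eq[OF \<rho>])
        also have "\<dots> = N (\<lambda>t. 2 * even_part (\<phi> l) t) \<alpha> (\<sigma> \<rho>)" by (rule integral_weight_even[OF \<rho> \<phi>(1)[OF l]])
        finally show ?thesis using \<phi>(3)[OF l] by (simp add: even_part_def)
      qed
      finally show ?thesis by simp
    qed
    have pow: "\<rho> ^ (q - 1) * \<rho> ^ p = \<rho> ^ (p - 1) * \<rho> ^ q"
      using pq by (simp add: power_add[symmetric] add.commute)
    have "(real q - real p) * \<rho> ^ (q - 1) * (\<rho> ^ p * (\<Sum>l\<in>A. D l * integral {-T..T} (\<lambda>t. integral {-T..t} (\<phi> l) * (f 1 t * W \<rho> t ^ (q - 1)))))
      = \<rho> ^ q * (\<Sum>l\<in>A. D l * ((real q - real p) * \<rho> ^ (p - 1) * integral {-T..T} (\<lambda>t. integral {-T..t} (\<phi> l) * (f 1 t * W \<rho> t ^ (q - 1)))))"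
    proof -
      have "c * a * (b * (\<Sum>l\<in>A. D l * I l)) = d * (\<Sum>l\<in>A. D l * (c * e * I l))" if "a * b = e * d"
        for a b c d e :: real and I
      proof -
        have "d * (\<Sum>l\<in>A. D l * (c * e * I l)) = c * (e * d) * (\<Sum>l\<in>A. D l * I l)"
          by (simp add: sum_distrib_left mult_ac)
        then show ?thesis unfolding that[symmetric] by simp
      qed
      from this[OF pow] show ?thesis .
    qed
    also have "\<dots> = \<rho> ^ q * (\<Sum>l\<in>A. (- 2 * D l) * N (\<phi> l) \<alpha> (\<sigma> \<rho>))"
      by (intro arg_cong[where f = "\<lambda>x. \<rho> ^ q * x"] sum.cong refl)
        (simp only: parts, simp add: N_def mult.assoc)
    also have "(\<Sum>l\<in>A. (- 2 * D l) * N (\<phi> l) \<alpha> (\<sigma> \<rho>)) = N (\<lambda>t. \<Sum>l\<in>A. (- 2 * D l) * \<phi> l t) \<alpha> (\<sigma> \<rho>)"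
      using T by (intro N_sum[symmetric] A S continuous_on_subset[OF \<phi>(1)]) auto
    finally have "melnikov f T p q n m 2 \<mu> \<rho> = \<rho> ^ p * (fst \<mu> 2 0 * integral {-T..T} (f 0)) +
      \<rho> ^ q * (N (\<lambda>t. 2 * even_part (Q_pert f m \<mu> 2) t) \<alpha> (\<sigma> \<rho>) + N (\<lambda>t. \<Sum>l\<in>A. (- 2 * D l) * \<phi> l t) \<alpha> (\<sigma> \<rho>))"
      unfolding orb.melnikov_2_integral[OF False D0_T] int orb.V_def PQ_integral[OF \<rho>]
      by (simp add: distrib_left)
    also have "N (\<lambda>t. 2 * even_part (Q_pert f m \<mu> 2) t) \<alpha> (\<sigma> \<rho>) + N (\<lambda>t. \<Sum>l\<in>A. (- 2 * D l) * \<phi> l t) \<alpha> (\<sigma> \<rho>) =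
      N (\<lambda>t. 2 * even_part (Q_pert f m \<mu> 2) t - 2 * (\<Sum>l\<in>A. D l * \<phi> l t)) \<alpha> (\<sigma> \<rho>)"
    proof -
      have "continuous_on {0..T} (\<lambda>t. 2 * even_part (Q_pert f m \<mu> 2) t)"
        "continuous_on {0..T} (\<lambda>t. \<Sum>l\<in>A. (- 2 * D l) * \<phi> l t)"
        using T by (auto intro!: continuous_intros continuous_on_subset[OF continuous_on_even_part[OF cont_Q]]
          continuous_on_subset[OF \<phi>(1)])
      from N_linear[OF this S, of 1 1 \<alpha>] show ?thesis
        by (simp add: sum_distrib_left sum_negf mult_ac)
    qed
    finally show ?thesis .
  qed
qed

end

section \<open>Upper bounds\<close>

context abel_family
begin

abbreviation J :: "real set" where "J \<equiv> J_domain f T p"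

abbreviation \<beta> :: real where "\<beta> \<equiv> \<alpha> + 1"

lemma p1_pos: "real p - 1 > 0" using pq by simp

lemma \<beta>_pos: "\<beta> > 0"
  using pq by (simp add: \<alpha>_def field_simps)

text \<open>At i = 0 this is p \<noteq> q; afterwards \<beta> = (q-1)/(p-1) > 0 takes over. It is
  the condition under which the zero count for the kernel integrals runs through all its
  differentiations.\<close>

lemma \<alpha>_nonzero: "\<alpha> + real i \<noteq> 0"
proof (cases i)
  case 0
  then show ?thesis using pq by (simp add: \<alpha>_def)
next
  case (Suc j)
  then show ?thesis using \<beta>_pos by simp
qed

lemma \<beta>_nonzero: "\<beta> + real i \<noteq> 0"
  using \<alpha>_nonzero[of "Suc i"] by (simp add: algebra_simps)

lemma \<alpha>_p: "\<alpha> * (real p - 1) = real q - real p"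
  using p1_pos by (simp add: \<alpha>_def)

lemma \<sigma>_deriv: "(\<sigma> has_real_derivative (real p - 1)^2 * \<rho> ^ (p - 2)) (at \<rho>)"
proof -
  have "p - Suc (Suc 0) = p - 2" "real (p - Suc 0) = real p - 1" using pq by auto
  then show ?thesis unfolding \<sigma>_def[abs_def]
    by (auto intro!: derivative_eq_intros simp: power2_eq_square)
qed

lemma \<sigma>_deriv_mult: "\<rho> * ((real p - 1)^2 * \<rho> ^ (p - 2)) = (real p - 1) * \<sigma> \<rho>"
proof -
  have "\<rho> ^ (p - 1) = \<rho> * \<rho> ^ (p - 2)" using pq by (cases p; cases "p - 1") auto
  then show ?thesis by (simp add: \<sigma>_def power2_eq_square)
qed

lemma cont_\<sigma>: "continuous_on A \<sigma>"
  unfolding \<sigma>_def[abs_def] by (intro continuous_intros)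

lemma zero_in_J: "0 \<in> J"
proof -
  have "\<sigma> 0 = 0" using pq by (simp add: \<sigma>_def)
  then show ?thesis by (simp add: J_iff)
qed

lemma open_J: "open J"
proof -
  have "J = \<sigma> -` S" by (auto simp: J_iff)
  then show ?thesis using open_S cont_\<sigma> by (simp add: open_vimage)
qed

lemma \<sigma>_minus_odd: "odd p \<Longrightarrow> \<sigma> (- \<rho>) = \<sigma> \<rho>"
  by (simp add: \<sigma>_def)

lemma J_minus_odd: "odd p \<Longrightarrow> - \<rho> \<in> J \<longleftrightarrow> \<rho> \<in> J"
  by (simp add: J_iff \<sigma>_minus_odd)

lemma \<sigma>_less_pos: "0 \<le> a \<Longrightarrow> a < b \<Longrightarrow> \<sigma> a < \<sigma> b"
  unfolding \<sigma>_def using pq p1_pos by (intro mult_strict_left_mono power_strict_mono) auto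

lemma \<sigma>_minus_even: "even p \<Longrightarrow> \<sigma> (- \<rho>) = - \<sigma> \<rho>"
  using pq by (simp add: \<sigma>_def)

lemma \<sigma>_strict_mono: "even p \<Longrightarrow> strict_mono \<sigma>"
proof (rule strict_monoI)
  fix a b :: real assume p: "even p" and ab: "a < b"
  have 0: "\<sigma> 0 = 0" using pq by (simp add: \<sigma>_def)
  show "\<sigma> a < \<sigma> b"
  proof (cases "0 \<le> a")
    case True
    then show ?thesis using \<sigma>_less_pos ab by blast
  next
    case a: False
    show ?thesis
    proof (cases "b \<le> 0")
      case True
      then show ?thesis using \<sigma>_less_pos[of "-b" "-a"] ab \<sigma>_minus_even[OF p] by simp
    next
      case False
      then show ?thesis
        using \<sigma>_less_pos[of 0 "-a"] \<sigma>_less_pos[of 0 b] a \<sigma>_minus_even[OF p, of a] 0 by simp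
    qed
  qed
qed

lemma \<sigma>_inj_pos: "inj_on \<sigma> {0<..}"
  by (rule strict_mono_on_imp_inj_on) (auto intro!: strict_mono_onI \<sigma>_less_pos)

lemma \<sigma>_inj_neg: "inj_on \<sigma> {..<0}"
proof (cases "even p")
  case True
  then show ?thesis using \<sigma>_strict_mono strict_mono_imp_inj_on subset_UNIV inj_on_subset by metis
next
  case False
  show ?thesis
  proof (rule inj_onI)
    fix x y :: real assume "x \<in> {..<0}" "y \<in> {..<0}" "\<sigma> x = \<sigma> y"
    then have "- x = - y"
      using inj_onD[OF \<sigma>_inj_pos, of "-x" "-y"] \<sigma>_minus_odd[OF False] by simp
    then show "x = y" by simp
  qed
qed

lemma \<sigma>_nonzero: "\<rho> \<noteq> 0 \<Longrightarrow> \<sigma> \<rho> \<noteq> 0"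
  using p1_pos by (simp add: \<sigma>_def)

text \<open>For even \<open>p\<close> the map \<sigma> is monotone. For odd \<open>p\<close> it is
  even and nonnegative, so the endpoint of larger modulus controls every point in between.\<close>

lemma J_interval:
  assumes "a \<in> J" "b \<in> J" "a \<le> x" "x \<le> b"
  shows "x \<in> J"
proof (cases "even p")
  case True
  have "\<sigma> a \<le> \<sigma> x" "\<sigma> x \<le> \<sigma> b"
    using assms strict_mono_less_eq[OF \<sigma>_strict_mono[OF True]] by auto
  then show ?thesis using assms S_interval unfolding J_iff by blast
next
  case False
  define r where "r = max \<bar>a\<bar> \<bar>b\<bar>"
  have "\<sigma> \<bar>y\<bar> = \<sigma> y" for y using \<sigma>_minus_odd[OF False] by (simp add: abs_if)
  then have "\<sigma> r = \<sigma> a \<or> \<sigma> r = \<sigma> b" unfolding r_def max_def by simp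
  then have "\<sigma> r \<in> S" using assms unfolding J_iff by auto
  moreover have "\<bar>x\<bar> \<le> r" using assms by (auto simp: r_def)
  then have "\<sigma> \<bar>x\<bar> \<le> \<sigma> r" using \<sigma>_less_pos[of "\<bar>x\<bar>" r] by (cases "\<bar>x\<bar> = r") auto
  moreover have "0 \<le> \<sigma> \<bar>x\<bar>" using p1_pos by (simp add: \<sigma>_def)
  ultimately have "\<sigma> \<bar>x\<bar> \<in> S" using S_interval[of 0 "\<sigma> r"] by auto
  then show ?thesis using \<open>\<And>y. \<sigma> \<bar>y\<bar> = \<sigma> y\<close> by (simp add: J_iff)
qed

lemma N\<sigma>_deriv:
  assumes "continuous_on {0..T} G" "\<rho> \<in> J"
  shows "((\<lambda>\<rho>. N G \<gamma> (\<sigma> \<rho>)) has_real_derivative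
    \<gamma> * N (\<lambda>t. G t * F t) (\<gamma> + 1) (\<sigma> \<rho>) * ((real p - 1)^2 * \<rho> ^ (p - 2))) (at \<rho>)"
  using DERIV_chain2[OF N_deriv[OF assms(1)] \<sigma>_deriv, of \<rho> \<gamma>] assms(2) by (simp add: J_iff)

lemma cont_N\<sigma>: "continuous_on {0..T} G \<Longrightarrow> continuous_on J (\<lambda>\<rho>. N G \<gamma> (\<sigma> \<rho>))"
  using N\<sigma>_deriv by (intro DERIV_continuous_on) (auto intro: DERIV_subset)

text \<open>For s \<noteq> 0 the identity \<open>N_shift\<close> can be solved for its last
  integral. Starting from one zero at exponent \<alpha>, the orders known at exponent \<beta> are
  thus transferred back, with a gain of one.\<close>

lemma vanishes_\<alpha>:
  assumes G: "continuous_on {0..T} G" and s: "s \<in> S" "s \<noteq> 0"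
    and "N G \<alpha> s = 0" "vanishes G \<beta> s k"
  shows "vanishes G \<alpha> s (Suc k)"
proof -
  have c: "continuous_on {0..T} (\<lambda>t. G t * F t ^ j)" for j by (intro continuous_intros G cont_F)
  have "j \<le> k \<Longrightarrow> N (\<lambda>t. G t * F t ^ j) (\<alpha> + real j) s = 0" for j
  proof (induction j)
    case 0
    then show ?case using assms by simp
  next
    case (Suc j)
    have "N (\<lambda>t. G t * F t ^ j) (\<beta> + real j) s = 0"
      using assms(5) Suc.prems by (simp add: vanishes_def)
    moreover have "N (\<lambda>t. G t * F t ^ j) (\<alpha> + real j) s = 0" using Suc by simp
    moreover have "(\<lambda>t. G t * F t ^ j * F t) = (\<lambda>t. G t * F t ^ Suc j)" by (auto simp: mult_ac)
    ultimately show ?case using N_shift[OF c s(1), of j "\<alpha> + real j"] s(2)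
      by (simp add: add_ac)
  qed
  then show ?thesis by (simp add: vanishes_def less_Suc_eq_le)
qed

end

text \<open>The formula for \<open>u\<close> is required on \<open>J\<close> only, since a Melnikov
  function carries no information elsewhere; as \<open>J\<close> is open, all derivatives there are
  still determined.\<close>

locale abel_zeros = abel_family +
  fixes G u :: "real \<Rightarrow> real" and A :: real and L :: nat
  assumes G: "continuous_on {0..T} G"
    and G_zeros: "finite {t \<in> {0<..<T}. G t = 0}" "card {t \<in> {0<..<T}. G t = 0} \<le> L"
    and u: "\<And>\<rho>. \<rho> \<in> J_domain f T p \<Longrightarrow> u \<rho> = A * \<rho> ^ p + \<rho> ^ q * N G \<alpha> (\<sigma> \<rho>)"
begin

text \<open>Differentiating the integral gives \<sigma> times an integral of exponent \<beta>;
  \<open>N_shift\<close> rewrites it as a difference, and \<alpha> (p - 1) = q - p turns the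
  coefficient q of the old integral into p. The result has the shape of the first link of a
  derivative chain.\<close>

lemma u_deriv_aux:
  assumes \<rho>: "\<rho> \<in> J" "\<rho> \<noteq> 0"
  shows "((\<lambda>\<rho>. A * \<rho> ^ p + \<rho> ^ q * N G \<alpha> (\<sigma> \<rho>)) has_real_derivative
    real p * inverse \<rho> * (A * \<rho> ^ p + \<rho> ^ q * N G \<alpha> (\<sigma> \<rho>)) +
    (real q - real p) * \<rho> ^ (q - 1) * N G \<beta> (\<sigma> \<rho>)) (at \<rho>)"
proof -
  let ?D = "\<alpha> * N (\<lambda>t. G t * F t) \<beta> (\<sigma> \<rho>) * ((real p - 1)^2 * \<rho> ^ (p - 2))"
  have d: "((\<lambda>\<rho>. A * \<rho> ^ p + \<rho> ^ q * N G \<alpha> (\<sigma> \<rho>)) has_real_derivative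
      A * (real p * \<rho> ^ (p - 1)) + (real q * \<rho> ^ (q - 1) * N G \<alpha> (\<sigma> \<rho>) + ?D * \<rho> ^ q)) (at \<rho>)"
    by (intro DERIV_add DERIV_cmult DERIV_mult N\<sigma>_deriv G \<rho>) (auto intro!: derivative_eq_intros)
  have e1: "?D * \<rho> ^ q = (real q - real p) * \<rho> ^ (q - 1) * (\<sigma> \<rho> * N (\<lambda>t. G t * F t) \<beta> (\<sigma> \<rho>))"
  proof -
    have "\<rho> ^ q = \<rho> ^ (q - 1) * \<rho>" using pq by (simp add: power_eq_if)
    then have "?D * \<rho> ^ q = \<alpha> * N (\<lambda>t. G t * F t) \<beta> (\<sigma> \<rho>) * \<rho> ^ (q - 1) * (\<rho> * ((real p - 1)^2 * \<rho> ^ (p - 2)))"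
      by (simp only: mult_ac)
    also have "\<dots> = \<alpha> * (real p - 1) * \<rho> ^ (q - 1) * (\<sigma> \<rho> * N (\<lambda>t. G t * F t) \<beta> (\<sigma> \<rho>))"
      unfolding \<sigma>_deriv_mult by (simp only: mult_ac)
    finally show ?thesis unfolding \<alpha>_p .
  qed
  have e2: "\<sigma> \<rho> * N (\<lambda>t. G t * F t) \<beta> (\<sigma> \<rho>) = N G \<beta> (\<sigma> \<rho>) - N G \<alpha> (\<sigma> \<rho>)"
    using N_shift[OF G, of "\<sigma> \<rho>" \<alpha>] \<rho> by (simp add: J_iff)
  have "\<rho> ^ p = \<rho> * \<rho> ^ (p - 1)" "\<rho> ^ q = \<rho> * \<rho> ^ (q - 1)" using pq by (simp_all add: power_eq_if)
  then have e3: "real p * inverse \<rho> * (A * \<rho> ^ p + \<rho> ^ q * x) = real p * (A * \<rho> ^ (p - 1) + \<rho> ^ (q - 1) * x)" for x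
    using \<rho>(2) by (simp only:) (simp add: field_simps)
  show ?thesis
    by (rule DERIV_cong[OF d]) (simp only: e1 e2 e3, simp add: algebra_simps)
qed

lemma has_deriv_cong_J:
  assumes "\<rho> \<in> J" "((\<lambda>\<rho>. A * \<rho> ^ p + \<rho> ^ q * N G \<alpha> (\<sigma> \<rho>)) has_real_derivative D) (at \<rho>)"
  shows "(u has_real_derivative D) (at \<rho>)"
  using assms u open_J by (subst DERIV_cong_ev[OF refl _ refl]) (auto simp: eventually_nhds)

lemmas u_deriv = has_deriv_cong_J[OF _ u_deriv_aux]

text \<open>The chain starts with \<open>u\<close> itself and continues with the integrals of
  exponents \<beta>, \<beta> + 1, ...; since \<open>u\<close> is link 0, an order k + 1 of
  \<open>u\<close> leaves \<open>k\<close> orders for the integrals.\<close>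

lemma order_imp_vanishes:
  assumes \<rho>: "\<rho> \<in> J" "\<rho> \<noteq> 0" and ord: "\<And>j. j < Suc k \<Longrightarrow> (deriv ^^ j) u \<rho> = 0"
  shows "vanishes G \<beta> (\<sigma> \<rho>) k"
  unfolding vanishes_def
proof (intro allI impI)
  fix j assume j: "j < k"
  define y where "y i = (case i of 0 \<Rightarrow> (\<lambda>\<rho>. A * \<rho> ^ p + \<rho> ^ q * N G \<alpha> (\<sigma> \<rho>)) |
    Suc i \<Rightarrow> (\<lambda>\<rho>. N (\<lambda>t. G t * F t ^ i) (\<beta> + real i) (\<sigma> \<rho>)))" for i
  define a where "a i = (case i of 0 \<Rightarrow> (\<lambda>z. real p * inverse z) | Suc i \<Rightarrow> (\<lambda>z. 0))" for i :: nat
  define b where "b i = (case i of 0 \<Rightarrow> (\<lambda>z. (real q - real p) * z ^ (q - 1)) |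
    Suc i \<Rightarrow> (\<lambda>z. (\<beta> + real i) * (real p - 1)^2 * z ^ (p - 2)))" for i :: nat
  have "y (Suc j) \<rho> = 0"
  proof (rule vanishing_derivs_chain[where U = "J - {0}" and a = a and b = b and u = u and k = "Suc k" and y = y and j = "Suc j" and x = \<rho>])
    show "open (J - {0})" using open_J by (simp add: open_delete)
    show "(y i has_real_derivative a i z * y i z + b i z * y (Suc i) z) (at z)" if "z \<in> J - {0}" for i z
    proof (cases i)
      case 0
      show ?thesis using u_deriv_aux[of z] that by (simp add: 0 y_def a_def b_def)
    next
      case (Suc i')
      have "continuous_on {0..T} (\<lambda>t. G t * F t ^ i')" by (intro continuous_intros G cont_F)
      from N\<sigma>_deriv[OF this, of z "\<beta> + real i'"] that
      show ?thesis by (simp add: Suc y_def a_def b_def mult_ac add_ac)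
    qed
    show "laurent (a i)" for i by (cases i) (simp_all add: a_def laurent.intros)
    show "laurent (b i)" for i
      by (cases i) (simp_all only: b_def nat.case, (intro laurent.mult laurent.const laurent_power laurent.ident)+)
    show "b i z \<noteq> 0" if "z \<in> J - {0}" for i z
      using that pq \<beta>_nonzero p1_pos by (auto simp: b_def split: nat.splits)
    show "u z = y 0 z" if "z \<in> J - {0}" for z using u that by (simp add: y_def)
  qed (use \<rho> ord j in auto)
  then show "N (\<lambda>t. G t * F t ^ j) (\<beta> + real j) (\<sigma> \<rho>) = 0" by (simp add: y_def)
qed

definition h :: "real \<Rightarrow> real" where "h \<rho> = (A * \<rho> ^ p + \<rho> ^ q * N G \<alpha> (\<sigma> \<rho>)) / \<rho> ^ p"

lemma h_deriv:
  assumes \<rho>: "\<rho> \<in> J" "\<rho> \<noteq> 0"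
  shows "(h has_real_derivative (real q - real p) * \<rho> ^ (q - 1) / \<rho> ^ p * N G \<beta> (\<sigma> \<rho>)) (at \<rho>)"
proof -
  obtain k where k: "p = Suc k" using pq by (cases p) auto
  let ?u = "\<lambda>\<rho>. A * \<rho> ^ p + \<rho> ^ q * N G \<alpha> (\<sigma> \<rho>)"
  have "((\<lambda>\<rho>. \<rho> ^ p) has_real_derivative real p * \<rho> ^ (p - 1)) (at \<rho>)"
    by (auto intro!: derivative_eq_intros)
  from DERIV_divide[OF u_deriv_aux[OF \<rho>] this] \<rho>
  have "(h has_real_derivative ((real p * inverse \<rho> * ?u \<rho> + (real q - real p) * \<rho> ^ (q - 1) * N G \<beta> (\<sigma> \<rho>)) * \<rho> ^ p
      - ?u \<rho> * (real p * \<rho> ^ (p - 1))) / (\<rho> ^ p * \<rho> ^ p)) (at \<rho>)"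
    unfolding h_def[abs_def] by simp
  moreover have "real p * inverse \<rho> * x * \<rho> ^ p = x * (real p * \<rho> ^ (p - 1))" for x
    using \<rho> by (simp add: k)
  then have "((real p * inverse \<rho> * ?u \<rho> + (real q - real p) * \<rho> ^ (q - 1) * N G \<beta> (\<sigma> \<rho>)) * \<rho> ^ p
      - ?u \<rho> * (real p * \<rho> ^ (p - 1))) = (real q - real p) * \<rho> ^ (q - 1) * N G \<beta> (\<sigma> \<rho>) * \<rho> ^ p"
    by (simp only: distrib_right)
  ultimately show ?thesis
    by (elim DERIV_cong) (use \<rho> in simp)
qed

lemma h_eq: "\<rho> \<noteq> 0 \<Longrightarrow> h \<rho> = A + \<rho> ^ q * N G \<alpha> (\<sigma> \<rho>) / \<rho> ^ p"
  by (simp add: h_def field_simps)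

lemma u_eq_h: "\<rho> \<in> J \<Longrightarrow> \<rho> \<noteq> 0 \<Longrightarrow> u \<rho> = \<rho> ^ p * h \<rho>"
  using u by (simp add: h_def)

lemma gap_same_sign:
  assumes ab: "a < b" "a \<in> J" "b \<in> J" "0 < a \<or> b < 0" and "u a = 0" "u b = 0"
  shows "\<exists>y>a. y < b \<and> N G \<beta> (\<sigma> y) = 0"
proof -
  have x: "x \<in> J" "x \<noteq> 0" if "a \<le> x" "x \<le> b" for x
    using J_interval[of a b x] that ab by auto
  have "\<exists>y>a. y < b \<and> (h has_real_derivative 0) (at y)"
  proof (rule Rolle[OF ab(1)])
    show "h a = h b" using u_eq_h[of a] u_eq_h[of b] x[of a] x[of b] assms by auto
    show "continuous_on {a..b} h"
      by (intro continuous_at_imp_continuous_on ballI DERIV_isCont[OF h_deriv]) (use x in auto)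
    show "h differentiable (at y)" if "a < y" "y < b" for y
      using h_deriv[OF x, of y] that by (auto simp: real_differentiable_def)
  qed
  then obtain y where y: "a < y" "y < b" "(h has_real_derivative 0) (at y)" by blast
  have "(real q - real p) * y ^ (q - 1) / y ^ p * N G \<beta> (\<sigma> y) = 0"
    using DERIV_unique[OF h_deriv[OF x, of y] y(3)] y by simp
  then show ?thesis using y x[of y] pq by auto
qed

lemma count_zeros:
  assumes X: "finite X" "X \<subseteq> J" "\<And>x. x \<in> X \<Longrightarrow> vanishes G \<beta> (\<sigma> x) (ms x - 1)" "\<And>x. x \<in> X \<Longrightarrow> ms x > 0"
    and Y: "finite Y" "Y \<subseteq> J" "\<And>y. y \<in> Y \<Longrightarrow> N G \<beta> (\<sigma> y) = 0" "Y \<inter> X = {}"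
    and inj: "inj_on \<sigma> (X \<union> Y)" and c: "card X \<le> card Y + c"
  shows "sum ms X \<le> L + c"
proof -
  define ns where "ns x = (if x \<in> X then ms x - 1 else (1::nat))" for x
  define g where "g = the_inv_into (X \<union> Y) \<sigma>"
  have g: "g (\<sigma> x) = x" if "x \<in> X \<union> Y" for x
    unfolding g_def using inj that by (rule the_inv_into_f_f)
  have "sum (ns \<circ> g) (\<sigma> ` (X \<union> Y)) \<le> L"
  proof (rule zeros_le_card_zeros[OF G G_zeros])
    show "\<sigma> ` (X \<union> Y) \<subseteq> S" using X Y by (auto simp: J_iff)
    show "vanishes G \<beta> s ((ns \<circ> g) s)" if "s \<in> \<sigma> ` (X \<union> Y)" for s
      using that g X Y by (auto simp: ns_def vanishes_def)
  qed (use X Y \<beta>_nonzero in auto)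
  also have "sum (ns \<circ> g) (\<sigma> ` (X \<union> Y)) = sum ns (X \<union> Y)"
    using inj g by (simp add: sum.reindex)
  also have "\<dots> = (\<Sum>x\<in>X. ms x - 1) + card Y"
  proof -
    have "sum ns Y = card Y" using Y(4) by (simp add: ns_def disjoint_iff)
    then show ?thesis using X Y by (subst sum.union_disjoint) (auto simp: ns_def)
  qed
  finally have "(\<Sum>x\<in>X. ms x - 1) + card Y \<le> L" .
  moreover have "sum ms X = (\<Sum>x\<in>X. ms x - 1) + card X"
  proof -
    have "sum ms X = (\<Sum>x\<in>X. (ms x - 1) + 1)" using X by (intro sum.cong) force+
    then show ?thesis by (simp only: sum.distrib) simp
  qed
  ultimately show ?thesis using c by simp
qed

lemma zero_and_vanishes:
  assumes X: "X \<subseteq> J - {0}" and ord: "\<forall>x\<in>X. 0 < ms x \<and> (\<forall>j<ms x. (deriv ^^ j) u x = 0)"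
    and x: "x \<in> X"
  shows "x \<in> J" "x \<noteq> 0" "u x = 0" "vanishes G \<beta> (\<sigma> x) (ms x - 1)"
proof -
  show *: "x \<in> J" "x \<noteq> 0" using X x by auto
  have pos: "0 < ms x" and 0: "\<And>j. j < ms x \<Longrightarrow> (deriv ^^ j) u x = 0" using ord x by auto
  show "u x = 0" using 0[OF pos] by simp
  show "vanishes G \<beta> (\<sigma> x) (ms x - 1)"
    by (rule order_imp_vanishes[OF *]) (use pos 0 in simp)
qed

lemma gap_set:
  assumes I: "I = {0<..} \<or> I = {..<0}" and X: "finite X" "X \<subseteq> J \<inter> I" "\<forall>x\<in>X. u x = 0"
  obtains Y where "finite Y" "Y \<subseteq> J \<inter> I" "card X \<le> card Y + 1" "Y \<inter> X = {}"
    "\<And>y. y \<in> Y \<Longrightarrow> N G \<beta> (\<sigma> y) = 0"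
proof -
  have gap: "\<exists>y>a. y < b \<and> (y \<in> J \<inter> I \<and> N G \<beta> (\<sigma> y) = 0)"
    if ab: "a \<in> X" "b \<in> X" "a < b" for a b
  proof -
    have ab': "a \<in> J" "b \<in> J" "a \<in> I" "b \<in> I" using X ab by auto
    have "\<exists>y>a. y < b \<and> N G \<beta> (\<sigma> y) = 0"
      by (rule gap_same_sign) (use ab ab' I X(3) in auto)
    then obtain y where y: "a < y" "y < b" "N G \<beta> (\<sigma> y) = 0" by blast
    moreover have "y \<in> J" using J_interval[of a b y] ab' y by auto
    moreover have "y \<in> I" using ab' y I by auto
    ultimately show ?thesis by blast
  qed
  obtain Y where "finite Y" "card X \<le> card Y + 1" "Y \<inter> X = {}"
    "\<forall>y\<in>Y. (y \<in> J \<inter> I \<and> N G \<beta> (\<sigma> y) = 0) \<and> (\<exists>x\<in>X. y < x)"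
    using finite_gap_points[OF X(1) gap] by blast
  then show ?thesis by (intro that[of Y]) auto
qed

lemma one_side_bound:
  assumes I: "I = {0<..} \<or> I = {..<0}"
  shows "zeros_bounded u (J \<inter> I) (L + 1)"
proof (rule zeros_boundedI)
  fix X ms
  assume X: "finite X" "X \<subseteq> J \<inter> I" "\<And>x. x \<in> X \<Longrightarrow> ms x > 0"
    "\<And>x j. x \<in> X \<Longrightarrow> j < ms x \<Longrightarrow> (deriv ^^ j) u x = 0"
  have "X \<subseteq> J - {0}" using X(2) I by auto
  moreover have "\<forall>x\<in>X. 0 < ms x \<and> (\<forall>j<ms x. (deriv ^^ j) u x = 0)" using X by blast
  ultimately have z: "x \<in> J" "x \<noteq> 0" "u x = 0" "vanishes G \<beta> (\<sigma> x) (ms x - 1)" if "x \<in> X" for x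
    using zero_and_vanishes[of X ms x] that by auto
  obtain Y where Y: "finite Y" "Y \<subseteq> J \<inter> I" "card X \<le> card Y + 1" "Y \<inter> X = {}"
    "\<And>y. y \<in> Y \<Longrightarrow> N G \<beta> (\<sigma> y) = 0"
    by (rule gap_set[OF I X(1,2)]) (use z(3) in auto)
  show "sum ms X \<le> L + 1"
  proof (rule count_zeros[where Y = Y])
    show "inj_on \<sigma> (X \<union> Y)"
      using I X Y \<sigma>_inj_pos \<sigma>_inj_neg by (auto intro: inj_on_subset)
  qed (use X Y z in auto)
qed

text \<open>Rolle is applied on each side of 0 separately and loses one zero on each. As \<sigma> is
  injective on the whole line, both sides draw on the same \<open>L\<close>.\<close>

lemma two_sides_bound_even:
  assumes p: "even p"
  shows "zeros_bounded u (J - {0}) (L + 2)"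
proof (rule zeros_boundedI)
  fix X ms
  assume X: "finite X" "X \<subseteq> J - {0}" "\<And>x. x \<in> X \<Longrightarrow> ms x > 0"
    "\<And>x j. x \<in> X \<Longrightarrow> j < ms x \<Longrightarrow> (deriv ^^ j) u x = 0"
  have ord: "\<forall>x\<in>X. 0 < ms x \<and> (\<forall>j<ms x. (deriv ^^ j) u x = 0)" using X by blast
  note z = zero_and_vanishes[OF X(2) ord]
  obtain Y where Y: "finite Y" "Y \<subseteq> J \<inter> {0<..}" "card (X \<inter> {0<..}) \<le> card Y + 1" "Y \<inter> (X \<inter> {0<..}) = {}"
    "\<And>y. y \<in> Y \<Longrightarrow> N G \<beta> (\<sigma> y) = 0"
    by (rule gap_set[of "{0<..}" "X \<inter> {0<..}"]) (use X z in auto)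
  obtain Y' where Y': "finite Y'" "Y' \<subseteq> J \<inter> {..<0}" "card (X \<inter> {..<0}) \<le> card Y' + 1" "Y' \<inter> (X \<inter> {..<0}) = {}"
    "\<And>y. y \<in> Y' \<Longrightarrow> N G \<beta> (\<sigma> y) = 0"
    by (rule gap_set[of "{..<0}" "X \<inter> {..<0}"]) (use X z in auto)
  show "sum ms X \<le> L + 2"
  proof (rule count_zeros[where Y = "Y \<union> Y'"])
    show "inj_on \<sigma> (X \<union> (Y \<union> Y'))"
      by (rule inj_on_subset[OF strict_mono_imp_inj_on[OF \<sigma>_strict_mono[OF p]] subset_UNIV])
    have "X = (X \<inter> {0<..}) \<union> (X \<inter> {..<0})" using X(2) by force
    then have "card X \<le> card (X \<inter> {0<..}) + card (X \<inter> {..<0})" by (metis card_Un_le)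
    moreover have "card (Y \<union> Y') = card Y + card Y'" using Y Y' by (intro card_Un_disjoint) force+
    ultimately show "card X \<le> card (Y \<union> Y') + 2" using Y Y' by linarith
    show "(Y \<union> Y') \<inter> X = {}" using Y(2,4) Y'(2,4) by blast
  qed (use X Y Y' z in auto)
qed

text \<open>Here q - p - 1 is even, so the derivative of u / \<rho>^p has the sign of the integral
  of exponent \<beta> on both sides of 0. Without a zero of that integral the quotient would be
  strictly monotone across 0 and could not vanish twice.\<close>

lemma gap_across_zero:
  assumes p: "even p" "odd q" "p < q" and ab: "a \<in> J" "b \<in> J" "a < 0" "0 < b" "u a = 0" "u b = 0"
  shows "\<exists>y>a. y < b \<and> N G \<beta> (\<sigma> y) = 0"
proof (rule ccontr)
  assume neg: "\<not> ?thesis"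
  have x: "x \<in> J" if "a \<le> x" "x \<le> b" for x using J_interval ab that by blast
  let ?N = "\<lambda>y. N G \<beta> (\<sigma> y)"
  have "continuous_on {a..b} ?N"
    by (rule continuous_on_subset[OF cont_N\<sigma>[OF G]]) (use x in auto)
  then have "\<exists>\<tau>\<in>{1, -1}. \<forall>t\<in>{a..b}. 0 \<le> \<tau> * ?N t"
    by (rule constant_sign_if_no_zeros) (use neg in auto)
  then obtain \<tau> where \<tau>: "\<tau> \<in> {1, -1}" "\<And>t. t \<in> {a..b} \<Longrightarrow> 0 \<le> \<tau> * ?N t" by blast
  have pos: "0 < \<tau> * ?N y" if "a < y" "y < b" for y
    using \<tau>(2)[of y] \<tau>(1) neg that by force
  \<comment> \<open>The continuous extension of \<open>h\<close> to 0, available because p < q;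
    monotonicity is proved on each half and joined at 0.\<close>
  define g where "g \<rho> = A + \<rho> ^ (q - p) * N G \<alpha> (\<sigma> \<rho>)" for \<rho>
  have gh: "g \<rho> = h \<rho>" if "\<rho> \<noteq> 0" for \<rho>
  proof -
    have "\<rho> ^ q = \<rho> ^ (q - p) * \<rho> ^ p" using p by (simp add: power_add[symmetric])
    then show ?thesis using h_eq[OF that] that by (simp add: g_def)
  qed
  have gc: "continuous_on {a..b} g" unfolding g_def
    by (intro continuous_intros continuous_on_subset[OF cont_N\<sigma>[OF G]]) (use x in auto)
  have gd: "(g has_real_derivative (real q - real p) * y ^ (q - 1) / y ^ p * ?N y) (at y)"
    if "a < y" "y < b" "y \<noteq> 0" for y
  proof -
    have "(h has_real_derivative (real q - real p) * y ^ (q - 1) / y ^ p * ?N y) (at y)"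
      using h_deriv x that by simp
    moreover have "eventually (\<lambda>z. g z = h z) (nhds y)"
      using gh that(3) by (auto simp: eventually_nhds intro!: exI[of _ "- {0}"])
    ultimately show ?thesis by (subst DERIV_cong_ev[OF refl _ refl])
  qed
  have sign: "0 < \<tau> * ((real q - real p) * y ^ (q - 1) / y ^ p * ?N y)" if "a < y" "y < b" "y \<noteq> 0" for y
  proof -
    have "0 < y ^ (q - 1) / y ^ p"
      using p that(3) by (intro divide_pos_pos) (auto simp: zero_less_power_eq)
    moreover have "0 < real q - real p" using p by simp
    ultimately have "0 < (real q - real p) * (y ^ (q - 1) / y ^ p) * (\<tau> * ?N y)"
      using mult_pos_pos[OF _ pos[OF that(1,2)]] mult_pos_pos by blast
    then show ?thesis by (simp add: mult_ac)
  qed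
  have inc: "\<tau> * g c < \<tau> * g d" if cd: "a \<le> c" "c < d" "d \<le> b" "0 \<le> c \<or> d \<le> 0" for c d
  proof (rule DERIV_pos_imp_increasing_open[OF cd(2)])
    show "\<exists>y. ((\<lambda>x. \<tau> * g x) has_real_derivative y) (at z) \<and> 0 < y" if "c < z" "z < d" for z
      using DERIV_cmult[OF gd[of z], of \<tau>] sign[of z] that cd by auto
    show "continuous_on {c..d} (\<lambda>x. \<tau> * g x)"
      by (intro continuous_intros continuous_on_subset[OF gc]) (use cd in auto)
  qed
  have "\<tau> * g a < \<tau> * g 0" "\<tau> * g 0 < \<tau> * g b" using inc[of a 0] inc[of 0 b] ab by auto
  moreover have "g a = 0" "g b = 0" using gh[of a] gh[of b] u_eq_h[of a] u_eq_h[of b] ab by auto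
  ultimately show False by simp
qed

lemma two_sides_bound_even_odd:
  assumes p: "even p" "odd q" "p < q"
  shows "zeros_bounded u (J - {0}) (L + 1)"
proof (rule zeros_boundedI)
  fix X ms
  assume X: "finite X" "X \<subseteq> J - {0}" "\<And>x. x \<in> X \<Longrightarrow> ms x > 0"
    "\<And>x j. x \<in> X \<Longrightarrow> j < ms x \<Longrightarrow> (deriv ^^ j) u x = 0"
  have ord: "\<forall>x\<in>X. 0 < ms x \<and> (\<forall>j<ms x. (deriv ^^ j) u x = 0)" using X by blast
  note z = zero_and_vanishes[OF X(2) ord]
  have gap: "\<exists>y>a. y < b \<and> (y \<in> J \<and> N G \<beta> (\<sigma> y) = 0)" if ab: "a \<in> X" "b \<in> X" "a < b" for a b
  proof -
    have "\<exists>y>a. y < b \<and> N G \<beta> (\<sigma> y) = 0"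
    proof (cases "0 < a \<or> b < 0")
      case True
      then show ?thesis using gap_same_sign[of a b] z[OF ab(1)] z[OF ab(2)] ab by blast
    next
      case False
      then have "a < 0" "0 < b" using z(2)[OF ab(1)] z(2)[OF ab(2)] by auto
      then show ?thesis using gap_across_zero[OF p, of a b] z[OF ab(1)] z[OF ab(2)] by blast
    qed
    moreover have "y \<in> J" if "a < y" "y < b" for y
      using J_interval[of a b y] z[OF ab(1)] z[OF ab(2)] that by auto
    ultimately show ?thesis by blast
  qed
  obtain Y where Y: "finite Y" "card X \<le> card Y + 1" "Y \<inter> X = {}"
    "\<And>y. y \<in> Y \<Longrightarrow> y \<in> J \<and> N G \<beta> (\<sigma> y) = 0"
    using finite_gap_points[OF X(1) gap] by blast
  show "sum ms X \<le> L + 1"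
  proof (rule count_zeros[where Y = Y])
    show "inj_on \<sigma> (X \<union> Y)"
      by (rule inj_on_subset[OF strict_mono_imp_inj_on[OF \<sigma>_strict_mono[OF p(1)]] subset_UNIV])
  qed (use X Y z in auto)
qed

text \<open>With A = 0 the zeros of \<open>u\<close> are zeros of the integral of exponent \<alpha>
  itself, so nothing is lost to Rolle. Moreover s = 0 belongs to \<open>S\<close> and is no value of
  \<sigma> on \<open>X\<close>, so a zero of order \<open>k\<close> there uses up part of the
  budget.\<close>

lemma homogeneous_count:
  assumes A: "A = 0" and I: "I = {0<..} \<or> I = {..<0}" and k: "vanishes G \<alpha> 0 k"
    and X: "finite X" "X \<subseteq> J \<inter> I" and ord: "\<forall>x\<in>X. 0 < ms x \<and> (\<forall>j<ms x. (deriv ^^ j) u x = 0)"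
  shows "sum ms X + k \<le> L"
proof -
  have X0: "X \<subseteq> J - {0}" using X(2) I by auto
  have v: "vanishes G \<alpha> (\<sigma> x) (ms x)" if x: "x \<in> X" for x
  proof -
    note z = zero_and_vanishes[OF X0 ord x]
    have "N G \<alpha> (\<sigma> x) = 0" using z u[of x] A by simp
    then show ?thesis
      using vanishes_\<alpha>[OF G, of "\<sigma> x" "ms x - 1"] z \<sigma>_nonzero ord x by (simp add: J_iff)
  qed
  have inj: "inj_on \<sigma> X" using I X(2) \<sigma>_inj_pos \<sigma>_inj_neg by (auto intro: inj_on_subset)
  define ns where "ns s = (if s = 0 then k else ms (the_inv_into X \<sigma> s))" for s
  have n0: "0 \<notin> \<sigma> ` X" using X0 \<sigma>_nonzero by force
  have "sum ns (insert 0 (\<sigma> ` X)) \<le> L"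
    by (rule zeros_le_card_zeros[OF G G_zeros \<alpha>_nonzero])
      (use X v k n0 the_inv_into_f_f[OF inj] in \<open>auto simp: J_iff ns_def\<close>)
  moreover have "sum ns (\<sigma> ` X) = sum ms X"
    unfolding sum.reindex[OF inj] using n0 the_inv_into_f_f[OF inj] by (intro sum.cong) (auto simp: ns_def)
  ultimately show ?thesis using n0 X by (simp add: ns_def)
qed

lemma one_side_bound_homogeneous:
  assumes "A = 0" "I = {0<..} \<or> I = {..<0}" "vanishes G \<alpha> 0 k"
  shows "zeros_bounded u (J \<inter> I) (L - k)"
proof (rule zeros_boundedI)
  fix X ms
  assume X: "finite X" "X \<subseteq> J \<inter> I" "\<And>x. x \<in> X \<Longrightarrow> ms x > 0"
    "\<And>x j. x \<in> X \<Longrightarrow> j < ms x \<Longrightarrow> (deriv ^^ j) u x = 0"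
  then have "\<forall>x\<in>X. 0 < ms x \<and> (\<forall>j<ms x. (deriv ^^ j) u x = 0)" by blast
  from homogeneous_count[OF assms X(1,2) this] show "sum ms X \<le> L - k" by simp
qed

lemma two_sides_bound_homogeneous:
  assumes "A = 0"
  shows "zeros_bounded u (J - {0}) (2 * L)"
proof -
  have v: "vanishes G \<alpha> 0 0" by (simp add: vanishes_def)
  have "zeros_bounded u (J \<inter> {0<..} \<union> J \<inter> {..<0}) ((L - 0) + (L - 0))"
    by (intro zeros_bounded_Un one_side_bound_homogeneous[OF assms _ v]) auto
  moreover have "J - {0} \<subseteq> J \<inter> {0<..} \<union> J \<inter> {..<0}" by force
  ultimately have "zeros_bounded u (J - {0}) ((L - 0) + (L - 0))" by (rule zeros_bounded_subset)
  then show ?thesis by (simp add: mult_2)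
qed

text \<open>For \<open>p\<close> odd and \<open>q\<close> even the zeros at \<open>\<rho> > 0\<close> and \<open>-\<rho> < 0\<close> are the solutions of
  \<open>g = -A\<close> and \<open>g = A\<close> for the same function \<open>g\<close>; both are zeros of \<open>g\<^sup>2 - A\<^sup>2\<close>, whose derivative
  \<open>2 g g'\<close> has at most \<open>2 L\<close> zeros.\<close>

lemma two_sides_bound_odd_even:
  assumes p: "odd p" "even q"
  shows "zeros_bounded u (J - {0}) (2 * L + 1)"
proof (cases "A = 0")
  case True
  from two_sides_bound_homogeneous[OF this] show ?thesis by (rule zeros_bounded_mono) simp
next
  case A: False
  show ?thesis
  proof (rule zeros_boundedI)
    fix X ms
    assume X: "finite X" "X \<subseteq> J - {0}" "\<And>x. x \<in> X \<Longrightarrow> ms x > 0"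
      "\<And>x j. x \<in> X \<Longrightarrow> j < ms x \<Longrightarrow> (deriv ^^ j) u x = 0"
    have ord: "\<forall>x\<in>X. 0 < ms x \<and> (\<forall>j<ms x. (deriv ^^ j) u x = 0)" using X by blast
  note z = zero_and_vanishes[OF X(2) ord]
    define g where "g \<rho> = h \<rho> - A" for \<rho>
    have g: "g \<rho> = \<rho> ^ q * N G \<alpha> (\<sigma> \<rho>) / \<rho> ^ p" if "\<rho> \<noteq> 0" for \<rho>
      using h_eq[OF that] by (simp add: g_def)
    have g_minus: "g (- \<rho>) = - g \<rho>" if "\<rho> \<noteq> 0" for \<rho>
      using g[OF that] g[of "-\<rho>"] that p by (simp add: \<sigma>_minus_odd)
    have gX: "g x = - A" if "x \<in> X" for x
      using z[OF that] u_eq_h[of x] by (simp add: g_def)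
    have abs_g: "\<bar>g \<bar>x\<bar>\<bar> = \<bar>A\<bar>" if "x \<in> X" for x
      using gX[OF that] g_minus[of x] z(2)[OF that] by (auto simp: abs_if)
    \<comment> \<open>Two opposite zeros would give g(x) = -A and g(-x) = A at the same time as
      g(-x) = -A, impossible for A \<noteq> 0. So all zeros can be folded to the positive
      side.\<close>
    have inj: "inj_on abs X"
    proof (rule inj_onI)
      fix x y assume xy: "x \<in> X" "y \<in> X" "\<bar>x\<bar> = \<bar>y\<bar>"
      show "x = y"
      proof (rule ccontr)
        assume "x \<noteq> y"
        then have "y = - x" using xy by (auto simp: abs_if split: if_splits)
        then show False using gX[OF xy(1)] gX[OF xy(2)] g_minus[of x] z(2)[OF xy(1)] A by simp
      qed
    qed
    have \<sigma>_abs: "\<sigma> \<bar>x\<bar> = \<sigma> x" for x using \<sigma>_minus_odd[OF p(1)] by (simp add: abs_if)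
    have J_abs: "\<bar>x\<bar> \<in> J" if "x \<in> J" for x using that by (simp add: J_iff \<sigma>_abs)
    let ?X = "abs ` X"
    have gap: "\<exists>y>a. y < b \<and> (y \<in> J \<and> 0 < y \<and> (N G \<alpha> (\<sigma> y) = 0 \<or> N G \<beta> (\<sigma> y) = 0))"
      if ab: "a \<in> ?X" "b \<in> ?X" "a < b" for a b
    proof -
      have abJ: "a \<in> J" "b \<in> J" "0 < a" using ab z J_abs by auto
      have x: "x \<in> J" "x > 0" if "a \<le> x" "x \<le> b" for x
        using J_interval[of a b x] that abJ by auto
      let ?d = "\<lambda>y. (real q - real p) * y ^ (q - 1) / y ^ p * N G \<beta> (\<sigma> y)"
      have gd: "((\<lambda>x. (g x)^2) has_real_derivative 2 * ?d y * g y) (at y)" if "a \<le> y" "y \<le> b" for y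
      proof -
        have "(g has_real_derivative ?d y) (at y)"
          unfolding g_def[abs_def] using DERIV_diff[OF h_deriv[OF x(1)[OF that]] DERIV_const] x(2)[OF that] by simp
        from DERIV_power[OF this, of 2] show ?thesis by (simp add: mult_ac)
      qed
      have "\<exists>y>a. y < b \<and> ((\<lambda>x. (g x)^2) has_real_derivative 0) (at y)"
      proof (rule Rolle[OF ab(3)])
        show "(g a)^2 = (g b)^2" using ab abs_g by (metis imageE power2_abs)
        show "continuous_on {a..b} (\<lambda>x. (g x)^2)"
          by (intro continuous_at_imp_continuous_on ballI DERIV_isCont[OF gd]) auto
        show "(\<lambda>x. (g x)^2) differentiable (at y)" if "a < y" "y < b" for y
          using gd[of y] that by (auto simp: real_differentiable_def)
      qed
      then obtain y where y: "a < y" "y < b" "((\<lambda>x. (g x)^2) has_real_derivative 0) (at y)" by blast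
      have "2 * ?d y * g y = 0" using DERIV_unique[OF gd[of y] y(3)] y by simp
      then have "N G \<alpha> (\<sigma> y) = 0 \<or> N G \<beta> (\<sigma> y) = 0" using g[of y] x[of y] y pq by auto
      then show ?thesis using y x[of y] by auto
    qed
    have "finite ?X" using X by simp
    from finite_gap_points[OF this gap]
    obtain Y where Y': "finite Y" "card ?X \<le> card Y + 1" "Y \<inter> ?X = {}"
      "\<forall>y\<in>Y. (y \<in> J \<and> 0 < y \<and> (N G \<alpha> (\<sigma> y) = 0 \<or> N G \<beta> (\<sigma> y) = 0)) \<and> (\<exists>x\<in>?X. y < x)"
      by (elim meta_impE exE conjE) simp_all
    note Y = Y'(1-3)
    have Y4: "y \<in> J \<and> 0 < y \<and> (N G \<alpha> (\<sigma> y) = 0 \<or> N G \<beta> (\<sigma> y) = 0)" if "y \<in> Y" for y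
      using Y'(4) that by auto
    \<comment> \<open>Critical points of the square at which the integral of exponent \<alpha>
      vanishes; there are at most \<open>L\<close> of them, and the remaining ones are zeros at
      exponent \<beta>. Hence the deficit \<open>L + 1\<close> and the total
      \<open>2 * L + 1\<close>.\<close>
    define Y0 where "Y0 = {y \<in> Y. N G \<alpha> (\<sigma> y) = 0}"
    have Y0: "card Y0 \<le> L"
    proof -
      have i: "inj_on \<sigma> Y0" using Y4 by (intro inj_on_subset[OF \<sigma>_inj_pos]) (auto simp: Y0_def)
      have "sum (\<lambda>_. 1) (\<sigma> ` Y0) \<le> L"
        by (rule zeros_le_card_zeros[OF G G_zeros \<alpha>_nonzero])
          (use Y Y4 in \<open>auto simp: Y0_def J_iff vanishes_def\<close>)
      then show ?thesis by (simp add: card_image[OF i])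
    qed
    have cY: "card Y = card Y0 + card (Y - Y0)"
      using Y(1) by (simp add: Y0_def card_Diff_subset card_mono)
    have "sum (ms \<circ> the_inv_into X abs) ?X \<le> L + (L + 1)"
    proof (rule count_zeros[where Y = "Y - Y0"])
      show "card ?X \<le> card (Y - Y0) + (L + 1)" using Y(2) Y0 cY by linarith
      show "inj_on \<sigma> (?X \<union> (Y - Y0))"
        by (rule inj_on_subset[OF \<sigma>_inj_pos]) (use Y4 z in auto)
      show "N G \<beta> (\<sigma> y) = 0" if "y \<in> Y - Y0" for y using Y4[of y] that by (auto simp: Y0_def)
    qed (use X Y Y4 z J_abs the_inv_into_f_f[OF inj] in \<open>auto simp: Y0_def \<sigma>_abs\<close>)
    then show "sum ms X \<le> 2 * L + 1" using the_inv_into_f_f[OF inj] by (simp add: sum.reindex[OF inj])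
  qed
qed

lemma two_sides_bound_odd:
  shows "zeros_bounded u (J - {0}) (2 * (L + 1))"
proof -
  have "zeros_bounded u (J \<inter> {0<..} \<union> J \<inter> {..<0}) ((L + 1) + (L + 1))"
    by (intro zeros_bounded_Un one_side_bound) auto
  moreover have "J - {0} \<subseteq> J \<inter> {0<..} \<union> J \<inter> {..<0}" by force
  ultimately have "zeros_bounded u (J - {0}) ((L + 1) + (L + 1))" by (rule zeros_bounded_subset)
  then show ?thesis by (simp add: mult_2)
qed

lemma u_differentiable: "\<rho> \<in> J - {0} \<Longrightarrow> u differentiable (at \<rho>)"
  using u_deriv by (auto simp: real_differentiable_def)

end

section \<open>Persistence of sign changes\<close>

text \<open>Opposite signs at the ends of disjoint closed intervals: this involves finitely many
  values only, so it survives any small perturbation, while the intermediate value theorem still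
  returns distinct zeros.\<close>

definition sign_changes :: "(real \<Rightarrow> real) \<Rightarrow> real set \<Rightarrow> nat \<Rightarrow> bool" where
  "sign_changes g S k \<longleftrightarrow> (\<exists>P. finite P \<and> card P = k \<and> disjoint_family_on (\<lambda>(a, b). {a..b}) P \<and>
     (\<forall>(a, b)\<in>P. a < b \<and> {a..b} \<subseteq> S \<and> g a * g b < 0))"

lemma sign_changes_subset: "sign_changes g S k \<Longrightarrow> S \<subseteq> S' \<Longrightarrow> sign_changes g S' k"
  unfolding sign_changes_def by fast

lemma sign_changes_single: "a < b \<Longrightarrow> {a..b} \<subseteq> S \<Longrightarrow> g a * g b < 0 \<Longrightarrow> sign_changes g S 1"
  unfolding sign_changes_def by (intro exI[of _ "{(a, b)}"]) (auto simp: disjoint_family_on_def)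

lemma sign_changes_Un:
  assumes "sign_changes g S1 k1" "sign_changes g S2 k2" "S1 \<inter> S2 = {}"
  shows "sign_changes g (S1 \<union> S2) (k1 + k2)"
proof -
  obtain P1 where P1: "finite P1" "card P1 = k1" "disjoint_family_on (\<lambda>(a, b). {a..b}) P1"
    "\<And>a b. (a, b) \<in> P1 \<Longrightarrow> a < b \<and> {a..b} \<subseteq> S1 \<and> g a * g b < 0"
    using assms(1) unfolding sign_changes_def by blast
  obtain P2 where P2: "finite P2" "card P2 = k2" "disjoint_family_on (\<lambda>(a, b). {a..b}) P2"
    "\<And>a b. (a, b) \<in> P2 \<Longrightarrow> a < b \<and> {a..b} \<subseteq> S2 \<and> g a * g b < 0"
    using assms(2) unfolding sign_changes_def by blast
  have dis: "{a..b} \<inter> {c..d} = {}" if "(a, b) \<in> P1" "(c, d) \<in> P2" for a b c d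
    using P1(4)[OF that(1)] P2(4)[OF that(2)] assms(3) by blast
  have "P1 \<inter> P2 = {}"
  proof (rule ccontr)
    assume "P1 \<inter> P2 \<noteq> {}"
    then obtain a b where "(a, b) \<in> P1" "(a, b) \<in> P2" by fast
    then show False using dis[of a b a b] P1(4)[of a b] by simp
  qed
  then have "card (P1 \<union> P2) = k1 + k2" using P1 P2 by (simp add: card_Un_disjoint)
  moreover have "disjoint_family_on (\<lambda>(a, b). {a..b}) (P1 \<union> P2)"
    unfolding disjoint_family_on_def
  proof (intro ballI impI)
    fix x y assume xy: "x \<in> P1 \<union> P2" "y \<in> P1 \<union> P2" "x \<noteq> y"
    obtain a b c d where [simp]: "x = (a, b)" "y = (c, d)" by (cases x; cases y) auto
    consider "x \<in> P1" "y \<in> P1" | "x \<in> P2" "y \<in> P2" | "x \<in> P1" "y \<in> P2" | "x \<in> P2" "y \<in> P1"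
      using xy by blast
    then show "(case x of (a, b) \<Rightarrow> {a..b}) \<inter> (case y of (a, b) \<Rightarrow> {a..b}) = {}"
    proof cases
      case 1
      then show ?thesis using P1(3) xy(3) unfolding disjoint_family_on_def by blast
    next
      case 2
      then show ?thesis using P2(3) xy(3) unfolding disjoint_family_on_def by blast
    next
      case 3
      then show ?thesis using dis[of a b c d] by simp
    next
      case 4
      then show ?thesis using dis[of c d a b] by (simp add: Int_commute)
    qed
  qed
  ultimately show ?thesis unfolding sign_changes_def using P1 P2
    by (intro exI[of _ "P1 \<union> P2"]) (auto dest: P1(4) P2(4))
qed

lemma sign_changes_scale:
  assumes "\<And>x. x \<in> S \<Longrightarrow> g x = w x * g' x" "\<And>a b. a < b \<Longrightarrow> {a..b} \<subseteq> S \<Longrightarrow> 0 < w a * w b"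
  shows "sign_changes g S k \<longleftrightarrow> sign_changes g' S k"
proof -
  have "g a * g b < 0 \<longleftrightarrow> g' a * g' b < 0" if ab: "a < b" "{a..b} \<subseteq> S" for a b
  proof -
    have "a \<in> S" "b \<in> S" using ab by auto
    then have "g a * g b = (w a * w b) * (g' a * g' b)" using assms(1) by simp
    then show ?thesis
      using mult_less_cancel_left_pos[OF assms(2)[OF ab], of "g' a * g' b" 0] by (simp only: mult_zero_right)
  qed
  then show ?thesis unfolding sign_changes_def by (intro arg_cong[where f = Ex] ext) fast
qed

lemma interval_avoiding_zero: "{a..b} \<subseteq> S \<Longrightarrow> 0 \<notin> S \<Longrightarrow> (0::real) < a \<or> b < 0"
  using atLeastAtMost_iff[of 0 a b] by (meson linorder_not_less subsetD)

text \<open>Each interval avoids 0, so its ends have equal sign and the factor x^j does not affect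
  the sign of the product.\<close>

lemma sign_changes_power:
  assumes "0 \<notin> S" "\<And>x. x \<in> S \<Longrightarrow> g x = x ^ j * g' x"
  shows "sign_changes g S k \<longleftrightarrow> sign_changes g' S k"
proof (rule sign_changes_scale[OF assms(2)])
  fix a b :: real assume ab: "a < b" "{a..b} \<subseteq> S"
  have "0 < a \<or> b < 0" by (rule interval_avoiding_zero[OF ab(2) assms(1)])
  then have "0 < a * b" using ab(1) by (auto intro: mult_pos_pos mult_neg_neg)
  then have "0 < (a * b) ^ j" by simp
  then show "0 < a ^ j * b ^ j" by (simp add: power_mult_distrib)
qed

lemma sign_changes_zeros:
  assumes "sign_changes g S k" "continuous_on S g"
  obtains X where "finite X" "X \<subseteq> S" "card X = k" "\<And>x. x \<in> X \<Longrightarrow> g x = 0"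
proof -
  obtain P where P: "finite P" "card P = k" "disjoint_family_on (\<lambda>(a, b). {a..b}) P"
    "\<And>a b. (a, b) \<in> P \<Longrightarrow> a < b \<and> {a..b} \<subseteq> S \<and> g a * g b < 0"
    using assms(1) unfolding sign_changes_def by blast
  have ex: "\<exists>x\<in>{a..b}. g x = 0" if ab: "(a, b) \<in> P" for a b
  proof (rule ccontr)
    assume neg: "\<not> ?thesis"
    have "continuous_on {a..b} g" using P(4)[OF ab] assms(2) continuous_on_subset by blast
    from constant_sign_if_no_zeros[OF this] neg obtain \<sigma> :: real where
      \<sigma>: "\<sigma> \<in> {1, -1}" "\<forall>t\<in>{a..b}. 0 \<le> \<sigma> * g t" by force
    then have "0 \<le> (\<sigma> * g a) * (\<sigma> * g b)" using P(4)[OF ab] 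
      by (intro mult_nonneg_nonneg[of "\<sigma> * g a" "\<sigma> * g b"]) auto
    then show False using \<sigma>(1) P(4)[OF ab] by auto
  qed
  then have "\<forall>x\<in>P. \<exists>y. y \<in> {fst x..snd x} \<and> g y = 0" by force
  from bchoice[OF this] obtain z where z: "\<And>a b. (a, b) \<in> P \<Longrightarrow> z (a, b) \<in> {a..b} \<and> g (z (a, b)) = 0"
    by force
  have "inj_on z P"
  proof (rule inj_onI)
    fix x y assume xy: "x \<in> P" "y \<in> P" "z x = z y"
    obtain a b c d where e: "x = (a, b)" "y = (c, d)" by (cases x; cases y) auto
    show "x = y"
    proof (rule ccontr)
      assume "x \<noteq> y"
      then have "{a..b} \<inter> {c..d} = {}" using P(3) xy e unfolding disjoint_family_on_def by fastforce
      then show False using z[of a b] z[of c d] xy e by auto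
    qed
  qed
  then show ?thesis
    using that[of "z ` P"] P z by (fastforce simp: card_image)
qed

text \<open>A nonzero derivative gives opposite signs on the two sides. One common radius below half
  of every mutual distance makes the intervals disjoint.\<close>

lemma sign_changes_if_simple_zeros:
  assumes X: "finite X" "X \<subseteq> S" "open S" and simple: "X \<subseteq> simple_zeros g S"
  shows "sign_changes g S (card X)"
proof -
  have ev: "eventually (\<lambda>e. {x - e..x + e} \<subseteq> S \<and> g (x - e) * g (x + e) < 0) (at_right 0)" if x: "x \<in> X" for x
  proof -
    obtain r where r: "r > 0" "cball x r \<subseteq> S" using X x open_contains_cball by blast
    obtain D where D: "D \<noteq> 0" "(g has_real_derivative D) (at x)" "g x = 0"
      using simple x by (auto simp: simple_zeros_def)
    have "\<exists>d>0. \<forall>h>0. h < d \<longrightarrow> g (x - h) * g (x + h) < 0"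
    proof (cases "D > 0")
      case True
      obtain d1 where d1: "d1 > 0" "\<And>h. 0 < h \<Longrightarrow> h < d1 \<Longrightarrow> g x < g (x + h)"
        using DERIV_pos_inc_right[OF D(2) True] by blast
      obtain d2 where d2: "d2 > 0" "\<And>h. 0 < h \<Longrightarrow> h < d2 \<Longrightarrow> g (x - h) < g x"
        using DERIV_pos_inc_left[OF D(2) True] by blast
      show ?thesis using d1 d2 D(3) by (intro exI[of _ "min d1 d2"]) (auto intro!: mult_neg_pos)
    next
      case False
      then have neg: "D < 0" using D by simp
      obtain d1 where d1: "d1 > 0" "\<And>h. 0 < h \<Longrightarrow> h < d1 \<Longrightarrow> g (x + h) < g x"
        using DERIV_neg_dec_right[OF D(2) neg] by blast
      obtain d2 where d2: "d2 > 0" "\<And>h. 0 < h \<Longrightarrow> h < d2 \<Longrightarrow> g x < g (x - h)"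
        using DERIV_neg_dec_left[OF D(2) neg] by blast
      show ?thesis using d1 d2 D(3) by (intro exI[of _ "min d1 d2"]) (auto intro!: mult_pos_neg)
    qed
    then obtain d where d: "d > 0" "\<And>h. 0 < h \<Longrightarrow> h < d \<Longrightarrow> g (x - h) * g (x + h) < 0" by blast
    have "{x - e..x + e} \<subseteq> S" if "e < r" for e
      using r(2) that by (force simp: subset_iff dist_real_def)
    then show ?thesis unfolding eventually_at_right_field
      using d r(1) by (intro exI[of _ "min d r"]) auto
  qed
  have ev2: "eventually (\<lambda>e. \<forall>x\<in>X. \<forall>y\<in>X. x \<noteq> y \<longrightarrow> 2 * e < \<bar>x - y\<bar>) (at_right 0)"
  proof (intro eventually_ball_finite X(1) ballI)
    fix x y assume "x \<in> X" "y \<in> X"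
    show "eventually (\<lambda>e. x \<noteq> y \<longrightarrow> 2 * e < \<bar>x - y\<bar>) (at_right 0)"
    proof (cases "x = y")
      case False
      then show ?thesis unfolding eventually_at_right_field
        by (intro exI[of _ "\<bar>x - y\<bar> / 2"]) auto
    qed simp
  qed
  have "eventually (\<lambda>e::real. 0 < e) (at_right 0)" by (simp add: eventually_at_right_less)
  moreover have "eventually (\<lambda>e. \<forall>x\<in>X. {x - e..x + e} \<subseteq> S \<and> g (x - e) * g (x + e) < 0) (at_right 0)"
    using ev by (intro eventually_ball_finite X(1)) auto
  ultimately have "eventually (\<lambda>e. 0 < e \<and> (\<forall>x\<in>X. {x - e..x + e} \<subseteq> S \<and> g (x - e) * g (x + e) < 0) \<and>
      (\<forall>x\<in>X. \<forall>y\<in>X. x \<noteq> y \<longrightarrow> 2 * e < \<bar>x - y\<bar>)) (at_right 0)"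
    using ev2 by eventually_elim auto
  then obtain e where e: "0 < e" "\<And>x. x \<in> X \<Longrightarrow> {x - e..x + e} \<subseteq> S \<and> g (x - e) * g (x + e) < 0"
    "\<And>x y. x \<in> X \<Longrightarrow> y \<in> X \<Longrightarrow> x \<noteq> y \<Longrightarrow> 2 * e < \<bar>x - y\<bar>"
    using eventually_happens'[OF trivial_limit_at_right_real] by blast
  define P where "P = (\<lambda>x. (x - e, x + e)) ` X"
  have "inj_on (\<lambda>x. (x - e, x + e)) X" by (rule inj_onI) simp
  then have "card P = card X" by (simp add: P_def card_image)
  moreover have "disjoint_family_on (\<lambda>(a, b). {a..b}) P"
    unfolding disjoint_family_on_def P_def
  proof (intro ballI impI)
    fix u v assume "u \<in> (\<lambda>x. (x - e, x + e)) ` X" "v \<in> (\<lambda>x. (x - e, x + e)) ` X" "u \<noteq> v"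
    then obtain x y where xy: "u = (x - e, x + e)" "v = (y - e, y + e)" "x \<in> X" "y \<in> X" "x \<noteq> y" by auto
    have "2 * e < \<bar>x - y\<bar>" using e(3) xy by auto
    then show "(case u of (a, b) \<Rightarrow> {a..b}) \<inter> (case v of (a, b) \<Rightarrow> {a..b}) = {}" by (auto simp: xy)
  qed
  ultimately show ?thesis unfolding sign_changes_def using X(1) e(1,2)
    by (intro exI[of _ P]) (auto simp: P_def)
qed

text \<open>Finitely many closed intervals that avoid 0 keep a positive distance from it. This
  leaves room near 0 for the new sign changes created by a perturbation.\<close>

lemma sign_changes_away_from_zero:
  assumes "sign_changes g S k" "0 \<notin> S"
  shows "\<exists>\<eta>>0. \<forall>\<eta>'<\<eta>. sign_changes g (S \<inter> {x. \<eta>' < \<bar>x\<bar>}) k"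
proof -
  obtain P where P: "finite P" "card P = k" "disjoint_family_on (\<lambda>(a, b). {a..b}) P"
    "\<And>a b. (a, b) \<in> P \<Longrightarrow> a < b \<and> {a..b} \<subseteq> S \<and> g a * g b < 0"
    using assms(1) unfolding sign_changes_def by blast
  have s: "0 < a \<or> b < 0" if "(a, b) \<in> P" for a b
    using P(4)[OF that] by (intro interval_avoiding_zero[OF _ assms(2)]) simp
  define \<eta> where "\<eta> = Min (insert 1 ((\<lambda>(a, b). min \<bar>a\<bar> \<bar>b\<bar>) ` P))"
  have "\<eta> > 0" unfolding \<eta>_def using P(1) s P(4) by (subst Min_gr_iff) fastforce+
  moreover have "sign_changes g (S \<inter> {x. \<eta>' < \<bar>x\<bar>}) k" if \<eta>': "\<eta>' < \<eta>" for \<eta>'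
  proof -
    have "{a..b} \<subseteq> {x. \<eta>' < \<bar>x\<bar>}" if ab: "(a, b) \<in> P" for a b
    proof -
      have "\<eta> \<le> min \<bar>a\<bar> \<bar>b\<bar>" unfolding \<eta>_def using P(1) ab by (intro Min_le) force+
      then show ?thesis using s[OF ab] \<eta>' P(4)[OF ab] by (auto simp: abs_if split: if_splits)
    qed
    then show ?thesis unfolding sign_changes_def using P by (intro exI[of _ P]) blast
  qed
  ultimately show ?thesis by blast
qed

text \<open>Only the values at the finitely many interval ends matter, so nothing is required of
  \<open>v\<close>.\<close>

lemma sign_changes_perturb:
  assumes "sign_changes g S k"
  shows "eventually (\<lambda>d. sign_changes (\<lambda>x. g x + d * v x) S k) (nhds 0)"
proof -
  obtain P where P: "finite P" "card P = k" "disjoint_family_on (\<lambda>(a, b). {a..b}) P"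
    "\<And>a b. (a, b) \<in> P \<Longrightarrow> a < b \<and> {a..b} \<subseteq> S \<and> g a * g b < 0"
    using assms unfolding sign_changes_def by blast
  have "eventually (\<lambda>d. \<forall>x\<in>P. case x of (a, b) \<Rightarrow> (g a + d * v a) * (g b + d * v b) < 0) (nhds 0)"
  proof (intro eventually_ball_finite P(1) ballI)
    fix x assume "x \<in> P"
    then obtain a b where x: "x = (a, b)" "(a, b) \<in> P" by (cases x) auto
    have "((\<lambda>d. (g a + d * v a) * (g b + d * v b)) \<longlongrightarrow> (g a + 0 * v a) * (g b + 0 * v b)) (nhds 0)"
      by (intro tendsto_intros filterlim_ident)
    moreover have "(g a + 0 * v a) * (g b + 0 * v b) < 0" using P(4)[OF x(2)] by simp
    ultimately show "eventually (\<lambda>d. case x of (a, b) \<Rightarrow> (g a + d * v a) * (g b + d * v b) < 0) (nhds 0)"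
      unfolding x(1) using order_tendstoD(2) by fastforce
  qed
  then show ?thesis
  proof eventually_elim
    case (elim d)
    then show ?case unfolding sign_changes_def
      by (intro exI[of _ P] conjI P(1-3)) (use P(4) in fast)
  qed
qed

lemma isCont_tendsto_nhds: "isCont f x \<Longrightarrow> (f \<longlongrightarrow> f x) (nhds x)"
  by (simp add: isCont_def tendsto_at_iff_tendsto_nhds)

text \<open>Near \<open>0\<close> the function \<open>g = x\<^sup>e k\<close> with \<open>k 0 \<noteq> 0\<close> has a zero of order \<open>e\<close>, from which a small
  multiple of \<open>v\<close> of the right sign splits off one or two sign changes.\<close>

lemma sign_changes_split_zero:
  assumes g: "\<And>x. g x = x ^ e * k x" and e: "e > 0"
    and J: "open J" "(0::real) \<in> J" and k: "continuous_on J k" "k 0 \<noteq> 0" and v: "continuous_on J v" "v 0 \<noteq> 0"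
    and sc: "sign_changes g (J - {0}) N"
  obtains d where "d \<noteq> 0" "sign_changes (\<lambda>x. g x + d * v x) (J - {0}) (N + (if even e then 2 else 1))"
proof -
  obtain \<eta>0 where \<eta>0: "\<eta>0 > 0" "\<And>\<eta>. \<eta> < \<eta>0 \<Longrightarrow> sign_changes g (J \<inter> {x. \<eta> < \<bar>x\<bar>}) N"
  proof -
    obtain \<eta>0 where "\<eta>0 > 0" "\<forall>\<eta><\<eta>0. sign_changes g ((J - {0}) \<inter> {x. \<eta> < \<bar>x\<bar>}) N"
      using sign_changes_away_from_zero[OF sc] by auto
    moreover have "(J - {0}) \<inter> {x. \<eta> < \<bar>x\<bar>} \<subseteq> J \<inter> {x. \<eta> < \<bar>x\<bar>}" for \<eta> by auto
    ultimately show ?thesis using that sign_changes_subset by meson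
  qed
  have "isCont k 0" using k J continuous_on_eq_continuous_at by blast
  from isCont_tendsto_nhds[OF this] have "((\<lambda>x. k x * k 0) \<longlongrightarrow> k 0 * k 0) (nhds 0)"
    by (intro tendsto_mult tendsto_const)
  moreover have "0 < k 0 * k 0" using k by (metis not_real_square_gt_zero)
  ultimately have "eventually (\<lambda>x. 0 < k x * k 0) (nhds 0)" by (rule order_tendstoD(1))
  moreover have "eventually (\<lambda>x. x \<in> J) (nhds 0)" using J eventually_nhds by blast
  ultimately have "eventually (\<lambda>x. 0 < k x * k 0 \<and> x \<in> J) (nhds 0)" by eventually_elim simp
  then obtain r where r: "r > 0" "\<And>x. \<bar>x\<bar> < r \<Longrightarrow> 0 < k x * k 0 \<and> x \<in> J"
    by (auto simp: eventually_nhds_metric dist_real_def)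
  define \<eta> where "\<eta> = min \<eta>0 r / 2"
  have \<eta>: "0 < \<eta>" "\<eta> < \<eta>0" "\<eta> < r" using \<eta>0 r by (auto simp: \<eta>_def)
  have right: "0 < g \<eta> * k 0" using r(2)[of \<eta>] \<eta> by (simp add: g mult.assoc)
  have left: "0 < g (-\<eta>) * k 0" if "even e" using r(2)[of "-\<eta>"] \<eta> that by (simp add: g mult.assoc)
  have ev: "eventually (\<lambda>d. 0 < (g y + d * v y) * k 0) (nhds 0)" if "0 < g y * k 0" for y
  proof -
    have "((\<lambda>d. (g y + d * v y) * k 0) \<longlongrightarrow> (g y + 0 * v y) * k 0) (nhds 0)"
      by (intro tendsto_intros filterlim_ident)
    then show ?thesis using that order_tendstoD(1) by fastforce
  qed
  have "eventually (\<lambda>d. sign_changes (\<lambda>x. g x + d * v x) (J \<inter> {x. \<eta> < \<bar>x\<bar>}) N) (nhds 0)"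
    by (rule sign_changes_perturb[OF \<eta>0(2)[OF \<eta>(2)]])
  moreover have "eventually (\<lambda>d. 0 < (g \<eta> + d * v \<eta>) * k 0) (nhds 0)" by (rule ev[OF right])
  moreover have "eventually (\<lambda>d. even e \<longrightarrow> 0 < (g (-\<eta>) + d * v (-\<eta>)) * k 0) (nhds 0)"
    using ev[OF left] by (cases "even e") auto
  ultimately have "eventually (\<lambda>d. sign_changes (\<lambda>x. g x + d * v x) (J \<inter> {x. \<eta> < \<bar>x\<bar>}) N \<and>
    0 < (g \<eta> + d * v \<eta>) * k 0 \<and> (even e \<longrightarrow> 0 < (g (-\<eta>) + d * v (-\<eta>)) * k 0)) (nhds 0)"
    by eventually_elim simp
  then obtain \<delta> where \<delta>: "\<delta> > 0" "\<And>d. \<bar>d\<bar> < \<delta> \<Longrightarrow> sign_changes (\<lambda>x. g x + d * v x) (J \<inter> {x. \<eta> < \<bar>x\<bar>}) N \<and>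
    0 < (g \<eta> + d * v \<eta>) * k 0 \<and> (even e \<longrightarrow> 0 < (g (-\<eta>) + d * v (-\<eta>)) * k 0)"
    by (auto simp: eventually_nhds_metric dist_real_def)
  have kv: "k 0 * v 0 \<noteq> 0" using k v by simp
  \<comment> \<open>\<open>c\<close> is the sign of \<open>k 0 * v 0\<close>; the perturbation
    \<open>d * v\<close> then has at 0 the sign opposite to \<open>k 0\<close>, while at \<eta> (and
    at -\<eta> if \<open>e\<close> is even) the sign of \<open>k 0\<close> persists. Between 0 and
    these points the sign must change.\<close>
  obtain c where c: "\<bar>c\<bar> = 1" "c * (k 0 * v 0) = \<bar>k 0 * v 0\<bar>"
  proof
    show "\<bar>sgn (k 0 * v 0)\<bar> = 1" using kv by (simp only: abs_sgn_eq if_False)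
    show "sgn (k 0 * v 0) * (k 0 * v 0) = \<bar>k 0 * v 0\<bar>" by (simp only: abs_sgn mult.commute)
  qed
  define d where "d = - c * \<delta> / 2"
  have d: "d \<noteq> 0" "\<bar>d\<bar> < \<delta>" using c(1) \<delta>(1) by (auto simp: d_def abs_mult)
  let ?f = "\<lambda>x. g x + d * v x"
  note D = \<delta>(2)[OF d(2)]
  have g0: "g 0 = 0" using e g[of 0] by (simp add: zero_power)
  have "?f 0 * k 0 = - (\<bar>k 0 * v 0\<bar> * \<delta> / 2)"
  proof -
    have "?f 0 * k 0 = - (c * (k 0 * v 0)) * \<delta> / 2" using e by (simp add: g0 d_def)
    then show ?thesis unfolding c(2) by simp
  qed
  moreover have "0 < \<bar>k 0 * v 0\<bar> * \<delta> / 2" using kv \<delta>(1) by simp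
  ultimately have f0: "?f 0 * k 0 < 0" by linarith
  have cg: "continuous_on J g" unfolding g[abs_def] by (intro continuous_intros k)
  have cf: "continuous_on J ?f" by (intro continuous_intros cg v)
  then have "isCont ?f 0" using J continuous_on_eq_continuous_at by blast
  from isCont_tendsto_nhds[OF this] have "((\<lambda>x. ?f x * k 0) \<longlongrightarrow> ?f 0 * k 0) (nhds 0)"
    by (intro tendsto_mult tendsto_const)
  then have "eventually (\<lambda>x. ?f x * k 0 < 0) (nhds 0)" using f0 by (rule order_tendstoD(2))
  then obtain r' where r': "r' > 0" "\<And>x. \<bar>x\<bar> < r' \<Longrightarrow> ?f x * k 0 < 0"
    by (auto simp: eventually_nhds_metric dist_real_def)
  define \<xi> where "\<xi> = min r' \<eta> / 2"
  have \<xi>: "0 < \<xi>" "\<xi> < r'" "\<xi> < \<eta>" using r' \<eta> by (auto simp: \<xi>_def)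
  have neg: "x * y < 0" if "0 < x * c" "y * c < 0" for x y c :: real
    using that by (auto simp: zero_less_mult_iff mult_less_0_iff)
  have R: "sign_changes ?f (J \<inter> {0<..\<eta>}) 1"
  proof (rule sign_changes_single)
    show "{\<xi>..\<eta>} \<subseteq> J \<inter> {0<..\<eta>}" using r(2) \<eta> \<xi> by auto
    show "?f \<xi> * ?f \<eta> < 0" using neg[of "?f \<eta>" "k 0" "?f \<xi>"] D r'(2)[of \<xi>] \<xi> by (simp add: mult.commute)
  qed (use \<xi> in auto)
  have Lft: "sign_changes ?f (J \<inter> {-\<eta>..<0}) 1" if "even e"
  proof (rule sign_changes_single)
    show "{-\<eta>..-\<xi>} \<subseteq> J \<inter> {-\<eta>..<0}" using r(2) \<eta> \<xi> by auto
    show "?f (-\<eta>) * ?f (-\<xi>) < 0" using neg[of "?f (-\<eta>)" "k 0" "?f (-\<xi>)"] D r'(2)[of "-\<xi>"] \<xi> that by simp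
  qed (use \<xi> in auto)
  have base: "sign_changes ?f ((J \<inter> {x. \<eta> < \<bar>x\<bar>}) \<union> (J \<inter> {0<..\<eta>})) (N + 1)"
    by (rule sign_changes_Un) (use D R in auto)
  show ?thesis
  proof (cases "even e")
    case True
    have "sign_changes ?f (((J \<inter> {x. \<eta> < \<bar>x\<bar>}) \<union> (J \<inter> {0<..\<eta>})) \<union> (J \<inter> {-\<eta>..<0})) (N + 1 + 1)"
      by (rule sign_changes_Un[OF base Lft[OF True]]) auto
    then have "sign_changes ?f (J - {0}) (N + 1 + 1)" by (rule sign_changes_subset) (use \<eta> in auto)
    then show ?thesis using that[of d] d True by simp
  next
    case False
    from base have "sign_changes ?f (J - {0}) (N + 1)" by (rule sign_changes_subset) (use \<eta> in auto)
    then show ?thesis using that[of d] d False by simp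
  qed
qed

section \<open>Realizing the bounds\<close>

locale abel_chebyshev = abel_family +
  fixes \<phi> :: "nat \<Rightarrow> real \<Rightarrow> real" and L :: nat
  assumes L: "L \<ge> 1"
    and \<phi>_cont: "\<And>l. continuous_on {0..T} (\<phi> l)"
    and chebyshev: "\<And>c. \<exists>l\<le>L. c l \<noteq> 0 \<Longrightarrow> finite {t \<in> {0<..<T}. (\<Sum>l\<le>L. c l * \<phi> l t) = 0} \<and>
      card {t \<in> {0<..<T}. (\<Sum>l\<le>L. c l * \<phi> l t) = 0} \<le> L"
    and \<phi>0_pos: "\<And>t. t \<in> {0..T} \<Longrightarrow> 0 < \<phi> 0 t"
begin

definition comb :: "(nat \<Rightarrow> real) \<Rightarrow> real \<Rightarrow> real" where "comb c t = (\<Sum>l\<le>L. c l * \<phi> l t)"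

definition u :: "real \<Rightarrow> (nat \<Rightarrow> real) \<Rightarrow> real \<Rightarrow> real" where
  "u A c \<rho> = A * \<rho> ^ p + \<rho> ^ q * N (comb c) \<alpha> (\<sigma> \<rho>)"

lemma comb_cont: "continuous_on {0..T} (comb c)"
  unfolding comb_def by (intro continuous_intros \<phi>_cont)

lemma N_comb: "s \<in> S \<Longrightarrow> N (comb c) \<gamma> s = (\<Sum>l\<le>L. c l * N (\<phi> l) \<gamma> s)"
  unfolding comb_def[abs_def] by (rule N_sum) (auto intro: \<phi>_cont)

lemma abel_zeros_comb:
  assumes "\<exists>l\<le>L. c l \<noteq> 0" "\<And>\<rho>. \<rho> \<in> J \<Longrightarrow> v \<rho> = u A c \<rho>"
  shows "abel_zeros f T p q (comb c) v A L"
  using comb_cont[of c] chebyshev[OF assms(1)] assms(2)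
  by unfold_locales (auto simp: comb_def u_def)

text \<open>With all \<open>c l\<close> zero only A \<rho>^p remains, which has no zero off 0. This
  disposes of the case in which the Chebyshev property says nothing.\<close>

lemma nontrivial_if_zero:
  assumes "A \<noteq> 0 \<or> (\<exists>l\<le>L. c l \<noteq> 0)" "\<rho> \<in> J - {0}" "u A c \<rho> = 0"
  shows "\<exists>l\<le>L. c l \<noteq> 0"
proof (rule ccontr)
  assume c: "\<not> ?thesis"
  have "N (comb c) \<alpha> (\<sigma> \<rho>) = 0"
    using c assms(2) by (subst N_comb) (auto simp: J_iff)
  then show False using assms c by (auto simp: u_def)
qed

lemma zeros_boundedI_nontrivial:
  assumes "A \<noteq> 0 \<or> (\<exists>l\<le>L. c l \<noteq> 0)" "\<And>\<rho>. \<rho> \<in> J \<Longrightarrow> v \<rho> = u A c \<rho>" "I \<subseteq> J - {0}"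
    and "\<exists>l\<le>L. c l \<noteq> 0 \<Longrightarrow> abel_zeros f T p q (comb c) v A L \<Longrightarrow> zeros_bounded v I k"
  shows "zeros_bounded v I k"
proof (cases "\<exists>l\<le>L. c l \<noteq> 0")
  case True
  then show ?thesis using assms(4) abel_zeros_comb assms(2) by blast
next
  case False
  show ?thesis
  proof (rule zeros_boundedI)
    fix X ms
    assume X: "finite X" "X \<subseteq> I" "\<And>x. x \<in> X \<Longrightarrow> ms x > 0"
      "\<And>x j. x \<in> X \<Longrightarrow> j < ms x \<Longrightarrow> (deriv ^^ j) v x = 0"
    have "X = {}"
    proof (rule equals0I)
      fix x assume x: "x \<in> X"
      have "v x = 0" using X(4)[OF x X(3)[OF x]] by simp
      moreover have "x \<in> J - {0}" using x X assms(3) by blast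
      ultimately show False using nontrivial_if_zero[OF assms(1), of x] assms(2) False by simp
    qed
    then show "sum ms X \<le> k" by simp
  qed
qed

lemma bound_one_side:
  assumes "A \<noteq> 0 \<or> (\<exists>l\<le>L. c l \<noteq> 0)" "\<And>\<rho>. \<rho> \<in> J \<Longrightarrow> v \<rho> = u A c \<rho>" "I = {0<..} \<or> I = {..<0}"
  shows "zeros_bounded v (J \<inter> I) (L + 1)"
  by (rule zeros_boundedI_nontrivial[OF assms(1,2)])
    (use assms(3) abel_zeros.one_side_bound in auto)

lemma bound_odd_even:
  assumes "A \<noteq> 0 \<or> (\<exists>l\<le>L. c l \<noteq> 0)" "\<And>\<rho>. \<rho> \<in> J \<Longrightarrow> v \<rho> = u A c \<rho>" "odd p" "even q"
  shows "zeros_bounded v (J - {0}) (2 * L + 1)"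
  by (rule zeros_boundedI_nontrivial[OF assms(1,2)])
    (use assms abel_zeros.two_sides_bound_odd_even in auto)

lemma bound_odd:
  assumes "A \<noteq> 0 \<or> (\<exists>l\<le>L. c l \<noteq> 0)" "\<And>\<rho>. \<rho> \<in> J \<Longrightarrow> v \<rho> = u A c \<rho>"
  shows "zeros_bounded v (J - {0}) (2 * (L + 1))"
  by (rule zeros_boundedI_nontrivial[OF assms(1,2)]) (use abel_zeros.two_sides_bound_odd in auto)

lemma bound_even:
  assumes "A \<noteq> 0 \<or> (\<exists>l\<le>L. c l \<noteq> 0)" "\<And>\<rho>. \<rho> \<in> J \<Longrightarrow> v \<rho> = u A c \<rho>" "even p"
  shows "zeros_bounded v (J - {0}) (L + 2)"
  by (rule zeros_boundedI_nontrivial[OF assms(1,2)])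
    (use assms abel_zeros.two_sides_bound_even in auto)

lemma bound_even_odd:
  assumes "A \<noteq> 0 \<or> (\<exists>l\<le>L. c l \<noteq> 0)" "\<And>\<rho>. \<rho> \<in> J \<Longrightarrow> v \<rho> = u A c \<rho>" "even p" "odd q" "p < q"
  shows "zeros_bounded v (J - {0}) (L + 1)"
  by (rule zeros_boundedI_nontrivial[OF assms(1,2)])
    (use assms abel_zeros.two_sides_bound_even_odd in auto)

section \<open>Coefficients with the maximal number of simple zeros\<close>

lemma positive_points: obtains X where "finite X" "card X = k" "X \<subseteq> J \<inter> {0<..}"
proof -
  obtain r where r: "r > 0" "ball 0 r \<subseteq> J" using open_J zero_in_J open_contains_ball by blast
  have "{0<..<r} \<subseteq> J \<inter> {0<..}" using r by (auto simp: subset_iff dist_real_def)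
  moreover have "infinite {0<..<r}" using r by simp
  ultimately have "infinite (J \<inter> {0<..})" using infinite_super by blast
  then show ?thesis using infinite_arbitrarily_large that by blast
qed

lemma interpolation:
  assumes "finite X" "X \<subseteq> J" "card X \<le> L + 1"
  obtains A c where "A \<noteq> 0 \<or> (\<exists>l\<le>L. c l \<noteq> 0)" "\<And>x. x \<in> X \<Longrightarrow> u A c x = 0"
proof -
  \<comment> \<open>\<open>A\<close> is treated as one more unknown, stored at index
    \<open>Suc L\<close>: there are L + 2 unknowns against at most L + 1 equations.\<close>
  define M where "M x l = (if l \<le> L then x ^ q * N (\<phi> l) \<alpha> (\<sigma> x) else x ^ p)" for x and l :: nat
  obtain d where d: "\<exists>l\<in>{..Suc L}. d l \<noteq> 0" "\<And>x. x \<in> X \<Longrightarrow> (\<Sum>l\<le>Suc L. d l * M x l) = 0"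
    using homogeneous_system_nontrivial_solution[of X "{..Suc L}" M] assms by auto
  have "u (d (Suc L)) d x = 0" if x: "x \<in> X" for x
  proof -
    have "\<sigma> x \<in> S" using x assms by (auto simp: J_iff)
    then have "u (d (Suc L)) d x = (\<Sum>l\<le>Suc L. d l * M x l)"
      unfolding u_def by (simp add: N_comb M_def sum_distrib_left mult_ac)
    then show ?thesis using d(2)[OF x] by simp
  qed
  moreover have "d (Suc L) \<noteq> 0 \<or> (\<exists>l\<le>L. d l \<noteq> 0)" using d(1) by (auto simp: le_Suc_eq)
  ultimately show ?thesis using that by blast
qed

lemma interpolation_homogeneous:
  assumes "finite Y" "Y \<subseteq> S" "card Y \<le> L"
  obtains c where "\<exists>l\<le>L. c l \<noteq> 0" "\<And>s. s \<in> Y \<Longrightarrow> N (comb c) \<alpha> s = 0"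
proof -
  obtain d where "\<exists>l\<in>{..L}. d l \<noteq> 0" "\<And>s. s \<in> Y \<Longrightarrow> (\<Sum>l\<le>L. d l * N (\<phi> l) \<alpha> s) = 0"
    using homogeneous_system_nontrivial_solution[of Y "{..L}" "\<lambda>s l. N (\<phi> l) \<alpha> s"] assms by auto
  then show ?thesis using assms(2) by (intro that[of d]) (auto simp: N_comb)
qed

lemma card_simple_zeros_u:
  assumes "A \<noteq> 0 \<or> (\<exists>l\<le>L. c l \<noteq> 0)" "zeros_bounded (u A c) (J - {0}) k"
    and X: "finite X" "X \<subseteq> J - {0}" "card X = k" "\<And>x. x \<in> X \<Longrightarrow> u A c x = 0" and k: "k > 0"
  shows "card (simple_zeros (u A c) (J - {0})) = k"
proof -
  have "X \<noteq> {}" using X k by auto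
  then have c: "\<exists>l\<le>L. c l \<noteq> 0" using nontrivial_if_zero[OF assms(1)] X by blast
  interpret abel_zeros f T p q n m "comb c" "u A c" A L by (rule abel_zeros_comb[OF c]) simp
  have "simple_zeros (u A c) (J - {0}) = X"
    by (rule simple_zeros_eq[OF assms(2) X]) (auto intro: u_differentiable)
  then show ?thesis using X by simp
qed

lemma u_minus:
  assumes "odd p" "u A c x = 0" "odd q \<or> A = 0"
  shows "u A c (- x) = 0"
  using assms by (cases "even q") (auto simp: u_def \<sigma>_minus_odd)

lemma card_symmetric: "finite X \<Longrightarrow> X \<subseteq> {0<..} \<Longrightarrow> card (X \<union> uminus ` X) = 2 * card (X :: real set)"
proof -
  assume X: "finite X" "X \<subseteq> {0<..}"
  have "X \<inter> uminus ` X = {}"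
  proof (rule equals0I)
    fix x assume "x \<in> X \<inter> uminus ` X"
    then have "x \<in> X" "- x \<in> X" by auto
    then have "0 < x" "0 < - x" using X(2) by blast+
    then show False by simp
  qed
  then show ?thesis using X(1) by (subst card_Un_disjoint) (auto simp: card_image)
qed

text \<open>Both powers are odd, so L + 1 prescribed positive zeros are reflected and the total
  meets the two-sided bound.\<close>

lemma exists_odd_odd:
  assumes "odd p" "odd q"
  shows "\<exists>A c. card (simple_zeros (u A c) (J - {0})) = 2 * (L + 1)"
proof -
  obtain X where X: "finite X" "card X = L + 1" "X \<subseteq> J \<inter> {0<..}" by (rule positive_points)
  obtain A c where Ac: "A \<noteq> 0 \<or> (\<exists>l\<le>L. c l \<noteq> 0)" "\<And>x. x \<in> X \<Longrightarrow> u A c x = 0"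
    by (rule interpolation[of X]) (use X in auto)
  have "card (simple_zeros (u A c) (J - {0})) = 2 * (L + 1)"
  proof (rule card_simple_zeros_u[OF Ac(1)])
    show "zeros_bounded (u A c) (J - {0}) (2 * (L + 1))" by (rule bound_odd[OF Ac(1)]) simp
    show "card (X \<union> uminus ` X) = 2 * (L + 1)" using card_symmetric X by simp
    show "X \<union> uminus ` X \<subseteq> J - {0}" using X J_minus_odd[OF assms(1)] by auto
  qed (use X Ac u_minus[OF assms(1)] assms in auto)
  then show ?thesis by blast
qed

text \<open>The two powers have different parity, so reflection of zeros is available only with A =
  0; this leaves \<open>L\<close> prescribed zeros on each side.\<close>

lemma exists_odd_even_greater:
  assumes "odd p" "even q" "q < p"
  shows "\<exists>A c. card (simple_zeros (u A c) (J - {0})) = 2 * L"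
proof -
  obtain X where X: "finite X" "card X = L" "X \<subseteq> J \<inter> {0<..}" by (rule positive_points)
  obtain c where c: "\<exists>l\<le>L. c l \<noteq> 0" "\<And>s. s \<in> \<sigma> ` X \<Longrightarrow> N (comb c) \<alpha> s = 0"
    by (rule interpolation_homogeneous[of "\<sigma> ` X"]) (use X card_image_le[of X \<sigma>] in \<open>auto simp: J_iff\<close>)
  have u0: "u 0 c x = 0" if "x \<in> X" for x using c(2) that by (simp add: u_def)
  have "card (simple_zeros (u 0 c) (J - {0})) = 2 * L"
  proof (rule card_simple_zeros_u)
    interpret abel_zeros f T p q n m "comb c" "u 0 c" 0 L by (rule abel_zeros_comb[OF c(1)]) simp
    show "zeros_bounded (u 0 c) (J - {0}) (2 * L)" by (rule two_sides_bound_homogeneous) simp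
    show "card (X \<union> uminus ` X) = 2 * L" using card_symmetric X by simp
    show "X \<union> uminus ` X \<subseteq> J - {0}" using X J_minus_odd[OF assms(1)] by auto
  qed (use X c u0 u_minus[OF assms(1)] L in auto)
  then show ?thesis by blast
qed

text \<open>The bound is for both sides together, so L + 1 positive zeros already exhaust
  it.\<close>

lemma exists_even_odd:
  assumes "even p" "odd q" "p < q"
  shows "\<exists>A c. card (simple_zeros (u A c) (J - {0})) = L + 1"
proof -
  obtain X where X: "finite X" "card X = L + 1" "X \<subseteq> J \<inter> {0<..}" by (rule positive_points)
  obtain A c where Ac: "A \<noteq> 0 \<or> (\<exists>l\<le>L. c l \<noteq> 0)" "\<And>x. x \<in> X \<Longrightarrow> u A c x = 0"
    by (rule interpolation[of X]) (use X in auto)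
  have "card (simple_zeros (u A c) (J - {0})) = L + 1"
    by (rule card_simple_zeros_u[OF Ac(1) bound_even_odd[OF Ac(1) _ assms] X(1)]) (use X Ac in auto)
  then show ?thesis by blast
qed

lemma sign_changes_comb:
  assumes c: "\<exists>l\<le>L. c l \<noteq> 0" and I: "I = {0<..} \<or> I = {..<0}" and k: "vanishes (comb c) \<alpha> 0 k"
    and X: "finite X" "X \<subseteq> J \<inter> I" "card X = L - k" "\<And>x. x \<in> X \<Longrightarrow> N (comb c) \<alpha> (\<sigma> x) = 0"
  shows "sign_changes (\<lambda>\<rho>. N (comb c) \<alpha> (\<sigma> \<rho>)) (J \<inter> I) (L - k)"
proof -
  interpret abel_zeros f T p q n m "comb c" "u 0 c" 0 L by (rule abel_zeros_comb[OF c]) simp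
  have "open I" using I by auto
  have "simple_zeros (u 0 c) (J \<inter> I) = X"
    by (rule simple_zeros_eq[OF one_side_bound_homogeneous[OF _ I k] X(1-3)])
      (use X(4) I in \<open>auto simp: u_def intro!: u_differentiable\<close>)
  then have "sign_changes (u 0 c) (J \<inter> I) (card X)"
    using X(1,2) open_J \<open>open I\<close> by (intro sign_changes_if_simple_zeros open_Int) auto
  then show ?thesis
    using sign_changes_power[of "J \<inter> I" "u 0 c" q "\<lambda>\<rho>. N (comb c) \<alpha> (\<sigma> \<rho>)"] I X(3) by (auto simp: u_def)
qed

text \<open>The point s = 0 shares the budget \<open>L\<close> with the positive zeros. This is what
  fixes the exact order of the integral at 0 in the constructions below.\<close>

lemma order_at_zero:
  assumes c: "\<exists>l\<le>L. c l \<noteq> 0" and k: "vanishes (comb c) \<alpha> 0 k"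
    and X: "finite X" "X \<subseteq> J \<inter> {0<..}" "\<And>x. x \<in> X \<Longrightarrow> N (comb c) \<alpha> (\<sigma> x) = 0"
  shows "card X + k \<le> L"
proof -
  interpret abel_zeros f T p q n m "comb c" "u 0 c" 0 L by (rule abel_zeros_comb[OF c]) simp
  have "sum (\<lambda>_. 1) X + k \<le> L"
    by (rule homogeneous_count[OF _ _ k X(1,2)]) (use X(3) in \<open>auto simp: u_def\<close>)
  then show ?thesis by simp
qed

lemma start_simple:
  obtains c X where "\<exists>l\<le>L. c l \<noteq> 0" "finite X" "card X = L" "X \<subseteq> J \<inter> {0<..}"
    "\<And>x. x \<in> X \<Longrightarrow> N (comb c) \<alpha> (\<sigma> x) = 0" "N (comb c) \<alpha> 0 \<noteq> 0"
proof -
  obtain X where X: "finite X" "card X = L" "X \<subseteq> J \<inter> {0<..}" by (rule positive_points)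
  obtain c where c: "\<exists>l\<le>L. c l \<noteq> 0" "\<And>s. s \<in> \<sigma> ` X \<Longrightarrow> N (comb c) \<alpha> s = 0"
    by (rule interpolation_homogeneous[of "\<sigma> ` X"]) (use X card_image_le[of X \<sigma>] in \<open>auto simp: J_iff\<close>)
  have "N (comb c) \<alpha> 0 \<noteq> 0"
  proof
    assume "N (comb c) \<alpha> 0 = 0"
    then have "vanishes (comb c) \<alpha> 0 1" by (simp add: vanishes_def)
    from order_at_zero[OF c(1) this X(1,3)] c(2) X(2) show False by auto
  qed
  then show ?thesis using that[of c X] X c by blast
qed

lemma vanishes_0: "vanishes G \<gamma> s 0"
  by (simp add: vanishes_def)

lemma card_simple_zeros_u_sign_changes:
  assumes "A \<noteq> 0 \<or> (\<exists>l\<le>L. c l \<noteq> 0)" "zeros_bounded (u A c) (J - {0}) k" "k > 0"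
    and "sign_changes g (J - {0}) k" "continuous_on (J - {0}) g" "\<And>x. x \<in> J - {0} \<Longrightarrow> u A c x = x ^ j * g x"
  shows "card (simple_zeros (u A c) (J - {0})) = k"
proof -
  obtain X where X: "finite X" "X \<subseteq> J - {0}" "card X = k" "\<And>x. x \<in> X \<Longrightarrow> g x = 0"
    using sign_changes_zeros[OF assms(4,5)] by blast
  have "u A c x = 0" if "x \<in> X" for x using assms(6)[of x] X(2,4) that by auto
  then show ?thesis by (rule card_simple_zeros_u[OF assms(1,2) X(1-3) _ assms(3)])
qed

lemma \<sigma>_0: "\<sigma> 0 = 0"
  using pq by (simp add: \<sigma>_def)

text \<open>Dividing by \<rho>^p leaves A plus a function with a zero of order q - p at 0. A small
  \<open>A\<close> splits this zero into one or two sign changes; since \<open>A\<close> is found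
  only afterwards, the bound is demanded for every \<open>A\<close>.\<close>

lemma perturb_constant_term:
  assumes less: "p < q" and c: "\<exists>l\<le>L. c l \<noteq> 0" "N (comb c) \<alpha> 0 \<noteq> 0"
    and sc: "sign_changes (\<lambda>\<rho>. N (comb c) \<alpha> (\<sigma> \<rho>)) (J - {0}) k"
    and b: "\<And>A. zeros_bounded (u A c) (J - {0}) (k + (if even (q - p) then 2 else 1))"
  shows "\<exists>A c. card (simple_zeros (u A c) (J - {0})) = k + (if even (q - p) then 2 else 1)"
proof -
  let ?\<Phi> = "\<lambda>\<rho>. N (comb c) \<alpha> (\<sigma> \<rho>)"
  have \<Phi>c: "continuous_on J ?\<Phi>" by (intro cont_N\<sigma> comb_cont)
  note s0 = \<sigma>_0
  have sc': "sign_changes (\<lambda>\<rho>. \<rho> ^ (q - p) * ?\<Phi> \<rho>) (J - {0}) k"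
    using sign_changes_power[of "J - {0}" "\<lambda>\<rho>. \<rho> ^ (q - p) * ?\<Phi> \<rho>" "q - p" ?\<Phi>] sc by simp
  obtain A where A: "A \<noteq> 0" "sign_changes (\<lambda>\<rho>. \<rho> ^ (q - p) * ?\<Phi> \<rho> + A * 1) (J - {0}) (k + (if even (q - p) then 2 else 1))"
    by (rule sign_changes_split_zero[where g = "\<lambda>\<rho>. \<rho> ^ (q - p) * ?\<Phi> \<rho>" and e = "q - p" and k = ?\<Phi> and v = "\<lambda>_. 1"])
      (use less open_J zero_in_J \<Phi>c c(2) s0 sc' in auto)
  have "card (simple_zeros (u A c) (J - {0})) = k + (if even (q - p) then 2 else 1)"
  proof (rule card_simple_zeros_u_sign_changes[OF _ b _ A(2)])
    show "continuous_on (J - {0}) (\<lambda>\<rho>. \<rho> ^ (q - p) * ?\<Phi> \<rho> + A * 1)"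
      by (intro continuous_intros continuous_on_subset[OF \<Phi>c]) auto
    show "u A c x = x ^ p * (x ^ (q - p) * ?\<Phi> x + A * 1)" for x
    proof -
      have "x ^ q = x ^ p * x ^ (q - p)" using less by (simp add: power_add[symmetric])
      then show ?thesis by (simp add: u_def algebra_simps)
    qed
  qed (use c in auto)
  then show ?thesis by blast
qed

text \<open>For odd \<open>p\<close> the integral is even in \<rho>, so its \<open>L\<close>
  positive sign changes are mirrored. As q - p is odd, the zero at 0 supplies one more.\<close>

lemma exists_odd_even_less:
  assumes "odd p" "even q" "p < q"
  shows "\<exists>A c. card (simple_zeros (u A c) (J - {0})) = 2 * L + 1"
proof -
  obtain c X where c: "\<exists>l\<le>L. c l \<noteq> 0" and X: "finite X" "card X = L" "X \<subseteq> J \<inter> {0<..}"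
    and z: "\<And>x. x \<in> X \<Longrightarrow> N (comb c) \<alpha> (\<sigma> x) = 0" "N (comb c) \<alpha> 0 \<noteq> 0"
    by (rule start_simple) blast
  let ?\<Phi> = "\<lambda>\<rho>. N (comb c) \<alpha> (\<sigma> \<rho>)"
  have "sign_changes ?\<Phi> (J \<inter> {0<..}) (L - 0)"
    by (rule sign_changes_comb[OF c _ vanishes_0 X(1,3)]) (use X z in auto)
  moreover have "sign_changes ?\<Phi> (J \<inter> {..<0}) (L - 0)"
  proof (rule sign_changes_comb[OF c _ vanishes_0])
    show "uminus ` X \<subseteq> J \<inter> {..<0}" using X J_minus_odd[OF assms(1)] by auto
  qed (use X z \<sigma>_minus_odd[OF assms(1)] in \<open>auto simp: card_image\<close>)
  ultimately have "sign_changes ?\<Phi> ((J \<inter> {0<..}) \<union> (J \<inter> {..<0})) (L + L)"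
    by (intro sign_changes_Un) auto
  then have sc: "sign_changes ?\<Phi> (J - {0}) (2 * L)" unfolding mult_2 by (rule sign_changes_subset) auto
  have o: "odd (q - p)" using assms by simp
  have "zeros_bounded (u A c) (J - {0}) (2 * L + 1)" for A
    by (rule bound_odd_even) (use c assms in auto)
  then show ?thesis using perturb_constant_term[OF assms(3) c z(2) sc] o by simp
qed

lemma exists_even_even_less:
  assumes "even p" "even q" "p < q"
  shows "\<exists>A c. card (simple_zeros (u A c) (J - {0})) = L + 2"
proof -
  obtain c X where c: "\<exists>l\<le>L. c l \<noteq> 0" and X: "finite X" "card X = L" "X \<subseteq> J \<inter> {0<..}"
    and z: "\<And>x. x \<in> X \<Longrightarrow> N (comb c) \<alpha> (\<sigma> x) = 0" "N (comb c) \<alpha> 0 \<noteq> 0"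
    by (rule start_simple) blast
  have "sign_changes (\<lambda>\<rho>. N (comb c) \<alpha> (\<sigma> \<rho>)) (J \<inter> {0<..}) (L - 0)"
    by (rule sign_changes_comb[OF c _ vanishes_0 X(1,3)]) (use X z in auto)
  then have "sign_changes (\<lambda>\<rho>. N (comb c) \<alpha> (\<sigma> \<rho>)) (J - {0}) (L - 0)" by (rule sign_changes_subset) auto
  then have sc: "sign_changes (\<lambda>\<rho>. N (comb c) \<alpha> (\<sigma> \<rho>)) (J - {0}) L" by simp
  have e: "even (q - p)" using assms by simp
  have "zeros_bounded (u A c) (J - {0}) (L + 2)" for A
    by (rule bound_even) (use c assms in auto)
  then show ?thesis using perturb_constant_term[OF assms(3) c z(2) sc] e by simp
qed

text \<open>For \<open>q < p\<close> one starts from a combination with \<open>N (comb c) \<alpha> = d s + O(s\<^sup>2)\<close>, \<open>d \<noteq> 0\<close>, and perturbs it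
  twice: first by \<open>A \<rho>\<^sup>p\<^sup>-\<^sup>q\<close>, then by a much smaller multiple of \<open>N (\<phi> 0) \<alpha>\<close>.\<close>

lemma exists_even_greater:
  assumes "even p" "q < p"
  shows "\<exists>A c. card (simple_zeros (u A c) (J - {0})) = L + 2"
proof -
  \<comment> \<open>Only L - 1 points, since the remaining condition is spent on a zero at s = 0,
    which must be of order exactly one.\<close>
  obtain X where X: "finite X" "card X = L - 1" "X \<subseteq> J \<inter> {0<..}" by (rule positive_points)
  obtain c where c: "\<exists>l\<le>L. c l \<noteq> 0" "\<And>s. s \<in> insert 0 (\<sigma> ` X) \<Longrightarrow> N (comb c) \<alpha> s = 0"
  proof (rule interpolation_homogeneous[of "insert 0 (\<sigma> ` X)"])
    show "card (insert 0 (\<sigma> ` X)) \<le> L"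
      using card_insert_le_m1[of L "\<sigma> ` X" 0] X card_image_le[of X \<sigma>] L by auto
  qed (use X in \<open>auto simp: J_iff\<close>)
  let ?\<Phi> = "\<lambda>\<rho>. N (comb c) \<alpha> (\<sigma> \<rho>)"
  have v1: "vanishes (comb c) \<alpha> 0 1" using c(2)[of 0] by (simp add: vanishes_def)
  define d where "d = \<alpha> * N (\<lambda>t. comb c t * F t) \<beta> 0"
  have "N (\<lambda>t. comb c t * F t) \<beta> 0 \<noteq> 0"
  proof
    assume "N (\<lambda>t. comb c t * F t) \<beta> 0 = 0"
    then have "vanishes (comb c) \<alpha> 0 2"
      using c(2)[of 0] by (auto simp: vanishes_def less_2_cases_iff add.commute)
    from order_at_zero[OF c(1) this X(1,3)] c(2) X(2) L show False by auto
  qed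
  then have d0: "d \<noteq> 0" using \<alpha>_nonzero[of 0] by (simp add: d_def)
  have "sign_changes ?\<Phi> (J \<inter> {0<..}) (L - 1)"
    by (rule sign_changes_comb[OF c(1) _ v1 X(1,3)]) (use X c in auto)
  then have sc0: "sign_changes ?\<Phi> (J - {0}) (L - 1)" by (rule sign_changes_subset) auto
  note s0 = \<sigma>_0
  have \<Phi>c: "continuous_on J ?\<Phi>" by (intro cont_N\<sigma> comb_cont)
  \<comment> \<open>The integral divided by \<rho>^(p-1), continued to 0. As \<sigma> = (p-1)
    \<rho>^(p-1), its value there is p - 1 times the derivative \<open>d\<close> in
    \<open>s\<close>.\<close>
  define \<Psi> where "\<Psi> \<rho> = (if \<rho> = 0 then (real p - 1) * d else ?\<Phi> \<rho> / \<rho> ^ (p - 1))" for \<rho>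
  have \<Phi>\<Psi>: "?\<Phi> \<rho> = \<rho> ^ (p - 1) * \<Psi> \<rho>" for \<rho>
    using c(2)[of 0] s0 pq by (auto simp: \<Psi>_def)
  have \<Psi>c: "continuous_on J \<Psi>"
  proof (intro continuous_at_imp_continuous_on ballI)
    fix x assume x: "x \<in> J"
    show "isCont \<Psi> x"
    proof (cases "x = 0")
      case True
      have "(N (comb c) \<alpha> has_real_derivative d) (at 0)"
        unfolding d_def by (rule N_deriv[OF comb_cont]) simp
      then have "((\<lambda>s. N (comb c) \<alpha> s / s) \<longlongrightarrow> d) (at 0)"
        using c(2)[of 0] by (simp add: has_field_derivative_iff)
      moreover have "filterlim \<sigma> (at 0) (at 0)"
      proof (rule filterlim_atI)
        have "isCont \<sigma> 0" using \<sigma>_deriv DERIV_isCont by blast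
        then show "(\<sigma> \<longlongrightarrow> 0) (at 0)" by (simp add: isCont_def s0)
        show "eventually (\<lambda>x. \<sigma> x \<noteq> 0) (at 0)"
          using \<sigma>_nonzero by (auto simp: eventually_at_filter)
      qed
      ultimately have "((\<lambda>\<rho>. ?\<Phi> \<rho> / \<sigma> \<rho>) \<longlongrightarrow> d) (at 0)"
        by (rule filterlim_compose)
      then have "((\<lambda>\<rho>. (real p - 1) * (?\<Phi> \<rho> / \<sigma> \<rho>)) \<longlongrightarrow> (real p - 1) * d) (at 0)"
        by (intro tendsto_intros)
      moreover have "eventually (\<lambda>\<rho>. (real p - 1) * (?\<Phi> \<rho> / \<sigma> \<rho>) = \<Psi> \<rho>) (at 0)"
        using p1_pos by (auto simp: eventually_at_filter \<Psi>_def \<sigma>_def)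
      ultimately have "(\<Psi> \<longlongrightarrow> (real p - 1) * d) (at 0)" by (rule Lim_transform_eventually)
      then show ?thesis unfolding True isCont_def by (simp add: \<Psi>_def)
    next
      case False
      have "isCont ?\<Phi> x" using \<Phi>c open_J x continuous_on_eq_continuous_at by blast
      then have "isCont (\<lambda>\<rho>. ?\<Phi> \<rho> / \<rho> ^ (p - 1)) x" using False by (intro continuous_intros) auto
      moreover have "eventually (\<lambda>\<rho>. ?\<Phi> \<rho> / \<rho> ^ (p - 1) = \<Psi> \<rho>) (nhds x)"
        using False by (auto simp: eventually_nhds \<Psi>_def intro!: exI[of _ "- {0}"])
      ultimately show ?thesis by (simp add: isCont_cong)
    qed
  qed
  have pw: "x ^ (p - 1) = x ^ (p - q) * x ^ (q - 1)" for x :: real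
    using assms(2) pq(2) by (simp add: power_add[symmetric])
  have "sign_changes ?\<Phi> (J - {0}) (L - 1) \<longleftrightarrow> sign_changes (\<lambda>\<rho>. \<rho> ^ (q - 1) * \<Psi> \<rho>) (J - {0}) (L - 1)"
    by (rule sign_changes_power[where j = "p - q"]) (simp, simp only: \<Phi>\<Psi> pw mult.assoc)
  with sc0 have "sign_changes (\<lambda>\<rho>. \<rho> ^ (q - 1) * \<Psi> \<rho>) (J - {0}) (L - 1)" by simp
  then obtain A where A: "A \<noteq> 0"
    "sign_changes (\<lambda>\<rho>. \<rho> ^ (q - 1) * \<Psi> \<rho> + A * 1) (J - {0}) (L - 1 + (if even (q - 1) then 2 else 1))"
    by (rule sign_changes_split_zero[where g = "\<lambda>\<rho>. \<rho> ^ (q - 1) * \<Psi> \<rho>" and e = "q - 1" and k = \<Psi> and v = "\<lambda>_. 1", rotated -2])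
      (use open_J zero_in_J \<Psi>c d0 p1_pos pq(2) in \<open>auto simp: \<Psi>_def\<close>)
  let ?k = "\<lambda>\<rho>. \<rho> ^ (q - 1) * \<Psi> \<rho> + A * 1"
  let ?v = "\<lambda>\<rho>. N (\<phi> 0) \<alpha> (\<sigma> \<rho>)"
  have kc: "continuous_on J ?k" by (intro continuous_intros \<Psi>c)
  have vc: "continuous_on J ?v" by (intro cont_N\<sigma> \<phi>_cont)
  have k0: "?k 0 \<noteq> 0" using A(1) pq(2) by (simp add: zero_power)
  have v0: "?v 0 \<noteq> 0"
  proof -
    have "0 < N (\<phi> 0) \<alpha> 0"
      by (rule N_pos[OF \<phi>_cont]) (use \<phi>0_pos T in \<open>force+\<close>)
    then show ?thesis by (simp add: s0)
  qed
  have "sign_changes (\<lambda>\<rho>. \<rho> ^ (p - q) * ?k \<rho>) (J - {0}) (L - 1 + (if even (q - 1) then 2 else 1))"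
    using sign_changes_power[of "J - {0}" "\<lambda>\<rho>. \<rho> ^ (p - q) * ?k \<rho>" "p - q" ?k] A(2) by simp
  then obtain \<delta> where \<delta>: "\<delta> \<noteq> 0" "sign_changes (\<lambda>\<rho>. \<rho> ^ (p - q) * ?k \<rho> + \<delta> * ?v \<rho>) (J - {0})
      (L - 1 + (if even (q - 1) then 2 else 1) + (if even (p - q) then 2 else 1))"
    by (rule sign_changes_split_zero[where g = "\<lambda>\<rho>. \<rho> ^ (p - q) * ?k \<rho>" and e = "p - q" and k = ?k and v = ?v, rotated -2])
      (use open_J zero_in_J kc vc v0 k0 assms in auto)
  \<comment> \<open>(q - 1) + (p - q) = p - 1 is odd, so exactly one of the two splittings yields
    two sign changes and the other one yields one: L - 1 + 3.\<close>
  have count: "L - 1 + (if even (q - 1) then 2 else 1) + (if even (p - q) then 2 else 1) = L + 2"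
    using assms L pq(2) by auto
  define c' where "c' = c(0 := c 0 + \<delta>)"
  have comb': "N (comb c') \<alpha> s = N (comb c) \<alpha> s + \<delta> * N (\<phi> 0) \<alpha> s" if "s \<in> S" for s
  proof -
    have "(\<Sum>l\<le>L. c' l * N (\<phi> l) \<alpha> s) = (\<Sum>l\<le>L. c l * N (\<phi> l) \<alpha> s + (if l = 0 then \<delta> * N (\<phi> 0) \<alpha> s else 0))"
      by (intro sum.cong) (auto simp: c'_def algebra_simps)
    then show ?thesis using that by (simp add: N_comb sum.distrib)
  qed
  have nt: "A \<noteq> 0 \<or> (\<exists>l\<le>L. c' l \<noteq> 0)" using A by simp
  have "card (simple_zeros (u A c') (J - {0})) = L + 2"
  proof (rule card_simple_zeros_u_sign_changes[OF nt])
    show "zeros_bounded (u A c') (J - {0}) (L + 2)" by (rule bound_even[OF nt _ assms(1)]) simp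
    show "sign_changes (\<lambda>\<rho>. \<rho> ^ (p - q) * ?k \<rho> + \<delta> * ?v \<rho>) (J - {0}) (L + 2)" using \<delta>(2) count by simp
    show "continuous_on (J - {0}) (\<lambda>\<rho>. \<rho> ^ (p - q) * ?k \<rho> + \<delta> * ?v \<rho>)"
      by (intro continuous_intros continuous_on_subset[OF \<Psi>c] continuous_on_subset[OF vc]) auto
    show "u A c' x = x ^ q * (x ^ (p - q) * ?k x + \<delta> * ?v x)" if x: "x \<in> J - {0}" for x
    proof -
      have "x ^ p = x ^ q * x ^ (p - q)" using assms(2) by (simp add: power_add[symmetric])
      moreover have "N (comb c') \<alpha> (\<sigma> x) = x ^ (p - q) * (x ^ (q - 1) * \<Psi> x) + \<delta> * ?v x"
        using comb'[of "\<sigma> x"] x \<Phi>\<Psi>[of x] pw[of x] by (simp add: J_iff mult.assoc)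
      ultimately show ?thesis by (simp add: u_def algebra_simps)
    qed
  qed simp
  then show ?thesis by blast
qed

lemma exists_even:
  assumes "even p" "even q \<or> q < p"
  shows "\<exists>A c. card (simple_zeros (u A c) (J - {0})) = L + 2"
  using assms exists_even_even_less exists_even_greater pq(3) by (cases "p < q") auto

end

section \<open>The space of second Melnikov functions\<close>

lemma enumerate_le_iff:
  assumes "infinite (A :: nat set)"
  shows "enumerate A l \<le> k \<longleftrightarrow> l < card {i \<in> A. i \<le> k}"
proof -
  define E where "E = {l. enumerate A l \<le> k}"
  have inj: "inj (enumerate A)" and ran: "range (enumerate A) = A"
    using bij_enumerate[OF assms] by (auto simp: bij_betw_def)
  have img: "enumerate A ` E = {i \<in> A. i \<le> k}" using ran by (auto simp: E_def)
  then have card: "card E = card {i \<in> A. i \<le> k}"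
    using card_image[OF inj_on_subset[OF inj subset_UNIV], of E] by simp
  have "finite (enumerate A ` E)" unfolding img by simp
  then have fin: "finite E" using inj by (meson finite_imageD inj_on_subset subset_UNIV)
  have mono: "enumerate A i \<le> enumerate A j \<longleftrightarrow> i \<le> j" for i j
    using assms by (metis enumerate_mono_iff linorder_not_less)
  show ?thesis
  proof
    assume "enumerate A l \<le> k"
    then have "enumerate A i \<le> k" if "i \<le> l" for i using mono[of i l] that by linarith
    then have "{..l} \<subseteq> E" by (auto simp: E_def)
    then have "card {..l} \<le> card E" using fin by (intro card_mono)
    then show "l < card {i \<in> A. i \<le> k}" using card by simp
  next
    assume l: "l < card {i \<in> A. i \<le> k}"
    show "enumerate A l \<le> k"
    proof (rule ccontr)
      assume "\<not> enumerate A l \<le> k"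
      then have "i < l" if "enumerate A i \<le> k" for i using mono[of l i] that by linarith
      then have "E \<subseteq> {..<l}" by (auto simp: E_def)
      then have "card E \<le> card {..<l}" by (intro card_mono) auto
      then show False using l card by simp
    qed
  qed
qed

lemma initial_segment_eq_enumerate:
  assumes "infinite (A :: nat set)"
  shows "{i \<in> A. i \<le> k} = enumerate A ` {..<card {i \<in> A. i \<le> k}}"
proof -
  have "range (enumerate A) = A" using bij_enumerate[OF assms] by (auto simp: bij_betw_def)
  then have *: "i \<in> A \<longleftrightarrow> (\<exists>l. i = enumerate A l)" for i by blast
  have "{i \<in> A. i \<le> k} = enumerate A ` {l. enumerate A l \<le> k}"
  proof (intro equalityI subsetI)
    fix i assume i: "i \<in> {i \<in> A. i \<le> k}"
    then obtain l where "i = enumerate A l" using *[of i] by blast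
    then show "i \<in> enumerate A ` {l. enumerate A l \<le> k}" using i by simp
  next
    fix i assume "i \<in> enumerate A ` {l. enumerate A l \<le> k}"
    then obtain l where "i = enumerate A l" "enumerate A l \<le> k" by blast
    then show "i \<in> {i \<in> A. i \<le> k}" using *[of i] by blast
  qed
  then show ?thesis by (simp only: enumerate_le_iff[OF assms] lessThan_def)
qed

text \<open>Back substitution: the last equation involves only the last unknown, which is then moved
  to the right-hand sides of the others.\<close>

lemma triangular_system_solvable:
  fixes M :: "nat \<Rightarrow> nat \<Rightarrow> real"
  assumes "\<And>l. l \<in> {1..k} \<Longrightarrow> M l l \<noteq> 0" "\<And>l j. l \<in> {1..k} \<Longrightarrow> l < j \<Longrightarrow> M l j = 0"
  shows "\<exists>x. \<forall>j\<in>{1..k}. (\<Sum>l=1..k. x l * M l j) = \<tau> j"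
  using assms
proof (induction k arbitrary: \<tau>)
  case (Suc k)
  define y where "y = \<tau> (Suc k) / M (Suc k) (Suc k)"
  obtain x where x: "\<forall>j\<in>{1..k}. (\<Sum>l=1..k. x l * M l j) = \<tau> j - y * M (Suc k) j"
    using Suc.IH[of "\<lambda>j. \<tau> j - y * M (Suc k) j"] Suc.prems by auto
  define z where "z = x(Suc k := y)"
  have s: "(\<Sum>l=1..Suc k. z l * M l j) = (\<Sum>l=1..k. x l * M l j) + y * M (Suc k) j" for j
    by (simp add: z_def)
  have "(\<Sum>l=1..Suc k. z l * M l j) = \<tau> j" if "j \<in> {1..Suc k}" for j
  proof (cases "j = Suc k")
    case True
    have "(\<Sum>l=1..k. x l * M l j) = 0" using Suc.prems(2) True by (intro sum.neutral) auto
    moreover have "y * M (Suc k) j = \<tau> j" using Suc.prems(1)[of "Suc k"] True by (simp add: y_def)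
    ultimately show ?thesis unfolding s by simp
  next
    case False
    then have "j \<in> {1..k}" using that by auto
    then show ?thesis unfolding s using x by simp
  qed
  then show ?case by blast
qed simp

lemma simple_zeros_cong:
  assumes "open J" "S \<subseteq> J" "\<And>x. x \<in> J \<Longrightarrow> v x = w x"
  shows "simple_zeros v S = simple_zeros w S"
proof -
  have "(v has_real_derivative D) (at x) \<longleftrightarrow> (w has_real_derivative D) (at x)" if "x \<in> S" for x D
    using assms that by (intro DERIV_cong_ev) (auto simp: eventually_nhds)
  then show ?thesis using assms(2,3) by (auto simp: simple_zeros_def)
qed

lemma real_analytic_isCont:
  assumes "real_analytic_on g U" "x \<in> U"
  shows "isCont g x"
proof -
  obtain G where "(\<lambda>h. g (x + h)) has_fps_expansion G"
    using assms unfolding real_analytic_on_def by blast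
  from has_fps_expansion_imp_continuous[OF this, of UNIV] show ?thesis
    unfolding isCont_iff by (simp add: continuous_within)
qed

text \<open>A nonnegative function whose integral over a subinterval is zero vanishes there;
  analyticity spreads this to [-T, T], against the assumption.\<close>

lemma primitive_strict_mono:
  assumes T: "T > 0" and U: "{-T..T} \<subseteq> U" "real_analytic_on g U"
    and g: "\<And>t. t \<in> {0..T} \<Longrightarrow> 0 \<le> g t" "\<exists>t\<in>{0..T}. g t \<noteq> 0"
  shows "strict_mono_on {0..T} (\<lambda>t. integral {-T..t} g)"
proof (rule strict_mono_onI)
  fix x y assume xy: "x \<in> {0..T}" "y \<in> {0..T}" "x < y"
  have c: "continuous_on {a..b} g" if "-T \<le> a" "b \<le> T" for a b
    using U real_analytic_isCont that
    by (intro continuous_at_imp_continuous_on) (auto simp: subset_iff)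
  have comb: "integral {-T..x} g + integral {x..y} g = integral {-T..y} g"
    using xy by (intro Henstock_Kurzweil_Integration.integral_combine integrable_continuous_interval c) auto
  have nn: "0 \<le> g t" if "t \<in> {x..y}" for t using g(1)[of t] that xy by auto
  have "0 \<le> integral {x..y} g"
    using nn xy by (intro integral_nonneg integrable_continuous_interval c) auto
  moreover have "integral {x..y} g \<noteq> 0"
  proof
    assume "integral {x..y} g = 0"
    then have z: "g t = 0" if "t \<in> {x..y}" for t
      using integral_eq_0_iff[OF c[of x y] xy(3) nn] xy that by auto
    \<comment> \<open>The inner part of [x, y] from one third to one half lies strictly inside (-T,
      T), as the identity theorem demands, even if y = T.\<close>
    have "g t = 0" if "t \<in> {-T..T}" for t
      by (rule real_analytic_zero_extend[OF U(2,1), of "x + (y - x) / 3" "x + (y - x) / 2"])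
        (use xy T z that in \<open>auto simp: field_simps\<close>)
    then show False using g(2) T by force
  qed
  ultimately show "integral {-T..x} g < integral {-T..y} g" using comb by linarith
qed

section \<open>The Melnikov functions in terms of the parameters\<close>

locale perturbed_abel_family = abel_family +
  fixes m1 n1 :: nat
  assumes f0_pos: "\<And>t. t \<in> {-T..T} \<Longrightarrow> f 0 t > 0"
    and m1: "m1 = card (nonodd_upto f T m) - 1" "m1 \<ge> 1"
    and n1: "n1 = card (nonodd_upto f T n) - 1" "n1 \<ge> 1"
    and m_pos: "m \<ge> 1"
    and CT: "\<And>r. r \<ge> 1 \<Longrightarrow>
       CT_system (map (\<lambda>i. even_part (f i)) (sorted_list_of_set (nonodd_upto f T r))) {0<..<T}"
    and inf: "infinite (odd_indices f T)" "infinite (nonodd_indices f T)"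
    and product: "\<And>k l. k \<ge> 1 \<Longrightarrow> l \<ge> 1 \<Longrightarrow>
       (\<lambda>t. F_tilde_even f T l t * f_tilde_odd f T k t) \<in> B_space f T (k + l - 1) - B_space f T (k + l - 2)"
    and min_le: "int m1 \<ge> min (int m - int m1 - 1) (int n1 - 1)"
begin

definition ev :: "nat \<Rightarrow> nat" where "ev l = enumerate (nonodd_indices f T) l"

definition od :: "nat \<Rightarrow> nat" where "od k = enumerate (odd_indices f T) (k - 1)"

definition \<phi> :: "nat \<Rightarrow> real \<Rightarrow> real" where "\<phi> l = even_part (f (ev l))"

text \<open>The number of odd indices up to \<open>m\<close>: of the m + 1 indices, m1 + 1 are
  non-odd.\<close>

definition k1 :: nat where "k1 = m - m1"

text \<open>The largest index of a \<phi> that can occur: the second-order coefficients of Q reach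
  \<open>m1\<close>, and the products, whose factors have indices up to \<open>n1\<close> and
  \<open>k1\<close>, reach k1 + n1 - 1. It equals K - 1.\<close>

definition L :: nat where "L = max (k1 + n1 - 1) m1"

lemma odd_indices_compl: "odd_indices f T = - nonodd_indices f T"
  by (auto simp: odd_indices_def nonodd_indices_def)

lemma nonodd_upto_eq: "nonodd_upto f T k = {i \<in> nonodd_indices f T. i \<le> k}"
  by (auto simp: nonodd_upto_def)

lemma zero_nonodd: "0 \<in> nonodd_indices f T"
  using f0_pos[of 0] T unfolding nonodd_indices_def by (auto simp: even_part_def intro!: bexI[of _ 0])

lemma one_odd: "1 \<in> odd_indices f T"
  using f1_odd by (auto simp: odd_indices_def even_part_def)

lemma inj_ev: "inj ev"
  using bij_enumerate[OF inf(2)] by (simp add: ev_def[abs_def] bij_betw_def)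

lemma ev_mono: "i < j \<Longrightarrow> ev i < ev j"
  unfolding ev_def by (rule enumerate_mono[OF _ inf(2)])

lemma ev_0: "ev 0 = 0"
  unfolding ev_def enumerate_0 using zero_nonodd by (rule Least_eq_0)

lemma ev_pos: "l \<ge> 1 \<Longrightarrow> ev l \<ge> 1"
  using ev_mono[of 0 l] ev_0 by simp

lemma od_1: "od 1 = 1"
proof -
  have "(LEAST i. i \<in> odd_indices f T) = 1"
  proof (rule Least_equality)
    show "1 \<in> odd_indices f T" by (rule one_odd)
    fix y assume "y \<in> odd_indices f T"
    then have "y \<notin> nonodd_indices f T" unfolding odd_indices_compl by simp
    then have "y \<noteq> 0" using zero_nonodd by metis
    then show "1 \<le> y" by simp
  qed
  then show ?thesis by (simp add: od_def enumerate_0)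
qed

lemma nonodd_upto_ev:
  assumes "r = card (nonodd_upto f T k) - 1"
  shows "nonodd_upto f T k = ev ` {..r}" "card (nonodd_upto f T k) = Suc r"
proof -
  have "0 \<in> nonodd_upto f T k" using zero_nonodd by (simp add: nonodd_upto_eq)
  then have "card (nonodd_upto f T k) > 0" by (auto simp: card_gt_0_iff nonodd_upto_eq)
  then show *: "card (nonodd_upto f T k) = Suc r" using assms by simp
  show "nonodd_upto f T k = ev ` {..r}"
    using initial_segment_eq_enumerate[OF inf(2), of k] *
    unfolding nonodd_upto_eq ev_def[abs_def] by (simp add: lessThan_Suc_atMost)
qed

lemma odd_upto_od: "{j \<in> odd_indices f T. j \<le> m} = od ` {1..k1}"
proof -
  have "{j \<in> odd_indices f T. j \<le> m} = {..m} - nonodd_upto f T m"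
    using odd_indices_compl by (auto simp: nonodd_upto_eq)
  moreover have "nonodd_upto f T m \<subseteq> {..m}" by (auto simp: nonodd_upto_eq)
  ultimately have c: "card {j \<in> odd_indices f T. j \<le> m} = k1"
    using nonodd_upto_ev(2)[OF m1(1)] by (simp add: card_Diff_subset finite_subset k1_def)
  have "{j \<in> odd_indices f T. j \<le> m} = enumerate (odd_indices f T) ` {..<k1}"
    using initial_segment_eq_enumerate[OF inf(1), of m] c by simp
  also have "\<dots> = od ` {1..k1}"
    unfolding od_def[abs_def] by (force simp: image_iff intro: bexI[of _ "Suc _"])
  finally show ?thesis .
qed

lemma inj_od: "inj_on od {1..k}"
proof (rule inj_onI)
  fix i j assume ij: "i \<in> {1..k}" "j \<in> {1..k}" "od i = od j"
  have "inj (enumerate (odd_indices f T))" using bij_enumerate[OF inf(1)] by (simp add: bij_betw_def)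
  then have "i - 1 = j - 1" using ij(3) unfolding od_def by (rule injD)
  then show "i = j" using ij by auto
qed

lemma k1_pos: "k1 \<ge> 1"
proof -
  have "1 \<in> {j \<in> odd_indices f T. j \<le> m}" using one_odd m_pos by simp
  then show ?thesis unfolding odd_upto_od by auto
qed

lemma L_ge: "L \<ge> m1" "L \<ge> 1" "L \<ge> k1 + n1 - 1"
  using m1(2) by (auto simp: L_def)

lemma \<phi>_continuous: "continuous_on {-T..T} (\<phi> l)"
  unfolding \<phi>_def by (rule continuous_on_even_part[OF f])

lemma \<phi>_even: "\<phi> l (-t) = \<phi> l t"
  by (simp add: \<phi>_def even_part_minus)

lemma \<phi>_mean_zero: "l \<ge> 1 \<Longrightarrow> integral {-T..T} (\<phi> l) = 0"
  unfolding \<phi>_def using integral_even_part[OF f] T mean_zero[OF ev_pos] by simp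

lemma sorted_list_nonodd_upto: "sorted_list_of_set (nonodd_upto f T (ev k)) = map ev [0..<Suc k]"
proof -
  have "nonodd_upto f T (ev k) = ev ` {..k}"
  proof -
    have "ev l \<le> ev k \<longleftrightarrow> l \<le> k" for l using ev_mono by (metis linorder_not_less nat_neq_iff order_less_imp_le order_refl)
    moreover have "range ev = nonodd_indices f T"
      using bij_enumerate[OF inf(2)] by (simp add: ev_def[abs_def] bij_betw_def)
    ultimately have "x \<in> nonodd_indices f T \<and> x \<le> ev k \<longleftrightarrow> (\<exists>l\<le>k. x = ev l)" for x
      by (metis rangeE rangeI)
    then show ?thesis unfolding nonodd_upto_eq by auto
  qed
  also have "\<dots> = set (map ev [0..<Suc k])"
    by (simp only: set_map set_upt atLeast0LessThan lessThan_Suc_atMost)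
  finally have "sorted_list_of_set (nonodd_upto f T (ev k)) = sorted_list_of_set (set (map ev [0..<Suc k]))" by simp
  also have "\<dots> = map ev [0..<Suc k]"
  proof -
    have "sorted_wrt (<) (map ev [0..<Suc k])"
      unfolding sorted_wrt_map by (rule sorted_wrt_mono_rel[OF _ sorted_wrt_upt]) (auto intro: ev_mono)
    then show ?thesis by (metis sorted_list_of_set.idem_if_sorted_distinct strict_sorted_iff)
  qed
  finally show ?thesis .
qed

sublocale abel_chebyshev f T p q n m \<phi> L
proof
  show "L \<ge> 1" by (rule L_ge)
  show "continuous_on {0..T} (\<phi> l)" for l using T by (intro continuous_on_subset[OF \<phi>_continuous]) auto
  show "0 < \<phi> 0 t" if "t \<in> {0..T}" for t
    using f0_pos[of t] f0_pos[of "-t"] that by (auto simp: \<phi>_def ev_0 even_part_def)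
  fix c :: "nat \<Rightarrow> real" assume c: "\<exists>l\<le>L. c l \<noteq> 0"
  let ?gs = "map (\<lambda>i. even_part (f i)) (sorted_list_of_set (nonodd_upto f T (ev L)))"
  have gs: "?gs ! i = \<phi> i" if "i \<le> L" for i
    unfolding sorted_list_nonodd_upto using that by (simp add: \<phi>_def del: upt_Suc)
  \<comment> \<open>The hypothesis is indexed by original indices, so the first L + 1 non-odd
    functions are addressed through r = \<open>ev L\<close>.\<close>
  have "CT_system ?gs {0<..<T}" by (rule CT[OF ev_pos[OF L_ge(2)]])
  moreover have "L < length ?gs" unfolding sorted_list_nonodd_upto by simp
  ultimately have "finite {t \<in> {0<..<T}. (\<Sum>i\<le>L. c i * (?gs ! i) t) = 0} \<and>
      card {t \<in> {0<..<T}. (\<Sum>i\<le>L. c i * (?gs ! i) t) = 0} \<le> L"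
    using c unfolding CT_system_def by blast
  moreover have "(\<Sum>i\<le>L. c i * (?gs ! i) t) = (\<Sum>l\<le>L. c l * \<phi> l t)" for t
    by (intro sum.cong) (simp_all only: gs atMost_iff)
  ultimately show "finite {t \<in> {0<..<T}. (\<Sum>l\<le>L. c l * \<phi> l t) = 0} \<and>
      card {t \<in> {0<..<T}. (\<Sum>l\<le>L. c l * \<phi> l t) = 0} \<le> L" by simp
qed

lemma sum_nonodd:
  assumes "r = card (nonodd_upto f T k) - 1" "t \<in> {-T..T}"
  shows "(\<Sum>j=0..k. c j * even_part (f j) t) = (\<Sum>l\<le>r. c (ev l) * \<phi> l t)"
proof -
  have "(\<Sum>j=0..k. c j * even_part (f j) t) = (\<Sum>j\<in>nonodd_upto f T k. c j * even_part (f j) t)"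
    using assms(2) by (intro sum.mono_neutral_right) (auto simp: nonodd_upto_def nonodd_indices_def)
  also have "\<dots> = (\<Sum>l\<le>r. c (ev l) * \<phi> l t)"
    unfolding nonodd_upto_ev(1)[OF assms(1)] using inj_ev
    by (subst sum.reindex) (auto simp: \<phi>_def inj_on_def inj_def)
  finally show ?thesis .
qed

lemma even_part_Q: "t \<in> {-T..T} \<Longrightarrow> even_part (Q_pert f m \<mu> i) t = (\<Sum>l\<le>m1. snd \<mu> i (ev l) * \<phi> l t)"
  unfolding Q_pert_def[abs_def] even_part_sum by (rule sum_nonodd[OF m1(1)])

lemma even_part_P: "t \<in> {-T..T} \<Longrightarrow> even_part (P_pert f n \<mu> i) t = (\<Sum>l\<le>n1. fst \<mu> i (ev l) * \<phi> l t)"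
  unfolding P_pert_def[abs_def] even_part_sum by (rule sum_nonodd[OF n1(1)])

lemma N_cong: "(\<And>t. t \<in> {0..T} \<Longrightarrow> G t = H t) \<Longrightarrow> N G \<gamma> s = N H \<gamma> s"
  unfolding N_def by (intro integral_cong) simp

definition c0 :: real where "c0 = integral {-T..T} (f 0)"

lemma c0_pos: "c0 > 0"
proof -
  have "0 \<le> c0" unfolding c0_def using f0_pos f T
    by (intro integral_nonneg integrable_continuous_interval) (auto intro: less_imp_le)
  moreover have "c0 \<noteq> 0"
  proof
    assume "c0 = 0"
    then have "f 0 0 = 0"
      using integral_eq_0_iff[OF f[of 0] _ less_imp_le[OF f0_pos]] T unfolding c0_def by auto
    then show False using f0_pos[of 0] T by simp
  qed
  ultimately show ?thesis by simp
qed

lemma melnikov_1_comb: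
  assumes "\<rho> \<in> J"
  shows "melnikov f T p q n m 1 \<mu> \<rho> = u (fst \<mu> 1 0 * c0) (\<lambda>l. if l \<le> m1 then 2 * snd \<mu> 1 (ev l) else 0) \<rho>"
proof -
  have "2 * even_part (Q_pert f m \<mu> 1) t = comb (\<lambda>l. if l \<le> m1 then 2 * snd \<mu> 1 (ev l) else 0) t"
    if t: "t \<in> {0..T}" for t
  proof -
    have "comb (\<lambda>l. if l \<le> m1 then 2 * snd \<mu> 1 (ev l) else 0) t = (\<Sum>l\<le>m1. 2 * snd \<mu> 1 (ev l) * \<phi> l t)"
      unfolding comb_def using L_ge(1) by (intro sum.mono_neutral_cong_right) auto
    then show ?thesis using even_part_Q[of t \<mu> 1] t by (simp add: sum_distrib_left mult.assoc)
  qed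
  then have "N (\<lambda>t. 2 * even_part (Q_pert f m \<mu> 1) t) \<alpha> (\<sigma> \<rho>) =
      N (comb (\<lambda>l. if l \<le> m1 then 2 * snd \<mu> 1 (ev l) else 0)) \<alpha> (\<sigma> \<rho>)" by (rule N_cong)
  then show ?thesis
    unfolding melnikov_1[OF assms] u_def c0_def by (simp only: mult.commute)
qed

text \<open>A nontrivial combination has at most L + 1 positive zeros, whereas \<open>J\<close>
  contains L + 2 positive points; an identically vanishing function is therefore trivial in its
  coefficients, and c0 > 0 returns the coefficient of \<open>f 0\<close>.\<close>

lemma melnikov_1_zero_iff:
  "(\<forall>\<rho>\<in>J. melnikov f T p q n m 1 \<mu> \<rho> = 0) \<longleftrightarrow> fst \<mu> 1 0 = 0 \<and> (\<forall>l\<le>m1. snd \<mu> 1 (ev l) = 0)"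
proof
  let ?c = "\<lambda>l. if l \<le> m1 then 2 * snd \<mu> 1 (ev l) else 0"
  assume 0: "\<forall>\<rho>\<in>J. melnikov f T p q n m 1 \<mu> \<rho> = 0"
  have "\<not> (fst \<mu> 1 0 * c0 \<noteq> 0 \<or> (\<exists>l\<le>L. ?c l \<noteq> 0))"
  proof
    assume nt: "fst \<mu> 1 0 * c0 \<noteq> 0 \<or> (\<exists>l\<le>L. ?c l \<noteq> 0)"
    obtain X where X: "finite X" "card X = L + 2" "X \<subseteq> J \<inter> {0<..}" by (rule positive_points)
    have "zeros_bounded (u (fst \<mu> 1 0 * c0) ?c) (J \<inter> {0<..}) (L + 1)"
      by (rule bound_one_side[OF nt]) auto
    then have "sum (\<lambda>_. 1) X \<le> L + 1"
    proof (rule zeros_boundedD[OF _ X(1,3)])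
      fix x j assume x: "x \<in> X" and j: "j < (1::nat)"
      have "x \<in> J" using x X(3) by blast
      then have "u (fst \<mu> 1 0 * c0) ?c x = 0" using 0 melnikov_1_comb[of x \<mu>] by simp
      then show "(deriv ^^ j) (u (fst \<mu> 1 0 * c0) ?c) x = 0" using j by simp
    qed
    then show False using X by simp
  qed
  then have nt: "fst \<mu> 1 0 * c0 = 0" "\<And>l. l \<le> L \<Longrightarrow> ?c l = 0" by blast+
  have "snd \<mu> 1 (ev l) = 0" if "l \<le> m1" for l using nt(2)[of l] L_ge(1) that by simp
  then show "fst \<mu> 1 0 = 0 \<and> (\<forall>l\<le>m1. snd \<mu> 1 (ev l) = 0)" using nt(1) c0_pos by simp
next
  assume 0: "fst \<mu> 1 0 = 0 \<and> (\<forall>l\<le>m1. snd \<mu> 1 (ev l) = 0)"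
  show "\<forall>\<rho>\<in>J. melnikov f T p q n m 1 \<mu> \<rho> = 0"
  proof
    fix \<rho> assume \<rho>: "\<rho> \<in> J"
    then have "N (comb (\<lambda>l. if l \<le> m1 then 2 * snd \<mu> 1 (ev l) else 0)) \<alpha> (\<sigma> \<rho>) = 0"
      using 0 by (subst N_comb) (auto simp: J_iff intro!: sum.neutral)
    then show "melnikov f T p q n m 1 \<mu> \<rho> = 0"
      using 0 unfolding melnikov_1_comb[OF \<rho>] u_def by simp
  qed
qed

text \<open>If the top coefficient were zero, the product would already lie in the preceding space
  of the filtration. Padding with zeros beyond k + l - 1 allows all products to be summed over one
  range.\<close>

lemma product_coefficients:
  obtains C :: "nat \<Rightarrow> nat \<Rightarrow> nat \<Rightarrow> real" where
    "\<And>k l t. k \<ge> 1 \<Longrightarrow> l \<ge> 1 \<Longrightarrow> t \<in> {-T..T} \<Longrightarrow>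
       integral {-T..t} (\<phi> l) * f (od k) t = (\<Sum>i=1..k + l - 1. C k l i * (integral {-T..t} (\<phi> i) * f 1 t))"
    "\<And>k l i. k + l - 1 < i \<Longrightarrow> C k l i = 0"
    "\<And>k l. k \<ge> 1 \<Longrightarrow> l \<ge> 1 \<Longrightarrow> C k l (k + l - 1) \<noteq> 0"
proof -
  have Fe: "F_tilde_even f T l t = integral {-T..t} (\<phi> l)" for l t
    by (simp add: F_tilde_even_def \<phi>_def ev_def)
  have fo: "f_tilde_odd f T k = f (od k)" for k by (simp add: f_tilde_odd_def od_def)
  have "\<exists>c. \<forall>t\<in>{-T..T}. integral {-T..t} (\<phi> l) * f (od k) t = (\<Sum>i=1..k + l - 1. c i * (integral {-T..t} (\<phi> i) * f 1 t))"
    if "k \<ge> 1" "l \<ge> 1" for k l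
    using product[OF that] unfolding B_space_def Fe fo od_1 by auto
  note ex = someI_ex[OF this]
  define C where "C k l = (SOME c. \<forall>t\<in>{-T..T}. integral {-T..t} (\<phi> l) * f (od k) t =
      (\<Sum>i=1..k + l - 1. c i * (integral {-T..t} (\<phi> i) * f 1 t)))" for k l
  have C: "integral {-T..t} (\<phi> l) * f (od k) t = (\<Sum>i=1..k + l - 1. C k l i * (integral {-T..t} (\<phi> i) * f 1 t))"
    if "k \<ge> 1" "l \<ge> 1" "t \<in> {-T..T}" for k l t
    using ex[OF that(1,2)] that(3) unfolding C_def by blast
  define C' where "C' k l i = (if i \<le> k + l - 1 then C k l i else 0)" for k l i
  have "C k l (k + l - 1) \<noteq> 0" if kl: "k \<ge> 1" "l \<ge> 1" for k l
  proof
    assume 0: "C k l (k + l - 1) = 0"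
    have "k + l - 1 = Suc (k + l - 2)" using kl by simp
    then have "(\<Sum>i=1..k + l - 1. C k l i * x i) = (\<Sum>i=1..k + l - 2. C k l i * x i)" for x :: "nat \<Rightarrow> real"
      using 0 by simp
    then have "(\<lambda>t. F_tilde_even f T l t * f_tilde_odd f T k t) \<in> B_space f T (k + l - 2)"
      unfolding B_space_def Fe fo od_1 using C[OF kl] by (intro CollectI exI[of _ "C k l"]) auto
    then show False using product[OF kl] by simp
  qed
  then show ?thesis
    using C by (intro that[of C']) (auto simp: C'_def)
qed

text \<open>Vanishing of the first order strips the first-order Q down to odd functions and removes
  \<phi> 0 from the even part of the first-order P. What is left are products covered by
  \<open>C\<close>; the minus sign stems from the integration by parts.\<close>

lemma melnikov_2_comb:
  fixes C :: "nat \<Rightarrow> nat \<Rightarrow> nat \<Rightarrow> real"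
  assumes C: "\<And>k l t. k \<ge> 1 \<Longrightarrow> l \<ge> 1 \<Longrightarrow> t \<in> {-T..T} \<Longrightarrow>
       integral {-T..t} (\<phi> l) * f (od k) t = (\<Sum>i=1..k + l - 1. C k l i * (integral {-T..t} (\<phi> i) * f 1 t))"
    "\<And>k l i. k + l - 1 < i \<Longrightarrow> C k l i = 0"
    and \<mu>: "fst \<mu> 1 0 = 0" "\<And>l. l \<le> m1 \<Longrightarrow> snd \<mu> 1 (ev l) = 0" and \<rho>: "\<rho> \<in> J"
  defines "D \<equiv> \<lambda>i. (\<Sum>l=1..n1. \<Sum>k=1..k1. fst \<mu> 1 (ev l) * snd \<mu> 1 (od k) * C k l i)"
  shows "melnikov f T p q n m 2 \<mu> \<rho> = u (fst \<mu> 2 0 * c0)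
    (\<lambda>l. (if l \<le> m1 then 2 * snd \<mu> 2 (ev l) else 0) - (if 1 \<le> l then 2 * D l else 0)) \<rho>"
proof -
  let ?F = "\<lambda>i t. integral {-T..t} (\<phi> i)"
  have Q_odd: "even_part (Q_pert f m \<mu> 1) t = 0" if "t \<in> {-T..T}" for t
    using even_part_Q[OF that, of \<mu> 1] \<mu>(2) by simp
  have Q: "Q_pert f m \<mu> 1 t = (\<Sum>k=1..k1. snd \<mu> 1 (od k) * f (od k) t)" for t
  proof -
    have "Q_pert f m \<mu> 1 t = (\<Sum>j\<in>{j \<in> odd_indices f T. j \<le> m}. snd \<mu> 1 j * f j t)"
      unfolding Q_pert_def
    proof (intro sum.mono_neutral_right ballI)
      fix j assume "j \<in> {0..m} - {j \<in> odd_indices f T. j \<le> m}"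
      then have "j \<in> nonodd_upto f T m" using odd_indices_compl by (auto simp: nonodd_upto_eq)
      then show "snd \<mu> 1 j * f j t = 0" using \<mu>(2) unfolding nonodd_upto_ev(1)[OF m1(1)] by auto
    qed auto
    also have "\<dots> = (\<Sum>k=1..k1. snd \<mu> 1 (od k) * f (od k) t)"
      unfolding odd_upto_od by (subst sum.reindex[OF inj_od]) simp
    finally show ?thesis .
  qed
  have P: "integral {-T..t} (even_part (P_pert f n \<mu> 1)) = (\<Sum>l=1..n1. fst \<mu> 1 (ev l) * ?F l t)" if t: "t \<in> {-T..T}" for t
  proof -
    have "integral {-T..t} (even_part (P_pert f n \<mu> 1)) = integral {-T..t} (\<lambda>x. \<Sum>l\<in>{1..n1}. fst \<mu> 1 (ev l) * \<phi> l x)"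
    proof (rule integral_cong)
      fix x assume "x \<in> {-T..t}"
      then have "even_part (P_pert f n \<mu> 1) x = (\<Sum>l\<le>n1. fst \<mu> 1 (ev l) * \<phi> l x)" using t by (intro even_part_P) auto
      also have "\<dots> = (\<Sum>l\<in>{1..n1}. fst \<mu> 1 (ev l) * \<phi> l x)"
      proof (intro sum.mono_neutral_right ballI)
        fix l assume "l \<in> {..n1} - {1..n1}"
        then have "l = 0" by auto
        then show "fst \<mu> 1 (ev l) * \<phi> l x = 0" using \<mu>(1) ev_0 by simp
      qed auto
      finally show "even_part (P_pert f n \<mu> 1) x = (\<Sum>l\<in>{1..n1}. fst \<mu> 1 (ev l) * \<phi> l x)" .
    qed
    also have "\<dots> = (\<Sum>l=1..n1. fst \<mu> 1 (ev l) * ?F l t)"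
      using t by (subst integral_sum)
        (auto intro!: integrable_continuous_interval continuous_on_mult_left continuous_on_subset[OF \<phi>_continuous])
    finally show ?thesis .
  qed
  have ext: "?F l t * f (od k) t = (\<Sum>i=1..L. C k l i * (?F i t * f 1 t))"
    if "l \<in> {1..n1}" "k \<in> {1..k1}" "t \<in> {-T..T}" for k l t
  proof -
    have "(\<Sum>i=1..L. C k l i * (?F i t * f 1 t)) = (\<Sum>i=1..k + l - 1. C k l i * (?F i t * f 1 t))"
      using that L_ge(3) C(2) by (intro sum.mono_neutral_right) auto
    then show ?thesis using C(1) that by simp
  qed
  have prod: "integral {-T..t} (even_part (P_pert f n \<mu> 1)) * Q_pert f m \<mu> 1 t = (\<Sum>i\<in>{1..L}. D i * (?F i t * f 1 t))"
    if t: "t \<in> {-T..T}" for t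
  proof -
    have "integral {-T..t} (even_part (P_pert f n \<mu> 1)) * Q_pert f m \<mu> 1 t =
        (\<Sum>l=1..n1. \<Sum>k=1..k1. fst \<mu> 1 (ev l) * snd \<mu> 1 (od k) * (?F l t * f (od k) t))"
      unfolding P[OF t] Q sum_product by (intro sum.cong refl) (simp add: mult_ac)
    also have "\<dots> = (\<Sum>l=1..n1. \<Sum>k=1..k1. \<Sum>i=1..L. fst \<mu> 1 (ev l) * snd \<mu> 1 (od k) * (C k l i * (?F i t * f 1 t)))"
      by (intro sum.cong refl) (simp only: ext[OF _ _ t] sum_distrib_left)
    also have "\<dots> = (\<Sum>l=1..n1. \<Sum>i=1..L. \<Sum>k=1..k1. fst \<mu> 1 (ev l) * snd \<mu> 1 (od k) * (C k l i * (?F i t * f 1 t)))"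
      by (intro sum.cong refl sum.swap)
    also have "\<dots> = (\<Sum>i=1..L. \<Sum>l=1..n1. \<Sum>k=1..k1. fst \<mu> 1 (ev l) * snd \<mu> 1 (od k) * (C k l i * (?F i t * f 1 t)))"
      by (rule sum.swap)
    also have "\<dots> = (\<Sum>i\<in>{1..L}. D i * (?F i t * f 1 t))"
      unfolding D_def by (simp add: sum_distrib_right mult.assoc)
    finally show ?thesis .
  qed
  have "melnikov f T p q n m 2 \<mu> \<rho> = \<rho> ^ p * (fst \<mu> 2 0 * integral {-T..T} (f 0)) +
    \<rho> ^ q * N (\<lambda>t. 2 * even_part (Q_pert f m \<mu> 2) t - 2 * (\<Sum>i\<in>{1..L}. D i * \<phi> i t)) \<alpha> (\<sigma> \<rho>)"
    by (rule melnikov_2[OF \<rho> \<mu>(1) Q_odd]) (use \<phi>_continuous \<phi>_mean_zero \<phi>_even prod in auto)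
  also have "N (\<lambda>t. 2 * even_part (Q_pert f m \<mu> 2) t - 2 * (\<Sum>i\<in>{1..L}. D i * \<phi> i t)) \<alpha> (\<sigma> \<rho>) =
    N (comb (\<lambda>l. (if l \<le> m1 then 2 * snd \<mu> 2 (ev l) else 0) - (if 1 \<le> l then 2 * D l else 0))) \<alpha> (\<sigma> \<rho>)"
  proof (rule N_cong)
    fix t assume t: "t \<in> {0..T}"
    have "comb (\<lambda>l. (if l \<le> m1 then 2 * snd \<mu> 2 (ev l) else 0) - (if 1 \<le> l then 2 * D l else 0)) t =
      (\<Sum>l\<le>L. (if l \<le> m1 then 2 * snd \<mu> 2 (ev l) else 0) * \<phi> l t) - (\<Sum>l\<le>L. (if 1 \<le> l then 2 * D l else 0) * \<phi> l t)"
      unfolding comb_def by (simp only: left_diff_distrib sum_subtractf)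
    also have "(\<Sum>l\<le>L. (if l \<le> m1 then 2 * snd \<mu> 2 (ev l) else 0) * \<phi> l t) = (\<Sum>l\<le>m1. 2 * snd \<mu> 2 (ev l) * \<phi> l t)"
      using L_ge(1) by (intro sum.mono_neutral_cong_right) auto
    also have "(\<Sum>l\<le>L. (if 1 \<le> l then 2 * D l else 0) * \<phi> l t) = (\<Sum>l\<in>{1..L}. 2 * D l * \<phi> l t)"
      by (intro sum.mono_neutral_cong_right) auto
    finally show "2 * even_part (Q_pert f m \<mu> 2) t - 2 * (\<Sum>i\<in>{1..L}. D i * \<phi> i t) =
      comb (\<lambda>l. (if l \<le> m1 then 2 * snd \<mu> 2 (ev l) else 0) - (if 1 \<le> l then 2 * D l else 0)) t"
      using even_part_Q[of t \<mu> 2] t by (simp add: sum_distrib_left mult.assoc)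
  qed
  finally show ?thesis by (simp add: u_def c0_def mult.commute)
qed

lemma melnikov_2_form:
  assumes "\<forall>\<rho>\<in>J. melnikov f T p q n m 1 \<mu> \<rho> = 0"
  shows "\<exists>A c. \<forall>\<rho>\<in>J. melnikov f T p q n m 2 \<mu> \<rho> = u A c \<rho>"
proof -
  obtain C :: "nat \<Rightarrow> nat \<Rightarrow> nat \<Rightarrow> real" where
    C: "\<And>k l t. k \<ge> 1 \<Longrightarrow> l \<ge> 1 \<Longrightarrow> t \<in> {-T..T} \<Longrightarrow>
       integral {-T..t} (\<phi> l) * f (od k) t = (\<Sum>i=1..k + l - 1. C k l i * (integral {-T..t} (\<phi> i) * f 1 t))"
    "\<And>k l i. k + l - 1 < i \<Longrightarrow> C k l i = 0"
    "\<And>k l. k \<ge> 1 \<Longrightarrow> l \<ge> 1 \<Longrightarrow> C k l (k + l - 1) \<noteq> 0"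
    by (fact product_coefficients)
  have \<mu>: "fst \<mu> 1 0 = 0" "\<And>l. l \<le> m1 \<Longrightarrow> snd \<mu> 1 (ev l) = 0"
    using assms unfolding melnikov_1_zero_iff by auto
  show ?thesis by (intro exI ballI) (rule melnikov_2_comb[where C = C, OF C(1,2) \<mu>])
qed

text \<open>The products \<open>a\<^sub>l b\<^sub>k\<close> enter \<open>M\<^sub>2\<close> through a triangular system as soon as only one \<open>b\<^sub>k\<close>
  (or only one \<open>a\<^sub>l\<close>) is nonzero; hypothesis (c) says that one of the two choices reaches all
  the coefficients that are not already controlled by \<open>Q\<^sub>2\<close>.\<close>

lemma product_coefficients_onto:
  fixes C :: "nat \<Rightarrow> nat \<Rightarrow> nat \<Rightarrow> real" and \<tau> :: "nat \<Rightarrow> real"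
  assumes C0: "\<And>k l i. k + l - 1 < i \<Longrightarrow> C k l i = 0"
    and C1: "\<And>k l. k \<ge> 1 \<Longrightarrow> l \<ge> 1 \<Longrightarrow> C k l (k + l - 1) \<noteq> 0"
  shows "\<exists>a b. \<forall>i. m1 < i \<and> i \<le> L \<longrightarrow> (\<Sum>l=1..n1. \<Sum>k=1..k1. a l * b k * C k l i) = \<tau> i"
proof (cases "L = m1")
  case True
  then show ?thesis by simp
next
  case False
  then have Leq: "L = k1 + n1 - 1" by (auto simp: L_def)
  have k1: "int k1 = int m - int m1" using k1_pos by (simp add: k1_def)
  \<comment> \<open>With b concentrated at \<open>k1\<close> the products reach the indices k1, ...,
    L; with a concentrated at \<open>n1\<close> they reach n1, ..., L. The inequality between
    \<open>m1\<close> and the minimum says that one of these ranges contains everything above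
    \<open>m1\<close>.\<close>
  consider "k1 - 1 \<le> m1" | "n1 - 1 \<le> m1" using min_le k1 by linarith
  then show ?thesis
  proof cases
    case 1
    obtain a where a: "\<forall>j\<in>{1..n1}. (\<Sum>l=1..n1. a l * C k1 l (k1 + j - 1)) = \<tau> (k1 + j - 1)"
      using triangular_system_solvable[of n1 "\<lambda>l j. C k1 l (k1 + j - 1)" "\<lambda>j. \<tau> (k1 + j - 1)"] C0 C1 k1_pos
      by auto
    have sol: "(\<Sum>l=1..n1. \<Sum>k=1..k1. a l * (if k = k1 then 1 else 0) * C k l i) = \<tau> i" if i: "m1 < i" "i \<le> L" for i
    proof -
      have "(\<Sum>k=1..k1. a l * (if k = k1 then 1 else 0) * C k l i) = a l * C k1 l i" for l
      proof -
        have "(\<Sum>k=1..k1. a l * (if k = k1 then 1 else 0) * C k l i) = (\<Sum>k\<in>{k1}. a l * C k l i)"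
          using k1_pos by (intro sum.mono_neutral_cong_right) auto
        then show ?thesis by simp
      qed
      moreover have j: "i - k1 + 1 \<in> {1..n1}" "k1 + (i - k1 + 1) - 1 = i" using i 1 Leq k1_pos n1(2) by auto
      have "(\<Sum>l=1..n1. a l * C k1 l i) = \<tau> i" using a[rule_format, OF j(1)] unfolding j(2) .
      ultimately show ?thesis by simp
    qed
    show ?thesis
      by (intro exI[of _ a] exI[of _ "\<lambda>k. if k = k1 then 1 else 0"] allI impI, elim conjE, rule sol)
  next
    case 2
    have "\<exists>b. \<forall>j\<in>{1..k1}. (\<Sum>k=1..k1. b k * C k n1 (n1 + j - 1)) = \<tau> (n1 + j - 1)"
    proof (rule triangular_system_solvable)
      show "C k n1 (n1 + k - 1) \<noteq> 0" if "k \<in> {1..k1}" for k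
        using C1[of k n1] that n1(2) by (simp add: add.commute)
      show "C k n1 (n1 + j - 1) = 0" if "k \<in> {1..k1}" "k < j" for k j
        by (rule C0) (use that n1(2) in auto)
    qed
    then obtain b where b: "\<forall>j\<in>{1..k1}. (\<Sum>k=1..k1. b k * C k n1 (n1 + j - 1)) = \<tau> (n1 + j - 1)" by blast
    have sol: "(\<Sum>l=1..n1. \<Sum>k=1..k1. (if l = n1 then 1 else 0) * b k * C k l i) = \<tau> i" if i: "m1 < i" "i \<le> L" for i
    proof -
      have "(\<Sum>l=1..n1. \<Sum>k=1..k1. (if l = n1 then 1 else 0) * b k * C k l i) = (\<Sum>l\<in>{n1}. \<Sum>k=1..k1. b k * C k l i)"
        using n1(2) by (intro sum.mono_neutral_cong_right) auto
      moreover have j: "i - n1 + 1 \<in> {1..k1}" "n1 + (i - n1 + 1) - 1 = i" using i 2 Leq k1_pos n1(2) by auto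
      have "(\<Sum>k=1..k1. b k * C k n1 i) = \<tau> i" using b[rule_format, OF j(1)] unfolding j(2) .
      ultimately show ?thesis by simp
    qed
    show ?thesis
      by (intro exI[of _ "\<lambda>l. if l = n1 then 1 else 0"] exI[of _ b] allI impI, elim conjE, rule sol)
  qed
qed

lemma melnikov_2_realize:
  "\<exists>\<mu>. (\<forall>\<rho>\<in>J. melnikov f T p q n m 1 \<mu> \<rho> = 0) \<and> (\<forall>\<rho>\<in>J. melnikov f T p q n m 2 \<mu> \<rho> = u A c \<rho>)"
proof -
  obtain C :: "nat \<Rightarrow> nat \<Rightarrow> nat \<Rightarrow> real" where
    C: "\<And>k l t. k \<ge> 1 \<Longrightarrow> l \<ge> 1 \<Longrightarrow> t \<in> {-T..T} \<Longrightarrow>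
       integral {-T..t} (\<phi> l) * f (od k) t = (\<Sum>i=1..k + l - 1. C k l i * (integral {-T..t} (\<phi> i) * f 1 t))"
    "\<And>k l i. k + l - 1 < i \<Longrightarrow> C k l i = 0"
    "\<And>k l. k \<ge> 1 \<Longrightarrow> l \<ge> 1 \<Longrightarrow> C k l (k + l - 1) \<noteq> 0"
    by (fact product_coefficients)
  obtain a b where ab: "\<And>i. m1 < i \<Longrightarrow> i \<le> L \<Longrightarrow> (\<Sum>l=1..n1. \<Sum>k=1..k1. a l * b k * C k l i) = - c i / 2"
    using product_coefficients_onto[where C = C and \<tau> = "\<lambda>i. - c i / 2", OF C(2,3)] by blast
  define D where "D i = (\<Sum>l=1..n1. \<Sum>k=1..k1. a l * b k * C k l i)" for i
  \<comment> \<open>Up to \<open>m1\<close> the second-order Q cancels the contribution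
    \<open>D\<close> of the products and installs \<open>c\<close>; above \<open>m1\<close> the
    products alone give -2 D = c. The first-order P takes \<open>a\<close> at the non-odd indices
    from \<open>ev 1\<close> on and the first-order Q takes \<open>b\<close> at odd ones, which
    keeps the first Melnikov function zero.\<close>
  define \<mu> :: params where "\<mu> =
    (\<lambda>i j. if i = 1 then (if \<exists>l\<ge>1. j = ev l then a (inv ev j) else 0) else A / c0,
     \<lambda>i j. if i = 1 then (if \<exists>k\<in>{1..k1}. j = od k then b (the_inv_into {1..k1} od j) else 0)
       else c (inv ev j) / 2 + (if 1 \<le> inv ev j then D (inv ev j) else 0))"
  have ev_od: "ev l \<noteq> od k" for l k
  proof -
    have "ev l \<in> nonodd_indices f T" unfolding ev_def by (rule enumerate_in_set[OF inf(2)])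
    moreover have "od k \<in> odd_indices f T" unfolding od_def by (rule enumerate_in_set[OF inf(1)])
    ultimately show ?thesis using odd_indices_compl by auto
  qed
  have inv: "inv ev (ev l) = l" for l using inj_ev by simp
  have 1: "fst \<mu> 1 0 = 0"
    using ev_pos by (fastforce simp: \<mu>_def)
  have 2: "fst \<mu> 1 (ev l) = a l" if "l \<ge> 1" for l using that inv by (auto simp: \<mu>_def)
  have 3: "snd \<mu> 1 (ev l) = 0" for l using ev_od by (auto simp: \<mu>_def)
  have 4: "snd \<mu> 1 (od k) = b k" if "k \<in> {1..k1}" for k
    using that the_inv_into_f_f[OF inj_od that] by (auto simp: \<mu>_def)
  have 5: "snd \<mu> 2 (ev l) = c l / 2 + (if 1 \<le> l then D l else 0)" for l
    using inv by (simp add: \<mu>_def)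
  have 6: "fst \<mu> 2 0 * c0 = A" using c0_pos by (simp add: \<mu>_def)
  have D: "(\<Sum>l=1..n1. \<Sum>k=1..k1. fst \<mu> 1 (ev l) * snd \<mu> 1 (od k) * C k l i) = D i" for i
    unfolding D_def using 2 4 by (intro sum.cong refl) auto
  have m1: "\<forall>\<rho>\<in>J. melnikov f T p q n m 1 \<mu> \<rho> = 0" unfolding melnikov_1_zero_iff using 1 3 by simp
  moreover have "melnikov f T p q n m 2 \<mu> \<rho> = u A c \<rho>" if \<rho>: "\<rho> \<in> J" for \<rho>
  proof -
    have "melnikov f T p q n m 2 \<mu> \<rho> =
      u A (\<lambda>l. (if l \<le> m1 then 2 * snd \<mu> 2 (ev l) else 0) - (if 1 \<le> l then 2 * D l else 0)) \<rho>"
      using melnikov_2_comb[where C = C, OF C(1,2) 1 3 \<rho>] unfolding D 6 .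
    also have "\<dots> = u A c \<rho>"
    proof -
      have "comb (\<lambda>l. (if l \<le> m1 then 2 * snd \<mu> 2 (ev l) else 0) - (if 1 \<le> l then 2 * D l else 0)) = comb c"
        unfolding comb_def
      proof (intro ext sum.cong refl)
        fix t l assume l: "l \<in> {..L}"
        have "D l = - c l / 2" if "\<not> l \<le> m1" using ab[of l] l that by (simp add: D_def)
        then show "((if l \<le> m1 then 2 * snd \<mu> 2 (ev l) else 0) - (if 1 \<le> l then 2 * D l else 0)) * \<phi> l t = c l * \<phi> l t"
          by (cases "l \<le> m1") (auto simp: 5)
      qed
      then show ?thesis by (simp add: u_def)
    qed
    finally show ?thesis .
  qed
  ultimately show ?thesis by blast
qed

lemma exists_simple_zeros:
  assumes "\<exists>A c. card (simple_zeros (u A c) (J - {0})) = k"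
  shows "\<exists>\<mu>0. (\<forall>\<rho>\<in>J. melnikov f T p q n m 1 \<mu>0 \<rho> = 0) \<and>
    card (simple_zeros (melnikov f T p q n m 2 \<mu>0) (J - {0})) = k"
proof -
  obtain A c where Ac: "card (simple_zeros (u A c) (J - {0})) = k" using assms by blast
  obtain \<mu> where \<mu>: "\<forall>\<rho>\<in>J. melnikov f T p q n m 1 \<mu> \<rho> = 0"
    "\<forall>\<rho>\<in>J. melnikov f T p q n m 2 \<mu> \<rho> = u A c \<rho>" using melnikov_2_realize by blast
  have "simple_zeros (melnikov f T p q n m 2 \<mu>) (J - {0}) = simple_zeros (u A c) (J - {0})"
    by (rule simple_zeros_cong[OF open_J]) (use \<mu> in auto)
  then show ?thesis using \<mu>(1) Ac by (intro exI[of _ \<mu>]) simp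
qed

lemma melnikov_2_nontrivial:
  assumes "\<forall>\<rho>\<in>J. melnikov f T p q n m 1 \<mu> \<rho> = 0" "\<exists>\<rho>\<in>J. melnikov f T p q n m 2 \<mu> \<rho> \<noteq> 0"
  obtains A c where "A \<noteq> 0 \<or> (\<exists>l\<le>L. c l \<noteq> 0)" "\<And>\<rho>. \<rho> \<in> J \<Longrightarrow> melnikov f T p q n m 2 \<mu> \<rho> = u A c \<rho>"
proof -
  obtain A c where Ac: "\<And>\<rho>. \<rho> \<in> J \<Longrightarrow> melnikov f T p q n m 2 \<mu> \<rho> = u A c \<rho>"
    using melnikov_2_form[OF assms(1)] by blast
  have "A \<noteq> 0 \<or> (\<exists>l\<le>L. c l \<noteq> 0)"
  proof (rule ccontr)
    assume "\<not> ?thesis"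
    then have "u A c \<rho> = 0" if "\<rho> \<in> J" for \<rho> using that by (simp add: u_def N_comb J_iff)
    then show False using assms(2) Ac by auto
  qed
  then show ?thesis using that Ac by blast
qed

end

section \<open>Bounds and sharpness in the four parity cases\<close>

theorem theorem2p2:
  fixes f :: "nat \<Rightarrow> real \<Rightarrow> real" and T :: real
    and p q n m m1 n1 K :: nat
    and J :: "real set" and M :: "nat \<Rightarrow> params \<Rightarrow> real \<Rightarrow> real"
  assumes T_pos: "T > 0"
    and pq: "p \<ge> 2" "q \<ge> 2" "p \<noteq> q"
    and nm: "n \<ge> 1" "m \<ge> 1"
    and analytic: "\<And>i. \<exists>U. open U \<and> {-T..T} \<subseteq> U \<and> real_analytic_on (f i) U"
    and f0_pos: "\<And>t. t \<in> {-T..T} \<Longrightarrow> f 0 t > 0"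
    and mean_zero: "\<And>k. k \<ge> 1 \<Longrightarrow> integral {-T..T} (f k) = 0"
    and m1: "m1 = card (nonodd_upto f T m) - 1" "m1 \<ge> 1"
    and n1: "n1 = card (nonodd_upto f T n) - 1" "n1 \<ge> 1"
    and a: "\<And>t. t \<in> {-T..T} \<Longrightarrow> f 1 (- t) = - f 1 t"
           "\<And>t. t \<in> {0..T} \<Longrightarrow> f 1 t \<ge> 0"
           "\<exists>t\<in>{0..T}. f 1 t \<noteq> 0"
    and b: "\<And>r. r \<ge> 1 \<Longrightarrow>
              CT_system (map (\<lambda>i. even_part (f i)) (sorted_list_of_set (nonodd_upto f T r))) {0<..<T}"
    and c: "infinite (odd_indices f T)" "infinite (nonodd_indices f T)"
           "\<And>k l. k \<ge> 1 \<Longrightarrow> l \<ge> 1 \<Longrightarrow>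
              (\<lambda>t. F_tilde_even f T l t * f_tilde_odd f T k t)
                \<in> B_space f T (k + l - 1) - B_space f T (k + l - 2)"
           "int m1 \<ge> min (int m - int m1 - 1) (int n1 - 1)"
    and K: "K = max (m - m1 + n1) (m1 + 1)"
    and J: "J = J_domain f T p"
    and M: "M = melnikov f T p q n m"
  shows
    "(odd p \<and> odd q \<longrightarrow>
       (\<forall>\<mu>. (\<forall>\<rho>\<in>J. M 1 \<mu> \<rho> = 0) \<and> (\<exists>\<rho>\<in>J. M 2 \<mu> \<rho> \<noteq> 0) \<longrightarrow>
          num_zeros_mult (M 2 \<mu>) (J \<inter> {0<..}) \<le> enat K \<and>
          num_zeros_mult (M 2 \<mu>) (J \<inter> {..<0}) \<le> enat K) \<and>
       (\<exists>\<mu>0. (\<forall>\<rho>\<in>J. M 1 \<mu>0 \<rho> = 0) \<and> card (simple_zeros (M 2 \<mu>0) (J - {0})) = 2 * K)) \<and>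
     (odd p \<and> even q \<longrightarrow>
       (\<forall>\<mu>. (\<forall>\<rho>\<in>J. M 1 \<mu> \<rho> = 0) \<and> (\<exists>\<rho>\<in>J. M 2 \<mu> \<rho> \<noteq> 0) \<longrightarrow>
          num_zeros_mult (M 2 \<mu>) (J \<inter> {0<..}) \<le> enat K \<and>
          num_zeros_mult (M 2 \<mu>) (J \<inter> {..<0}) \<le> enat K \<and>
          \<not> (num_zeros_mult (M 2 \<mu>) (J \<inter> {0<..}) = enat K \<and>
             num_zeros_mult (M 2 \<mu>) (J \<inter> {..<0}) = enat K)) \<and>
       (p < q \<longrightarrow>
          (\<exists>\<mu>0. (\<forall>\<rho>\<in>J. M 1 \<mu>0 \<rho> = 0) \<and> card (simple_zeros (M 2 \<mu>0) (J - {0})) = 2 * K - 1)) \<and>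
       (p > q \<longrightarrow>
          (\<exists>\<mu>0. (\<forall>\<rho>\<in>J. M 1 \<mu>0 \<rho> = 0) \<and> card (simple_zeros (M 2 \<mu>0) (J - {0})) = 2 * (K - 1)))) \<and>
     (even p \<and> odd q \<and> p < q \<longrightarrow>
       (\<forall>\<mu>. (\<forall>\<rho>\<in>J. M 1 \<mu> \<rho> = 0) \<and> (\<exists>\<rho>\<in>J. M 2 \<mu> \<rho> \<noteq> 0) \<longrightarrow>
          num_zeros_mult (M 2 \<mu>) (J \<inter> {0<..}) + num_zeros_mult (M 2 \<mu>) (J \<inter> {..<0}) \<le> enat K) \<and>
       (\<exists>\<mu>0. (\<forall>\<rho>\<in>J. M 1 \<mu>0 \<rho> = 0) \<and> card (simple_zeros (M 2 \<mu>0) (J - {0})) = K)) \<and>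
     (even p \<and> (even q \<or> p > q) \<longrightarrow>
       (\<forall>\<mu>. (\<forall>\<rho>\<in>J. M 1 \<mu> \<rho> = 0) \<and> (\<exists>\<rho>\<in>J. M 2 \<mu> \<rho> \<noteq> 0) \<longrightarrow>
          num_zeros_mult (M 2 \<mu>) (J \<inter> {0<..}) + num_zeros_mult (M 2 \<mu>) (J \<inter> {..<0}) \<le> enat (K + 1)) \<and>
       (\<exists>\<mu>0. (\<forall>\<rho>\<in>J. M 1 \<mu>0 \<rho> = 0) \<and> card (simple_zeros (M 2 \<mu>0) (J - {0})) = K + 1))"
proof -
  obtain U where U: "open U" "{-T..T} \<subseteq> U" "real_analytic_on (f 1) U" using analytic by blast
  have f_cont: "continuous_on {-T..T} (f i)" for i
  proof -
    obtain V where "{-T..T} \<subseteq> V" "real_analytic_on (f i) V" using analytic by blast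
    then show ?thesis using real_analytic_isCont
      by (intro continuous_at_imp_continuous_on) blast
  qed
  interpret perturbed_abel_family f T p q n m m1 n1
    by unfold_locales
      (use T_pos pq f_cont a mean_zero f0_pos m1 n1 nm b c primitive_strict_mono[OF T_pos U(2,3) a(2,3)]
        in \<open>auto simp del: One_nat_def\<close>)
  have K: "K = L + 1" using K k1_pos by (auto simp: L_def k1_def)
  have J: "J = J_domain f T p" by (rule J)
  have sides: "J \<inter> {0<..} \<union> J \<inter> {..<0} \<subseteq> J - {0}" "J \<inter> {0<..} \<inter> (J \<inter> {..<0}) = {}" by auto
  have "num_zeros_mult (M 2 \<mu>) (J \<inter> I) \<le> enat K"
    if \<mu>: "\<forall>\<rho>\<in>J. M 1 \<mu> \<rho> = 0" "\<exists>\<rho>\<in>J. M 2 \<mu> \<rho> \<noteq> 0" and I: "I = {0<..} \<or> I = {..<0}" for \<mu> I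
  proof -
    obtain A c where "A \<noteq> 0 \<or> (\<exists>l\<le>L. c l \<noteq> 0)" "\<And>\<rho>. \<rho> \<in> J \<Longrightarrow> M 2 \<mu> \<rho> = u A c \<rho>"
      using melnikov_2_nontrivial[of \<mu>] \<mu> unfolding J M by blast
    from num_zeros_mult_le[OF bound_one_side[OF this[unfolded J] I]] show ?thesis
      by (simp add: K J)
  qed
  note one = this
  have two: "num_zeros_mult (M 2 \<mu>) (J \<inter> {0<..}) + num_zeros_mult (M 2 \<mu>) (J \<inter> {..<0}) \<le> enat k"
    if \<mu>: "\<forall>\<rho>\<in>J. M 1 \<mu> \<rho> = 0" "\<exists>\<rho>\<in>J. M 2 \<mu> \<rho> \<noteq> 0"
      and bound: "\<And>A c. A \<noteq> 0 \<or> (\<exists>l\<le>L. c l \<noteq> 0) \<Longrightarrow> (\<And>\<rho>. \<rho> \<in> J \<Longrightarrow> M 2 \<mu> \<rho> = u A c \<rho>) \<Longrightarrow>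
        zeros_bounded (M 2 \<mu>) (J - {0}) k" for \<mu> k
  proof -
    obtain A c where "A \<noteq> 0 \<or> (\<exists>l\<le>L. c l \<noteq> 0)" "\<And>\<rho>. \<rho> \<in> J \<Longrightarrow> M 2 \<mu> \<rho> = u A c \<rho>"
      using melnikov_2_nontrivial[of \<mu>] \<mu> unfolding J M by blast
    from bound[OF this] sides(1) have "zeros_bounded (M 2 \<mu>) (J \<inter> {0<..} \<union> J \<inter> {..<0}) k"
      by (rule zeros_bounded_subset)
    then show ?thesis using sides(2) by (rule num_zeros_mult_add_le)
  qed
  have ex: "\<exists>\<mu>0. (\<forall>\<rho>\<in>J. M 1 \<mu>0 \<rho> = 0) \<and> card (simple_zeros (M 2 \<mu>0) (J - {0})) = k"
    if "\<exists>A c. card (simple_zeros (u A c) (J - {0})) = k" for k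
    using exists_simple_zeros[of k] that unfolding J M .
  show ?thesis
  proof (intro conjI impI)
    assume p: "odd p \<and> odd q"
    show "\<forall>\<mu>. (\<forall>\<rho>\<in>J. M 1 \<mu> \<rho> = 0) \<and> (\<exists>\<rho>\<in>J. M 2 \<mu> \<rho> \<noteq> 0) \<longrightarrow>
        num_zeros_mult (M 2 \<mu>) (J \<inter> {0<..}) \<le> enat K \<and> num_zeros_mult (M 2 \<mu>) (J \<inter> {..<0}) \<le> enat K"
      using one by simp
    show "\<exists>\<mu>0. (\<forall>\<rho>\<in>J. M 1 \<mu>0 \<rho> = 0) \<and> card (simple_zeros (M 2 \<mu>0) (J - {0})) = 2 * K"
      using exists_odd_odd p unfolding K by (intro ex) (simp add: J)
  next
    assume p: "odd p \<and> even q"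
    show "\<forall>\<mu>. (\<forall>\<rho>\<in>J. M 1 \<mu> \<rho> = 0) \<and> (\<exists>\<rho>\<in>J. M 2 \<mu> \<rho> \<noteq> 0) \<longrightarrow>
        num_zeros_mult (M 2 \<mu>) (J \<inter> {0<..}) \<le> enat K \<and> num_zeros_mult (M 2 \<mu>) (J \<inter> {..<0}) \<le> enat K \<and>
        \<not> (num_zeros_mult (M 2 \<mu>) (J \<inter> {0<..}) = enat K \<and> num_zeros_mult (M 2 \<mu>) (J \<inter> {..<0}) = enat K)"
    proof (intro allI impI)
      fix \<mu> assume \<mu>: "(\<forall>\<rho>\<in>J. M 1 \<mu> \<rho> = 0) \<and> (\<exists>\<rho>\<in>J. M 2 \<mu> \<rho> \<noteq> 0)"
      \<comment> \<open>The joint bound 2 L + 1 is one less than 2 K, so the two sides cannot both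
        reach \<open>K\<close>.\<close>
      have "num_zeros_mult (M 2 \<mu>) (J \<inter> {0<..}) + num_zeros_mult (M 2 \<mu>) (J \<inter> {..<0}) \<le> enat (2 * L + 1)"
        by (rule two) (use \<mu> p bound_odd_even in \<open>auto simp: J\<close>)
      then have "\<not> (num_zeros_mult (M 2 \<mu>) (J \<inter> {0<..}) = enat K \<and> num_zeros_mult (M 2 \<mu>) (J \<inter> {..<0}) = enat K)"
        by (auto simp: K)
      then show "num_zeros_mult (M 2 \<mu>) (J \<inter> {0<..}) \<le> enat K \<and> num_zeros_mult (M 2 \<mu>) (J \<inter> {..<0}) \<le> enat K \<and>
        \<not> (num_zeros_mult (M 2 \<mu>) (J \<inter> {0<..}) = enat K \<and> num_zeros_mult (M 2 \<mu>) (J \<inter> {..<0}) = enat K)"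
        using one \<mu> by simp
    qed
    show "\<exists>\<mu>0. (\<forall>\<rho>\<in>J. M 1 \<mu>0 \<rho> = 0) \<and> card (simple_zeros (M 2 \<mu>0) (J - {0})) = 2 * K - 1" if "p < q"
      using exists_odd_even_less p that unfolding K by (intro ex) (simp add: J)
    show "\<exists>\<mu>0. (\<forall>\<rho>\<in>J. M 1 \<mu>0 \<rho> = 0) \<and> card (simple_zeros (M 2 \<mu>0) (J - {0})) = 2 * (K - 1)" if "p > q"
      using exists_odd_even_greater p that unfolding K by (intro ex) (simp add: J)
  next
    assume p: "even p \<and> odd q \<and> p < q"
    show "\<forall>\<mu>. (\<forall>\<rho>\<in>J. M 1 \<mu> \<rho> = 0) \<and> (\<exists>\<rho>\<in>J. M 2 \<mu> \<rho> \<noteq> 0) \<longrightarrow>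
        num_zeros_mult (M 2 \<mu>) (J \<inter> {0<..}) + num_zeros_mult (M 2 \<mu>) (J \<inter> {..<0}) \<le> enat K"
    proof (intro allI impI)
      fix \<mu> assume "(\<forall>\<rho>\<in>J. M 1 \<mu> \<rho> = 0) \<and> (\<exists>\<rho>\<in>J. M 2 \<mu> \<rho> \<noteq> 0)"
      then show "num_zeros_mult (M 2 \<mu>) (J \<inter> {0<..}) + num_zeros_mult (M 2 \<mu>) (J \<inter> {..<0}) \<le> enat K"
        by (intro two) (use p bound_even_odd in \<open>auto simp: J K\<close>)
    qed
    show "\<exists>\<mu>0. (\<forall>\<rho>\<in>J. M 1 \<mu>0 \<rho> = 0) \<and> card (simple_zeros (M 2 \<mu>0) (J - {0})) = K"
      using exists_even_odd p unfolding K by (intro ex) (simp add: J)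
  next
    assume p: "even p \<and> (even q \<or> p > q)"
    show "\<forall>\<mu>. (\<forall>\<rho>\<in>J. M 1 \<mu> \<rho> = 0) \<and> (\<exists>\<rho>\<in>J. M 2 \<mu> \<rho> \<noteq> 0) \<longrightarrow>
        num_zeros_mult (M 2 \<mu>) (J \<inter> {0<..}) + num_zeros_mult (M 2 \<mu>) (J \<inter> {..<0}) \<le> enat (K + 1)"
    proof (intro allI impI)
      fix \<mu> assume "(\<forall>\<rho>\<in>J. M 1 \<mu> \<rho> = 0) \<and> (\<exists>\<rho>\<in>J. M 2 \<mu> \<rho> \<noteq> 0)"
      then show "num_zeros_mult (M 2 \<mu>) (J \<inter> {0<..}) + num_zeros_mult (M 2 \<mu>) (J \<inter> {..<0}) \<le> enat (K + 1)"
        by (intro two) (use p bound_even in \<open>auto simp: J K\<close>)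
    qed
    show "\<exists>\<mu>0. (\<forall>\<rho>\<in>J. M 1 \<mu>0 \<rho> = 0) \<and> card (simple_zeros (M 2 \<mu>0) (J - {0})) = K + 1"
      using exists_even p unfolding K by (intro ex) (simp add: J)
  qed
qed

end
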